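(* Let $G$ be an infinite algorithmically finite group generated by a finite set $X$, and let $S\subseteq F(X)$ be a subset such that the Equality Problem in $G$ is decidable on $S$. Then $S$ is negligible. Moreover, if $G$ is non-amenable, then $S$ is strongly negligible.
   Context: For a finite set $X$, $F(X)$ is the free group on $X$, viewed as the set of freely reduced words in $X\cup X^{-1}$, with word length $|\cdot|$. A subset of $F(X)$ is computably enumerable if some algorithm enumerates its elements. A group $G$ generated by a finite set $X$, with canonical epimorphism $\eta:F(X)\to G$, is algorithmically finite if for every infinite computably enumerable subset $W\subseteq F(X)$ there exist two distinct words $u,v\in W$ with $\eta(u)=\eta(v)$. The Equality Problem (EP) in $G$ is: given $u,v\in F(X)$, decide whether $\eta(u)=\eta(v)$. EP is decidable in $G$ on a set $S\subseteq F(X)$ if there is a partial decision algorithm for EP (one which takes pairs of words and answers correctly whether they are equal in $G$ whenever it halts) that halts on all pairs from $S\times S$. Let $S_n=\{w\in F(X): |w|=n\}$ and, for $T\subseteq F(X)$, $\rho_n(T)=|T\cap S_n|/|S_n|$. The set $T$ is negligible if $\rho_n(T)\to 0$ as $n\to\infty$ (equivalently, its complement is generic, i.e., $\rho_n(F(X)\setminus T)\to 1$), and strongly negligible if there exists $t>1$ such that $\rho_n(T)=O(t^{-n})$ as $n\to\infty$. *)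

theory Defs
  imports "HOL-Algebra.Generated_Groups" "HOL-Algebra.Coset" "HOL-Library.Landau_Symbols"
    "HOL-Library.Nat_Bijection" "HOL-Library.Countable_Set"
begin

section \<open>Partial recursive functions\<close>

text \<open>Programs for the partial recursive functions. Arities are not part of the syntax: a program
  is run on a list of arguments, and simply has no value on a list of unsuitable length.\<close>

datatype recf = Zero | Succ | Proj nat | Comp recf "recf list" | Prim recf recf | Mu recf

text \<open>\<open>recf_eval p xs y\<close>: the program \<open>p\<close> halts on input \<open>xs\<close> with output \<open>y\<close>.
  In the rule \<open>Mu\<close>, all values of \<open>f\<close> below the zero found have to be defined.\<close>

inductive recf_eval :: "recf \<Rightarrow> nat list \<Rightarrow> nat \<Rightarrow> bool" where
  Zero: "recf_eval Zero xs 0"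
| Succ: "recf_eval Succ [x] (Suc x)"
| Proj: "i < length xs \<Longrightarrow> recf_eval (Proj i) xs (xs ! i)"
| Comp: "list_all2 (\<lambda>g y. recf_eval g xs y) gs ys \<Longrightarrow> recf_eval f ys z
    \<Longrightarrow> recf_eval (Comp f gs) xs z"
| Prim_0: "recf_eval f xs z \<Longrightarrow> recf_eval (Prim f g) (0 # xs) z"
| Prim_Suc: "recf_eval (Prim f g) (n # xs) y \<Longrightarrow> recf_eval g (n # y # xs) z
    \<Longrightarrow> recf_eval (Prim f g) (Suc n # xs) z"
| Mu: "recf_eval f (n # xs) 0 \<Longrightarrow> (\<And>m. m < n \<Longrightarrow> \<exists>k. recf_eval f (m # xs) (Suc k))
    \<Longrightarrow> recf_eval (Mu f) xs n"

lemma recf_eval_deterministic: "recf_eval p xs y \<Longrightarrow> recf_eval p xs z \<Longrightarrow> y = z"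
proof (induction p xs y arbitrary: z rule: recf_eval.induct)
  case (Zero xs)
  then show ?case by (auto elim: recf_eval.cases)
next
  case (Succ x)
  then show ?case by (auto elim: recf_eval.cases)
next
  case (Proj i xs)
  from Proj(2) show ?case by (cases rule: recf_eval.cases) auto
next
  case (Comp xs gs ys f z z')
  from Comp.prems obtain ys' where ys': "list_all2 (\<lambda>g y. recf_eval g xs y) gs ys'"
    "recf_eval f ys' z'"
    by (cases rule: recf_eval.cases) auto
  have "ys = ys'"
    using Comp(1) ys'(1) by (auto simp: list_all2_conv_all_nth intro!: nth_equalityI)
  then show ?case using Comp.IH ys'(2) by blast
next
  case (Prim_0 f xs z g z')
  from Prim_0.prems show ?case by (cases rule: recf_eval.cases) (auto dest: Prim_0.IH)
next
  case (Prim_Suc f g n xs y z z')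
  from Prim_Suc.prems show ?case
    by (cases rule: recf_eval.cases) (use Prim_Suc.IH in blast)
next
  case (Mu f n xs z)
  from Mu.prems have z: "recf_eval f (z # xs) 0" "\<And>m. m < z \<Longrightarrow> \<exists>k. recf_eval f (m # xs) (Suc k)"
    by (cases rule: recf_eval.cases; simp)+
  show ?case
  proof (cases n z rule: linorder_cases)
    case less
    then show ?thesis using z(2) Mu.IH(1) by fastforce
  next
    case greater
    then show ?thesis using z(1) Mu.IH(2) by fastforce
  qed
qed

text \<open>Computably enumerable: listed by an algorithm, that is, the range of a unary partial
  recursive function.\<close>

definition ce_set :: "nat set \<Rightarrow> bool" where
  "ce_set A \<longleftrightarrow> (\<exists>p. A = {y. \<exists>n. recf_eval p [n] y})"


section \<open>Reduced words\<close>

text \<open>The letter \<open>(x, True)\<close> stands for \<open>x\<close> and \<open>(x, False)\<close> for the formal inverse of \<open>x\<close>.\<close>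

type_synonym 'a word = "('a \<times> bool) list"

definition reduced :: "'a word \<Rightarrow> bool" where
  "reduced w \<longleftrightarrow> successively (\<lambda>a b. \<not> (fst a = fst b \<and> snd a \<noteq> snd b)) w"

definition free_words :: "'a set \<Rightarrow> 'a word set" where
  "free_words X = {w. set w \<subseteq> X \<times> UNIV \<and> reduced w}"

definition sphere_words :: "'a set \<Rightarrow> nat \<Rightarrow> 'a word set" where
  "sphere_words X n = {w \<in> free_words X. length w = n}"

definition word_value :: "('a, 'm) monoid_scheme \<Rightarrow> 'a word \<Rightarrow> 'a" where
  "word_value G w =
     foldr (\<lambda>(x, b) g. (if b then x else inv\<^bsub>G\<^esub> x) \<otimes>\<^bsub>G\<^esub> g) w \<one>\<^bsub>G\<^esub>"

definition density :: "'a set \<Rightarrow> 'a word set \<Rightarrow> nat \<Rightarrow> real" where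
  "density X T n = real (card (T \<inter> sphere_words X n)) / real (card (sphere_words X n))"

definition negligible_words :: "'a set \<Rightarrow> 'a word set \<Rightarrow> bool" where
  "negligible_words X T \<longleftrightarrow> density X T \<longlonglongrightarrow> 0"

definition strongly_negligible_words :: "'a set \<Rightarrow> 'a word set \<Rightarrow> bool" where
  "strongly_negligible_words X T \<longleftrightarrow>
     (\<exists>t::real. t > 1 \<and> density X T \<in> O(\<lambda>n. t powr (- real n)))"


section \<open>Algorithms on words\<close>

text \<open>For finite \<open>X\<close>, \<open>to_nat_on X\<close> is a bijection from \<open>X\<close> onto \<open>{..<card X}\<close>. The notions below do
  not depend on which bijection is used, since permutations of a finite alphabet are computable.\<close>

definition word_code :: "'a set \<Rightarrow> 'a word \<Rightarrow> nat" where
  "word_code X w = list_encode (map (\<lambda>(x, b). 2 * to_nat_on X x + of_bool b) w)"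

definition ce_words :: "'a set \<Rightarrow> 'a word set \<Rightarrow> bool" where
  "ce_words X W \<longleftrightarrow> W \<subseteq> free_words X \<and> ce_set (word_code X ` W)"

definition algorithmically_finite :: "('a, 'm) monoid_scheme \<Rightarrow> 'a set \<Rightarrow> bool" where
  "algorithmically_finite G X \<longleftrightarrow>
     (\<forall>W. infinite W \<and> ce_words X W \<longrightarrow>
        (\<exists>u\<in>W. \<exists>v\<in>W. u \<noteq> v \<and> word_value G u = word_value G v))"

text \<open>The output \<open>1\<close> means ``equal'' and \<open>0\<close> means ``not equal''.\<close>

definition partial_EP_algorithm :: "('a, 'm) monoid_scheme \<Rightarrow> 'a set \<Rightarrow> recf \<Rightarrow> bool" where
  "partial_EP_algorithm G X p \<longleftrightarrow>
     (\<forall>u\<in>free_words X. \<forall>v\<in>free_words X. \<forall>y.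
        recf_eval p [word_code X u, word_code X v] y \<longrightarrow>
        y = (if word_value G u = word_value G v then 1 else 0))"

definition EP_decidable_on :: "('a, 'm) monoid_scheme \<Rightarrow> 'a set \<Rightarrow> 'a word set \<Rightarrow> bool" where
  "EP_decidable_on G X S \<longleftrightarrow>
     (\<exists>p. partial_EP_algorithm G X p \<and>
        (\<forall>u\<in>S. \<forall>v\<in>S. \<exists>y. recf_eval p [word_code X u, word_code X v] y))"


section \<open>Amenability\<close>

text \<open>Amenability as a discrete group: there is a finitely additive left-invariant probability
  measure defined on all subsets of the group.\<close>

definition amenable :: "('a, 'm) monoid_scheme \<Rightarrow> bool" where
  "amenable G \<longleftrightarrow>
     (\<exists>\<mu> :: 'a set \<Rightarrow> real.
        (\<forall>A. A \<subseteq> carrier G \<longrightarrow> 0 \<le> \<mu> A) \<and>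
        \<mu> (carrier G) = 1 \<and>
        (\<forall>A B. A \<subseteq> carrier G \<and> B \<subseteq> carrier G \<and> A \<inter> B = {} \<longrightarrow> \<mu> (A \<union> B) = \<mu> A + \<mu> B) \<and>
        (\<forall>g\<in>carrier G. \<forall>A. A \<subseteq> carrier G \<longrightarrow> \<mu> (g <#\<^bsub>G\<^esub> A) = \<mu> A))"

end

theory Submission
  imports Defs "HOL-Analysis.Function_Topology" "HOL-Analysis.Convex" "HOL-Algebra.Zassenhaus"
begin

text \<open>
  Let \<open>p\<close> be a partial algorithm for the Equality Problem that halts on \<open>S \<times> S\<close>. The set \<open>S\<close> is
  arbitrary, so there may be no way to list it, and its image in \<open>G\<close> may be infinite; but \<open>p\<close> can be used to
  certify inequalities of arbitrary words. If \<open>p\<close> says that \<open>a\<close> and \<open>b\<close> differ in \<open>G\<close>, while \<open>a\<close> can be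
  transformed into \<open>b\<close> by relations that hold in \<open>G\<close> together with the extra relation \<open>u = w\<close>, then
  \<open>u\<close> and \<open>w\<close> differ in \<open>G\<close>; call \<open>u\<close> and \<open>w\<close> \<^emph>\<open>separated\<close> in this case. This is a semidecidable
  relation.

  Suppose that \<open>u\<close> and \<open>w\<close> are not separated. Then \<open>S\<close> is thin: two words of \<open>S\<close> that are congruent
  modulo \<open>u = w\<close> have the same value in \<open>G\<close>. Let \<open>N\<close> be the set of values of the words that are
  congruent to the empty word, a normal subgroup of \<open>G\<close> (\<open>relator_subgroup u w\<close>) that contains
  \<open>u\<^sup>-\<^sup>1 w\<close>. A finite set \<open>E \<subseteq> N\<close> is represented by congruent words of one length with one first and one
  last letter, so that these words can replace each other inside reduced words. A random long reduced
  word contains linearly many such exchangeable blocks, and all words that arise from it by exchanges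
  are congruent, so those of them that lie in \<open>S\<close> have one value. If \<open>N\<close> is infinite, \<open>E\<close> can be as
  large as desired; among the words that differ in a single block, at most one in \<open>card E\<close> lies in
  \<open>S\<close>, and \<open>S\<close> is negligible (\<open>infinite_relator_subgroup_negligible\<close>). If there are no functions on
  \<open>G\<close> that are almost invariant under \<open>N\<close>, then, for some \<open>E\<close>, averaging over \<open>E\<close> contracts the
  square norm on \<open>G\<close> by a factor below 1; as every block contributes such a factor, the proportion of
  exchanges with a prescribed value is exponentially small, and \<open>S\<close> is strongly negligible
  (\<open>not_reiter_relator_subgroup_strongly_negligible\<close>).

  Assume now that \<open>S\<close> is not negligible, and let \<open>\<Q>\<close> be the class of finite normal subgroups; or that
  \<open>G\<close> is not amenable and \<open>S\<close> is not strongly negligible, and let \<open>\<Q>\<close> be the class of normal subgroups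
  with almost invariant functions on \<open>G\<close>. By the preceding paragraph, \<open>u\<^sup>-\<^sup>1 w\<close> lies in a member of \<open>\<Q>\<close>
  unless \<open>u\<close> and \<open>w\<close> are separated. The class \<open>\<Q>\<close> is closed under products, and no member has finite
  index, since \<open>G\<close> is infinite, respectively not amenable. As \<open>G\<close> is finitely generated, finitely many
  cosets of the union of \<open>\<Q>\<close> do not cover \<open>G\<close> (\<open>fresh_word\<close>). Hence, given any finite list of words,
  there is a further word separated from all of them, and a search finds one. In this way an
  algorithm lists infinitely many words with distinct values (\<open>unseparated_pair_exists\<close>),
  which contradicts algorithmic finiteness.

  Algorithmic finiteness is used once more at the outset: applied to the powers of a generator, it
  shows that all generators have finite order. So inverses are represented by positive words, and the
  words to be listed and to be exchanged can be taken positive, which rules out free cancellation.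
\<close>

section \<open>Total computable functions\<close>

text \<open>Only unary functions are considered; several arguments are combined by Cantor pairing, so that
  lists are handled through the same pairing by their codes.\<close>

definition computable :: "(nat \<Rightarrow> nat) \<Rightarrow> bool" where
  "computable f \<longleftrightarrow> (\<exists>p. \<forall>x. recf_eval p [x] (f x))"

abbreviation pair :: "nat \<Rightarrow> nat \<Rightarrow> nat" where "pair a b \<equiv> prod_encode (a, b)"
definition pr1 :: "nat \<Rightarrow> nat" where "pr1 z = fst (prod_decode z)"
definition pr2 :: "nat \<Rightarrow> nat" where "pr2 z = snd (prod_decode z)"

lemma pr_pair [simp]: "pr1 (pair a b) = a" "pr2 (pair a b) = b" "pair (pr1 z) (pr2 z) = z"
  by (simp_all add: pr1_def pr2_def)

lemma recf_eval_Comp1: "recf_eval g xs a \<Longrightarrow> recf_eval f [a] z \<Longrightarrow> recf_eval (Comp f [g]) xs z"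
  by (rule recf_eval.Comp) auto

lemma recf_eval_Comp2:
  "recf_eval g xs a \<Longrightarrow> recf_eval h xs b \<Longrightarrow> recf_eval f [a, b] z \<Longrightarrow> recf_eval (Comp f [g, h]) xs z"
  by (rule recf_eval.Comp) auto

lemma recf_eval_Proj0: "recf_eval (Proj 0) (x # xs) x"
  using recf_eval.Proj[of 0 "x # xs"] by simp

lemma recf_eval_Proj1: "recf_eval (Proj (Suc 0)) (x # y # xs) y"
  using recf_eval.Proj[of 1 "x # y # xs"] by simp

lemma recf_eval_Proj2: "recf_eval (Proj 2) (x # y # z # xs) z"
  using recf_eval.Proj[of 2 "x # y # z # xs"] by simp

lemmas recf_basic = recf_eval.Zero recf_eval.Succ recf_eval_Proj0 recf_eval_Proj1 recf_eval_Proj2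
  recf_eval_Comp1 recf_eval_Comp2

definition rec_add :: recf where "rec_add = Prim (Proj 0) (Comp Succ [Proj (Suc 0)])"
definition rec_pred :: recf where "rec_pred = Prim Zero (Proj 0)"
definition rec_sub :: recf where "rec_sub = Prim (Proj 0) (Comp rec_pred [Proj (Suc 0)])"
definition rec_triangle :: recf where
  "rec_triangle = Prim Zero (Comp Succ [Comp rec_add [Proj 0, Proj (Suc 0)]])"
definition rec_pair :: recf where
  "rec_pair = Comp rec_add [Comp rec_triangle [rec_add], Proj 0]"
definition rec_diag :: recf where
  "rec_diag = Mu (Comp rec_sub [Comp rec_triangle [Comp Succ [Proj 0]], Comp Succ [Proj (Suc 0)]])"

lemma recf_eval_add: "recf_eval rec_add [n, x] (n + x)"
  unfolding rec_add_def
  by (induction n) (auto intro!: recf_basic recf_eval.Prim_0 recf_eval.Prim_Suc)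

lemma recf_eval_pred: "recf_eval rec_pred [n] (n - 1)"
  unfolding rec_pred_def
  by (induction n) (auto intro!: recf_basic recf_eval.Prim_0 intro: recf_eval.Prim_Suc)

lemma recf_eval_sub: "recf_eval rec_sub [n, x] (x - n)"
  unfolding rec_sub_def
proof (induction n)
  case (Suc n)
  have "recf_eval (Comp rec_pred [Proj (Suc 0)]) [n, x - n, x] (x - Suc n)"
    using recf_eval_pred[of "x - n"] by (auto intro!: recf_basic)
  with Suc show ?case by (rule recf_eval.Prim_Suc)
qed (auto intro!: recf_basic recf_eval.Prim_0)

lemma recf_eval_triangle: "recf_eval rec_triangle [n] (triangle n)"
  unfolding rec_triangle_def
proof (induction n)
  case (Suc n)
  have "recf_eval (Comp Succ [Comp rec_add [Proj 0, Proj (Suc 0)]]) [n, triangle n] (Suc (n + triangle n))"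
    by (rule recf_basic recf_eval_add)+
  with Suc show ?case by (auto intro: recf_eval.Prim_Suc simp: add.commute)
qed (auto intro!: recf_basic recf_eval.Prim_0)

lemma recf_eval_pair: "recf_eval rec_pair [a, b] (pair a b)"
  unfolding rec_pair_def prod_encode_def prod.case
  by (rule recf_basic recf_eval_add recf_eval_triangle)+

lemma triangle_mono: "m \<le> n \<Longrightarrow> triangle m \<le> triangle n"
  by (rule lift_Suc_mono_le[of triangle]) auto

text \<open>The sum of the two components of \<open>x\<close> is the index of the diagonal of
  \<open>x\<close> in Cantor's enumeration, that is, the least \<open>k\<close> such that
  \<open>x\<close> is below the triangular number of \<open>k + 1\<close>; unbounded search finds
  it.\<close>

lemma recf_eval_diag: "recf_eval rec_diag [x] (pr1 x + pr2 x)"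
proof -
  let ?k = "pr1 x + pr2 x"
  let ?f = "Comp rec_sub [Comp rec_triangle [Comp Succ [Proj 0]], Comp Succ [Proj (Suc 0)]]"
  have x: "x = triangle ?k + pr1 x"
    using pr_pair(3)[of x] unfolding prod_encode_def prod.case by simp
  have ev: "recf_eval ?f [k, x] (Suc x - triangle (Suc k))" for k
    by (rule recf_basic recf_eval_sub recf_eval_triangle)+
  have "recf_eval ?f [?k, x] 0"
    using ev[of ?k] x by (simp del: diff_Suc_Suc)
  moreover have "\<exists>j. recf_eval ?f [m, x] (Suc j)" if "m < ?k" for m
  proof -
    have "triangle (Suc m) \<le> x"
      using triangle_mono[of "Suc m" ?k] that x by linarith
    then show ?thesis using ev[of m] by (metis Suc_diff_le)
  qed
  ultimately show ?thesis unfolding rec_diag_def by (rule recf_eval.Mu)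
qed

lemma computable_id: "computable (\<lambda>x. x)"
  unfolding computable_def by (rule exI[of _ "Proj 0"]) (auto intro!: recf_basic)

lemma computable_compose:
  assumes "computable g" "computable f" shows "computable (\<lambda>x. g (f x))"
  using assms unfolding computable_def by (meson recf_eval_Comp1)

lemma computable_Suc: "computable f \<Longrightarrow> computable (\<lambda>x. Suc (f x))"
  by (rule computable_compose[of Suc]) (auto simp: computable_def intro: recf_eval.Succ)

lemma computable_const: "computable (\<lambda>_. c)"
proof (induction c)
  case 0
  show ?case unfolding computable_def by (auto intro: recf_eval.Zero)
qed (rule computable_Suc)

lemma computable_binary:
  assumes "\<And>a b. recf_eval p [a, b] (h a b)" "computable f" "computable g"
  shows "computable (\<lambda>x. h (f x) (g x))"
  using assms unfolding computable_def by (meson recf_eval_Comp2)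

lemma computable_pair: "computable f \<Longrightarrow> computable g \<Longrightarrow> computable (\<lambda>x. pair (f x) (g x))"
  by (rule computable_binary[OF recf_eval_pair])

lemma computable_add: "computable f \<Longrightarrow> computable g \<Longrightarrow> computable (\<lambda>x. f x + g x)"
  by (rule computable_binary[OF recf_eval_add])

lemma computable_diff: "computable f \<Longrightarrow> computable g \<Longrightarrow> computable (\<lambda>x. f x - g x)"
  by (rule computable_binary[OF recf_eval_sub])

lemma computable_triangle: "computable triangle"
  unfolding computable_def using recf_eval_triangle by blast

lemma computable_diag: "computable (\<lambda>x. pr1 x + pr2 x)"
  unfolding computable_def using recf_eval_diag by blast

lemma computable_pr1: "computable f \<Longrightarrow> computable (\<lambda>x. pr1 (f x))"
proof (rule computable_compose[of pr1])
  have "pr1 x = x - triangle (pr1 x + pr2 x)" for x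
    using pr_pair(3)[of x] unfolding prod_encode_def prod.case by simp
  moreover have "computable (\<lambda>x. x - triangle (pr1 x + pr2 x))"
    by (intro computable_diff computable_id computable_compose[OF computable_triangle computable_diag])
  ultimately show "computable pr1" by presburger
qed

lemma computable_pr2: "computable f \<Longrightarrow> computable (\<lambda>x. pr2 (f x))"
proof (rule computable_compose[of pr2])
  have "computable (\<lambda>x. (pr1 x + pr2 x) - pr1 x)"
    by (intro computable_diff computable_id computable_pr1 computable_diag)
  then show "computable pr2" by simp
qed

lemma computable_funpow:
  assumes "computable g" "computable h" "computable f"
  shows "computable (\<lambda>x. (g ^^ h x) (f x))"
proof -
  obtain p where p: "\<And>x. recf_eval p [x] (g x)" using assms(1) unfolding computable_def by blast
  have "recf_eval (Prim (Proj 0) (Comp p [Proj (Suc 0)])) [n, y] ((g ^^ n) y)" for n y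
    by (induction n) (auto intro!: recf_basic recf_eval.Prim_0 recf_eval.Prim_Suc p)
  then show ?thesis using assms(2,3) by (rule computable_binary)
qed

lemma computable_if:
  assumes "computable c" "computable f" "computable g"
  shows "computable (\<lambda>x. if c x = 0 then f x else g x)"
proof -
  obtain p q where pq: "\<And>x. recf_eval p [x] (f x)" "\<And>x. recf_eval q [x] (g x)"
    using assms(2,3) unfolding computable_def by blast
  have "recf_eval (Prim p (Comp q [Proj 2])) [n, x] (if n = 0 then f x else g x)" for n x
  proof (induction n)
    case 0
    show ?case using pq(1) by (simp add: recf_eval.Prim_0)
  next
    case (Suc n)
    have "recf_eval (Comp q [Proj 2]) [n, if n = 0 then f x else g x, x] (g x)"
      by (rule recf_basic pq)+
    with Suc show ?case by (auto intro: recf_eval.Prim_Suc)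
  qed
  then show ?thesis
    by (rule computable_binary[of _ "\<lambda>n x. if n = 0 then f x else g x"]) (intro assms(1) computable_id)+
qed

lemma computable_sum:
  assumes "computable f" "computable h"
  shows "computable (\<lambda>x. \<Sum>i<h x. f (pair x i))"
proof -
  define st where "st = (\<lambda>z. pair (pair (pr1 (pr1 z)) (Suc (pr2 (pr1 z)))) (pr2 z + f (pr1 z)))"
  have "(st ^^ n) (pair (pair x 0) 0) = pair (pair x n) (\<Sum>i<n. f (pair x i))" for n x
    by (induction n) (auto simp: st_def)
  then have eq: "(\<Sum>i<h x. f (pair x i)) = pr2 ((st ^^ h x) (pair (pair x 0) 0))" for x by simp
  have "computable st" unfolding st_def
    by (intro computable_pair computable_pr1 computable_pr2 computable_Suc computable_add
        computable_compose[OF assms(1)] computable_id)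
  then show ?thesis unfolding eq
    by (intro computable_pr2 computable_funpow computable_pair assms computable_id computable_const)
qed

text \<open>The entry of index \<open>i\<close> of the list coded by \<open>t\<close>, for \<open>i\<close>
  below its length. Since every finite sequence has a code, quantifying over \<open>t\<close> in
  \<open>cnth t\<close> amounts to quantifying over finite sequences.\<close>

definition cnth :: "nat \<Rightarrow> nat \<Rightarrow> nat" where
  "cnth t i = pr1 (((\<lambda>t. pr2 (t - 1)) ^^ i) t - 1)"

lemma cnth: "i < length xs \<Longrightarrow> cnth (list_encode xs) i = xs ! i"
  unfolding cnth_def
proof (induction xs arbitrary: i)
  case (Cons x xs)
  then show ?case by (cases i) (auto simp: funpow_Suc_right simp del: funpow.simps)
qed simp

lemma computable_cnth: "computable f \<Longrightarrow> computable g \<Longrightarrow> computable (\<lambda>x. cnth (f x) (g x))"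
  unfolding cnth_def
  by (intro computable_pr1 computable_diff computable_funpow computable_pr2 computable_id computable_const)

text \<open>The code of a list serves as a bound for the number of steps of an iteration along the list.\<close>

lemma list_code_le: "length xs \<le> list_encode xs"
proof (induction xs)
  case (Cons x xs)
  then show ?case using le_prod_encode_2[of "list_encode xs" x] by simp
qed simp

lemma computable_foldl:
  assumes "computable (\<lambda>z. g (pr1 z) (pr2 z))" "computable f" "computable h"
  shows "computable (\<lambda>x. foldl g (f x) (list_decode (h x)))"
proof -
  define st where "st = (\<lambda>z. if pr2 z = 0 then z
    else pair (g (pr1 z) (pr1 (pr2 z - 1))) (pr2 (pr2 z - 1)))"
  have "(st ^^ n) (pair a (list_encode xs)) = pair (foldl g a xs) 0" if "length xs \<le> n" for a xs n
    using that
  proof (induction n arbitrary: a xs)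
    case (Suc n)
    have "(st ^^ Suc n) (pair a (list_encode xs)) = (st ^^ n) (st (pair a (list_encode xs)))"
      by (simp add: funpow_Suc_right del: funpow.simps)
    then show ?case
    proof (cases xs)
      case Nil
      then show ?thesis using Suc.IH[of "[]" a]
          \<open>(st ^^ Suc n) _ = _\<close> by (simp add: st_def)
    next
      case (Cons y ys)
      then show ?thesis using Suc.IH[of ys "g a y"] Suc.prems
          \<open>(st ^^ Suc n) _ = _\<close> by (simp add: st_def del: funpow.simps)
    qed
  qed simp
  from this[OF list_code_le]
  have eq: "foldl g (f x) (list_decode (h x)) = pr1 ((st ^^ h x) (pair (f x) (h x)))" for x
    by (metis list_decode_inverse pr_pair(1))
  have "computable (\<lambda>z. pair (pr1 z) (pr1 (pr2 z - 1)))"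
    by (intro computable_pair computable_pr1 computable_pr2 computable_diff computable_id computable_const)
  from computable_compose[OF assms(1) this]
  have g: "computable (\<lambda>z. g (pr1 z) (pr1 (pr2 z - 1)))" by simp
  have "computable st" unfolding st_def
    by (intro computable_if computable_pair computable_pr1 computable_pr2 computable_diff g
        computable_id computable_const)
  then show ?thesis unfolding eq
    by (intro computable_pr1 computable_funpow computable_pair assms)
qed

abbreviation computable_list :: "(nat \<Rightarrow> nat list) \<Rightarrow> bool" where
  "computable_list f \<equiv> computable (\<lambda>x. list_encode (f x))"

lemma computable_list_decode: "computable f \<Longrightarrow> computable_list (\<lambda>x. list_decode (f x))"
  by simp

lemma computable_list_Nil: "computable_list (\<lambda>_. [])"
  by (rule computable_const)

lemma computable_list_Cons:
  "computable f \<Longrightarrow> computable_list g \<Longrightarrow> computable_list (\<lambda>x. f x # g x)"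
  by (simp add: computable_Suc computable_pair)

lemma computable_list_append:
  assumes "computable_list f" "computable_list g"
  shows "computable_list (\<lambda>x. f x @ g x)"
proof -
  let ?cons = "\<lambda>a b. Suc (pair b a)"
  have fold: "foldl ?cons (list_encode ys) xs = list_encode (rev xs @ ys)" for xs ys
    by (induction xs arbitrary: ys) (auto simp flip: list_encode.simps(2))
  have cons: "computable (\<lambda>z. ?cons (pr1 z) (pr2 z))"
    by (intro computable_Suc computable_pair computable_pr1 computable_pr2 computable_id)
  have "list_encode (f x @ g x) = foldl ?cons (list_encode (g x))
      (list_decode (foldl ?cons 0 (list_decode (list_encode (f x)))))" for x
    using fold[of "[]" "f x"] fold[of "g x" "rev (f x)"] by simp
  then show ?thesis
    using computable_foldl[OF cons assms(2) computable_foldl[OF cons computable_const assms(1)]]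
    by simp
qed

lemma computable_length:
  assumes "computable_list f" shows "computable (\<lambda>x. length (f x))"
proof -
  have "foldl (\<lambda>a b. Suc a) n xs = n + length xs" for n and xs :: "nat list"
    by (induction xs arbitrary: n) auto
  moreover have "computable (\<lambda>x. foldl (\<lambda>a b. Suc a) 0 (list_decode (list_encode (f x))))"
    by (intro computable_foldl computable_Suc computable_pr1 computable_id computable_const assms)
  ultimately show ?thesis by simp
qed

lemma computable_list_replicate:
  assumes "computable h" "computable f"
  shows "computable_list (\<lambda>x. replicate (h x) (f x))"
proof -
  define st where "st = (\<lambda>z. pair (pr1 z) (Suc (pair (pr1 z) (pr2 z))))"
  have "(st ^^ n) (pair a 0) = pair a (list_encode (replicate n a))" for n a
    by (induction n) (auto simp: st_def)
  then have "list_encode (replicate (h x) (f x)) = pr2 ((st ^^ h x) (pair (f x) 0))" for x by simp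
  moreover have "computable (\<lambda>x. pr2 ((st ^^ h x) (pair (f x) 0)))" unfolding st_def
    by (intro computable_pr2 computable_funpow computable_pair computable_pr1 computable_Suc
        computable_id computable_const assms)
  ultimately show ?thesis by simp
qed

lemmas computable_intros = computable_id computable_const computable_Suc computable_pair
  computable_pr1 computable_pr2 computable_add computable_diff computable_cnth
  computable_list_decode computable_list_Nil computable_list_Cons computable_list_append
  computable_length computable_list_replicate

section \<open>Semidecidable predicates\<close>

text \<open>The normal form of semidecidable predicates: one unbounded search with a decidable test. Two
  searches are merged into one by pairing, which takes the place of dovetailing.\<close>

definition sigma1 :: "(nat \<Rightarrow> bool) \<Rightarrow> bool" where
  "sigma1 P \<longleftrightarrow> (\<exists>f. computable f \<and> (\<forall>x. P x \<longleftrightarrow> (\<exists>s. f (pair x s) = 0)))"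

lemma sigma1_compose:
  assumes "sigma1 P" "computable h" shows "sigma1 (\<lambda>x. P (h x))"
proof -
  obtain f where f: "computable f" "\<And>x. P x \<longleftrightarrow> (\<exists>s. f (pair x s) = 0)"
    using assms(1) unfolding sigma1_def by blast
  have "computable (\<lambda>z. f (pair (h (pr1 z)) (pr2 z)))"
    by (intro computable_compose[OF f(1)] computable_pair computable_compose[OF assms(2)] computable_intros)
  then show ?thesis unfolding sigma1_def
    by (intro exI[of _ "\<lambda>z. f (pair (h (pr1 z)) (pr2 z))"]) (simp add: f(2))
qed

lemma sigma1_decidable:
  assumes "computable f" shows "sigma1 (\<lambda>x. f x = 0)"
  unfolding sigma1_def
  by (rule exI[of _ "\<lambda>z. f (pr1 z)"]) (simp add: computable_compose[OF assms] computable_intros)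

lemma sigma1_eq:
  assumes "computable f" "computable g" shows "sigma1 (\<lambda>x. f x = g x)"
proof -
  have "(f x = g x) \<longleftrightarrow> (f x - g x) + (g x - f x) = 0" for x by auto
  then show ?thesis
    by (simp only:) (intro sigma1_decidable computable_add computable_diff assms)
qed

lemma sigma1_less: "computable f \<Longrightarrow> computable g \<Longrightarrow> sigma1 (\<lambda>x. f x < g x)"
  using sigma1_decidable[of "\<lambda>x. Suc (f x) - g x"]
  by (simp add: computable_intros Suc_le_eq del: diff_Suc_Suc)

lemma sigma1_conj:
  assumes "sigma1 P" "sigma1 Q" shows "sigma1 (\<lambda>x. P x \<and> Q x)"
proof -
  obtain f where f: "computable f" "\<And>x. P x \<longleftrightarrow> (\<exists>s. f (pair x s) = 0)"
    using assms(1) unfolding sigma1_def by blast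
  obtain g where g: "computable g" "\<And>x. Q x \<longleftrightarrow> (\<exists>s. g (pair x s) = 0)"
    using assms(2) unfolding sigma1_def by blast
  let ?h = "\<lambda>z. f (pair (pr1 z) (pr1 (pr2 z))) + g (pair (pr1 z) (pr2 (pr2 z)))"
  have "computable ?h"
    by (intro computable_compose[OF f(1)] computable_compose[OF g(1)] computable_intros)
  moreover have "(P x \<and> Q x) \<longleftrightarrow> (\<exists>s. ?h (pair x s) = 0)" for x
    unfolding f g by (auto, metis pr_pair)
  ultimately show ?thesis unfolding sigma1_def by blast
qed

lemma sigma1_disj:
  assumes "sigma1 P" "sigma1 Q" shows "sigma1 (\<lambda>x. P x \<or> Q x)"
proof -
  obtain f where f: "computable f" "\<And>x. P x \<longleftrightarrow> (\<exists>s. f (pair x s) = 0)"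
    using assms(1) unfolding sigma1_def by blast
  obtain g where g: "computable g" "\<And>x. Q x \<longleftrightarrow> (\<exists>s. g (pair x s) = 0)"
    using assms(2) unfolding sigma1_def by blast
  have "computable (\<lambda>z. if f z = 0 then 0 else g z)"
    by (intro computable_if f g computable_intros)
  moreover have "(P x \<or> Q x) \<longleftrightarrow> (\<exists>s. (if f (pair x s) = 0 then 0 else g (pair x s)) = 0)" for x
  proof -
    have "(if a = 0 then 0 else b) = 0 \<longleftrightarrow> a = 0 \<or> b = 0" for a b :: nat by simp
    then show ?thesis unfolding f g by (simp only: ex_disj_distrib)
  qed
  ultimately show ?thesis unfolding sigma1_def by blast
qed

lemma sigma1_ex:
  assumes "sigma1 (\<lambda>z. P (pr1 z) (pr2 z))" shows "sigma1 (\<lambda>x. \<exists>y. P x y)"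
proof -
  obtain f where f: "computable f" "\<And>x y. P x y \<longleftrightarrow> (\<exists>s. f (pair (pair x y) s) = 0)"
    using assms unfolding sigma1_def by (metis pr_pair)
  let ?h = "\<lambda>z. f (pair (pair (pr1 z) (pr1 (pr2 z))) (pr2 (pr2 z)))"
  have "computable ?h" by (intro computable_compose[OF f(1)] computable_intros)
  moreover have "(\<exists>y. P x y) \<longleftrightarrow> (\<exists>s. ?h (pair x s) = 0)" for x
    unfolding f by (auto, metis pr_pair(1,2))
  ultimately show ?thesis unfolding sigma1_def by blast
qed

lemma sigma1_ex_list:
  assumes "sigma1 (\<lambda>z. P (pr1 z) (list_decode (pr2 z)))" shows "sigma1 (\<lambda>x. \<exists>ys. P x ys)"
proof -
  have "(\<exists>ys. P x ys) \<longleftrightarrow> (\<exists>y. P x (list_decode y))" for x by (metis list_encode_inverse)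
  then show ?thesis using sigma1_ex[OF assms] by presburger
qed

text \<open>The witnesses for the finitely many values of \<open>i\<close> are put into one list, which is
  then the single object to search for.\<close>

lemma sigma1_all_less:
  assumes "sigma1 (\<lambda>z. P (pr1 z) (pr2 z))" "computable h"
  shows "sigma1 (\<lambda>x. \<forall>i<h x. P x i)"
proof -
  obtain f where f: "computable f" "\<And>x y. P x y \<longleftrightarrow> (\<exists>s. f (pair (pair x y) s) = 0)"
    using assms(1) unfolding sigma1_def by (metis pr_pair)
  let ?g = "\<lambda>u. f (pair (pair (pr1 (pr1 u)) (pr2 u)) (cnth (pr2 (pr1 u)) (pr2 u)))"
  let ?S = "\<lambda>z. \<Sum>i<h (pr1 z). ?g (pair z i)"
  have "computable ?S"
    by (intro computable_sum computable_compose[OF f(1)] computable_compose[OF assms(2)] computable_intros)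
  moreover have "(\<forall>i<h x. P x i) \<longleftrightarrow> (\<exists>s. ?S (pair x s) = 0)" for x
  proof
    assume "\<forall>i<h x. P x i"
    then obtain w where w: "\<And>i. i < h x \<Longrightarrow> f (pair (pair x i) (w i)) = 0" unfolding f(2) by metis
    have "?S (pair x (list_encode (map w [0..<h x]))) = 0" by (simp add: cnth w)
    then show "\<exists>s. ?S (pair x s) = 0" by blast
  next
    assume "\<exists>s. ?S (pair x s) = 0"
    then show "\<forall>i<h x. P x i" unfolding f(2) by auto
  qed
  ultimately show ?thesis unfolding sigma1_def by blast
qed

lemma sigma1_list_eq: "computable_list f \<Longrightarrow> computable_list g \<Longrightarrow> sigma1 (\<lambda>x. f x = g x)"
  using sigma1_eq[of "\<lambda>x. list_encode (f x)" "\<lambda>x. list_encode (g x)"] by (simp add: list_encode_eq)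

lemmas sigma1_intros = sigma1_eq sigma1_list_eq sigma1_less sigma1_conj sigma1_disj
  sigma1_ex sigma1_ex_list sigma1_all_less

text \<open>A finite path from \<open>f x\<close> to \<open>g x\<close> is a coded sequence whose
  consecutive entries are related.\<close>

lemma sigma1_rtranclp:
  assumes "sigma1 (\<lambda>z. R (pr1 (pr1 z)) (pr2 (pr1 z)) (pr2 z))"
    and "computable h" "computable f" "computable g"
  shows "sigma1 (\<lambda>x. (R (h x))\<^sup>*\<^sup>* (f x) (g x))"
proof -
  have path: "(R q)\<^sup>*\<^sup>* a b \<longleftrightarrow> (\<exists>t n. cnth t 0 = a \<and> cnth t n = b \<and>
      (\<forall>i<n. R q (cnth t i) (cnth t (Suc i))))" for q a b
  proof
    assume "(R q)\<^sup>*\<^sup>* a b"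
    then obtain n where "(R q ^^ n) a b" unfolding rtranclp_is_Sup_relpowp by auto
    then obtain w where w: "w 0 = a" "w n = b" "\<And>i. i < n \<Longrightarrow> R q (w i) (w (Suc i))"
      unfolding relpowp_fun_conv by blast
    have "cnth (list_encode (map w [0..<Suc n])) i = w i" if "i \<le> n" for i
      using that by (subst cnth) (auto simp del: upt_Suc)
    then show "\<exists>t n. cnth t 0 = a \<and> cnth t n = b \<and> (\<forall>i<n. R q (cnth t i) (cnth t (Suc i)))"
      using w by (intro exI[of _ "list_encode (map w [0..<Suc n])"] exI[of _ n]) auto
  next
    assume "\<exists>t n. cnth t 0 = a \<and> cnth t n = b \<and> (\<forall>i<n. R q (cnth t i) (cnth t (Suc i)))"
    then have "\<exists>n. (R q ^^ n) a b" unfolding relpowp_fun_conv by blast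
    then show "(R q)\<^sup>*\<^sup>* a b" unfolding rtranclp_is_Sup_relpowp by auto
  qed
  have R: "sigma1 (\<lambda>x. R (h' x) (f' x) (g' x))"
    if "computable h'" "computable f'" "computable g'" for h' f' g'
    using sigma1_compose[OF assms(1) computable_pair[OF computable_pair[OF that(1,2)] that(3)]] by simp
  show ?thesis unfolding path
    by (intro sigma1_intros computable_intros R computable_compose[OF assms(2)]
        computable_compose[OF assms(3)] computable_compose[OF assms(4)])
qed

inductive_cases recf_Zero_cases: "recf_eval Zero xs y"
  and recf_Succ_cases: "recf_eval Succ xs y"
  and recf_Proj_cases: "recf_eval (Proj i) xs y"
  and recf_Comp_cases: "recf_eval (Comp f gs) xs y"
  and recf_Prim_cases: "recf_eval (Prim f g) xs y"
  and recf_Prim_0_cases: "recf_eval (Prim f g) (0 # xs) y"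
  and recf_Prim_Suc_cases: "recf_eval (Prim f g) (Suc n # xs) y"
  and recf_Mu_cases: "recf_eval (Mu f) xs y"

text \<open>A run of a primitive recursion is described by the sequence of its intermediate values, which
  turns the recursion into an existential statement with a bounded quantifier.\<close>

lemma recf_eval_Prim_iff:
  "recf_eval (Prim f g) xs y \<longleftrightarrow> (\<exists>n ys t. xs = n # ys \<and> recf_eval f ys (cnth t 0) \<and>
     (\<forall>i<n. recf_eval g (i # cnth t i # ys) (cnth t (Suc i))) \<and> y = cnth t n)"
proof
  have "\<exists>w. recf_eval f ys (w 0) \<and> (\<forall>i<n. recf_eval g (i # w i # ys) (w (Suc i))) \<and> y = w n"
    if "recf_eval (Prim f g) (n # ys) y" for n ys
    using that
  proof (induction n arbitrary: y)
    case 0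
    then show ?case by (auto elim: recf_Prim_0_cases)
  next
    case (Suc n)
    then obtain y' where "recf_eval (Prim f g) (n # ys) y'" and y: "recf_eval g (n # y' # ys) y"
      by (auto elim: recf_Prim_Suc_cases)
    then obtain w where w: "recf_eval f ys (w 0)" "\<forall>i<n. recf_eval g (i # w i # ys) (w (Suc i))"
      "y' = w n" using Suc.IH by blast
    show ?case by (rule exI[of _ "w(Suc n := y)"]) (use w y in \<open>auto simp: less_Suc_eq\<close>)
  qed
  moreover assume ev: "recf_eval (Prim f g) xs y"
  moreover obtain n ys where xs: "xs = n # ys" using ev by (auto elim: recf_Prim_cases)
  ultimately obtain w where w: "recf_eval f ys (w 0)"
    "\<forall>i<n. recf_eval g (i # w i # ys) (w (Suc i))" "y = w n" by blast
  have t: "cnth (list_encode (map w [0..<Suc n])) i = w i" if "i \<le> n" for i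
    using that by (subst cnth) (auto simp del: upt_Suc)
  show "\<exists>n ys t. xs = n # ys \<and> recf_eval f ys (cnth t 0) \<and>
     (\<forall>i<n. recf_eval g (i # cnth t i # ys) (cnth t (Suc i))) \<and> y = cnth t n"
    by (intro exI[of _ n] exI[of _ ys] exI[of _ "list_encode (map w [0..<Suc n])"])
      (use w xs t in \<open>auto simp del: upt_Suc\<close>)
next
  assume "\<exists>n ys t. xs = n # ys \<and> recf_eval f ys (cnth t 0) \<and>
     (\<forall>i<n. recf_eval g (i # cnth t i # ys) (cnth t (Suc i))) \<and> y = cnth t n"
  then obtain n ys t where w: "xs = n # ys" "recf_eval f ys (cnth t 0)"
     "\<forall>i<n. recf_eval g (i # cnth t i # ys) (cnth t (Suc i))" "y = cnth t n" by blast
  have "recf_eval (Prim f g) (m # ys) (cnth t m)" if "m \<le> n" for m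
    using that
  proof (induction m)
    case 0
    show ?case using w(2) by (rule recf_eval.Prim_0)
  next
    case (Suc m)
    show ?case using Suc w(3) by (intro recf_eval.Prim_Suc[of _ _ m _ "cnth t m"]) auto
  qed
  then show "recf_eval (Prim f g) xs y" using w by simp
qed

lemma sigma1_list_all2:
  assumes "\<And>g f h. g \<in> set gs \<Longrightarrow> computable_list f \<Longrightarrow> computable h \<Longrightarrow>
      sigma1 (\<lambda>x. recf_eval g (f x) (h x))"
    and "computable_list f" "computable_list h"
  shows "sigma1 (\<lambda>x. list_all2 (\<lambda>g y. recf_eval g (f x) y) gs (h x))"
  using assms
proof (induction gs arbitrary: f h)
  case Nil
  then show ?case by (simp add: sigma1_list_eq computable_intros)
next
  case (Cons g gs)
  have "sigma1 (\<lambda>x. \<exists>y ys. h x = y # ys \<and> recf_eval g (f x) y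
      \<and> list_all2 (\<lambda>g y. recf_eval g (f x) y) gs ys)"
    by (intro sigma1_intros computable_intros Cons.IH Cons.prems(1))
      (simp_all add: computable_compose[OF Cons.prems(2)] computable_compose[OF Cons.prems(3)]
        computable_intros Cons.prems(1))
  then show ?case by (simp add: list_all2_Cons1)
qed

text \<open>Kleene's normal form, for a fixed program: its graph is semidecidable. The induction follows the
  syntax of the program: the runs of its parts are the objects to search for.\<close>

lemma sigma1_recf_eval:
  assumes "computable_list f" "computable h"
  shows "sigma1 (\<lambda>x. recf_eval p (f x) (h x))"
  using assms
proof (induction p arbitrary: f h)
  case Zero
  have "recf_eval Zero xs y \<longleftrightarrow> y = 0" for xs y by (auto elim: recf_Zero_cases intro: recf_eval.Zero)
  then show ?case using Zero by (simp add: sigma1_intros computable_intros)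
next
  case Succ
  have "recf_eval Succ xs y \<longleftrightarrow> (\<exists>z. xs = [z] \<and> y = Suc z)" for xs y
    by (auto elim: recf_Succ_cases intro: recf_eval.Succ)
  then show ?case
    by (simp only:) (intro sigma1_intros computable_intros computable_compose[OF Succ(1)]
        computable_compose[OF Succ(2)])
next
  case (Proj i)
  have "recf_eval (Proj i) xs y \<longleftrightarrow> i < length xs \<and> y = cnth (list_encode xs) i" for xs y
    by (auto elim: recf_Proj_cases intro: recf_eval.Proj simp: cnth)
  then show ?case
    by (simp only:) (intro sigma1_intros computable_intros Proj)
next
  case (Comp p gs)
  have "recf_eval (Comp p gs) xs y \<longleftrightarrow>
      (\<exists>ys. list_all2 (\<lambda>g y. recf_eval g xs y) gs ys \<and> recf_eval p ys y)" for xs y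
    by (auto elim: recf_Comp_cases intro: recf_eval.Comp)
  then show ?case
    by (simp only:) (intro sigma1_ex_list sigma1_conj sigma1_list_all2 Comp.IH computable_intros
        computable_compose[OF Comp.prems(1)] computable_compose[OF Comp.prems(2)])
next
  case (Prim p q)
  show ?case unfolding recf_eval_Prim_iff
    by (intro sigma1_intros Prim.IH computable_intros
        computable_compose[OF Prim.prems(1)] computable_compose[OF Prim.prems(2)])
next
  case (Mu p)
  have "recf_eval (Mu p) xs y \<longleftrightarrow>
      recf_eval p (y # xs) 0 \<and> (\<forall>m<y. \<exists>k. recf_eval p (m # xs) (Suc k))" for xs y
    by (auto elim: recf_Mu_cases intro: recf_eval.Mu)
  then show ?case
    by (simp only:) (intro sigma1_intros Mu.IH computable_intros Mu.prems
        computable_compose[OF Mu.prems(1)] computable_compose[OF Mu.prems(2)])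
qed

section \<open>Greedy enumeration\<close>

lemma ce_set_range: "computable f \<Longrightarrow> ce_set (range f)"
  unfolding computable_def ce_set_def by (auto dest: recf_eval_deterministic)

fun chain :: "(nat list \<Rightarrow> nat \<Rightarrow> bool) \<Rightarrow> nat list \<Rightarrow> bool" where
  "chain Q [] \<longleftrightarrow> True"
| "chain Q (w # ws) \<longleftrightarrow> Q ws w \<and> chain Q ws"

text \<open>If every list obtained so far has an admissible next element, then repeated search for the first
  admissible element never gets stuck and is carried out by a program.\<close>

lemma greedy_ce_set:
  assumes "sigma1 (\<lambda>z. Q (list_decode (pr1 z)) (pr2 z))"
    and ext: "\<And>ws. chain Q ws \<Longrightarrow> \<exists>w. Q ws w"
  obtains w where "ce_set (range w)" "\<And>n. Q (rev (map w [0..<n])) (w n)"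
proof -
  obtain f where f: "computable f" "\<And>l w. Q (list_decode l) w \<longleftrightarrow> (\<exists>s. f (pair (pair l w) s) = 0)"
    using assms(1) unfolding sigma1_def by (metis pr_pair)
  define F where "F = (\<lambda>l z. f (pair (pair l (pr1 z)) (pr2 z)))"
  define m where "m = (\<lambda>l. LEAST z. F l z = 0)"
  define L where "L = (\<lambda>n. rec_nat [] (\<lambda>_ l. pr1 (m (list_encode l)) # l) n)"
  have L0: "L 0 = []" and LSuc: "\<And>n. L (Suc n) = pr1 (m (list_encode (L n))) # L n"
    by (simp_all add: L_def)
  have ex: "\<exists>z. F (list_encode l) z = 0" if "chain Q l" for l
    using ext[OF that] f(2)[of "list_encode l"] unfolding F_def by (metis list_encode_inverse pr_pair(1,2))
  have Q_step: "Q l (pr1 (m (list_encode l)))" if "chain Q l" for l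
  proof -
    have "F (list_encode l) (m (list_encode l)) = 0" unfolding m_def
      using LeastI_ex[OF ex[OF that]] .
    then show ?thesis using f(2)[of "list_encode l"] unfolding F_def by (metis list_encode_inverse)
  qed
  have chain_L: "chain Q (L n)" for n
    by (induction n) (simp_all add: L0 LSuc Q_step)
  define w where "w = (\<lambda>n. pr1 (m (list_encode (L n))))"
  have w: "w n = pr1 (m (list_encode (L n)))" for n by (simp add: w_def)
  have L: "L n = rev (map w [0..<n])" for n
    by (induction n) (simp_all add: L0 LSuc w_def)
  have "computable (\<lambda>u. F (pr2 u) (pr1 u))" unfolding F_def
    by (intro computable_compose[OF f(1)] computable_intros)
  then obtain p where p: "\<And>u. recf_eval p [u] (F (pr2 u) (pr1 u))" unfolding computable_def by blast
  define pF where "pF = Comp p [rec_pair]"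
  have pF: "recf_eval pF [z, l] (F l z)" for z l
    using p[of "pair z l"] recf_eval_pair[of z l] unfolding pF_def by (auto intro: recf_basic)
  have Mu: "recf_eval (Mu pF) [list_encode l] (m (list_encode l))" if "chain Q l" for l
  proof (rule recf_eval.Mu)
    have "F (list_encode l) (m (list_encode l)) = 0" unfolding m_def
      using LeastI_ex[OF ex[OF that]] .
    then show "recf_eval pF [m (list_encode l), list_encode l] 0" using pF by metis
    fix k assume "k < m (list_encode l)"
    then have "F (list_encode l) k \<noteq> 0" unfolding m_def by (rule not_less_Least)
    then show "\<exists>j. recf_eval pF [k, list_encode l] (Suc j)"
      using pF[of k "list_encode l"] by (metis not0_implies_Suc)
  qed
  have "computable pr1" using computable_pr1[OF computable_id] .
  then obtain p1 where p1: "\<And>x. recf_eval p1 [x] (pr1 x)" unfolding computable_def by blast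
  have head: "recf_eval (Comp p1 [Mu pF]) [list_encode (L n)] (w n)" for n
    unfolding w_def by (rule recf_basic Mu chain_L p1)+
  define step where "step = Comp Succ [Comp rec_pair [Comp (Comp p1 [Mu pF]) [Proj (Suc 0)], Proj (Suc 0)]]"
  have step: "recf_eval step (n # list_encode (L n) # xs) (list_encode (L (Suc n)))" for n xs
    unfolding step_def LSuc list_encode.simps w[symmetric]
    by (rule recf_eval_Comp1[OF _ recf_eval.Succ] recf_eval_Comp2[OF _ _ recf_eval_pair]
        recf_eval_Comp1[OF _ head] recf_eval_Proj1)+
  have "recf_eval (Prim Zero step) [n] (list_encode (L n))" for n
  proof (induction n)
    case 0
    show ?case by (simp add: L0) (intro recf_eval.Prim_0 recf_eval.Zero)
  next
    case (Suc n)
    then show ?case using step by (rule recf_eval.Prim_Suc)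
  qed
  then have "recf_eval (Comp (Comp p1 [Mu pF]) [Prim Zero step]) [n] (w n)" for n
    using head by (rule recf_eval_Comp1)
  then have "computable w" unfolding computable_def by blast
  then have "ce_set (range w)" by (rule ce_set_range)
  moreover have "Q (rev (map w [0..<n])) (w n)" for n
    using Q_step[OF chain_L[of n]] unfolding L[symmetric] w .
  ultimately show thesis by (rule that)
qed

section \<open>Thue congruences and words in a group\<close>

definition thue_step :: "('b list \<times> 'b list) set \<Rightarrow> 'b list \<Rightarrow> 'b list \<Rightarrow> bool" where
  "thue_step R c d \<longleftrightarrow> (\<exists>p l r s. c = p @ l @ s \<and> d = p @ r @ s \<and> ((l, r) \<in> R \<or> (r, l) \<in> R))"

abbreviation thue_congruence :: "('b list \<times> 'b list) set \<Rightarrow> 'b list \<Rightarrow> 'b list \<Rightarrow> bool" where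
  "thue_congruence R \<equiv> (thue_step R)\<^sup>*\<^sup>*"

lemma thue_congruence_rule: "(l, r) \<in> R \<Longrightarrow> thue_congruence R l r"
  unfolding thue_step_def by (rule r_into_rtranclp) (metis append_Nil append_Nil2)

lemma thue_congruence_sym: "thue_congruence R a b \<Longrightarrow> thue_congruence R b a"
proof (rule sympD[OF symp_rtranclp])
  show "symp (thue_step R)" unfolding symp_def thue_step_def by blast
qed

lemma thue_congruence_context:
  assumes "thue_congruence R a b" shows "thue_congruence R (p @ a @ s) (p @ b @ s)"
  using assms
proof (induction rule: rtranclp_induct)
  case (step b c)
  from step(2) obtain p' l r s' where "b = p' @ l @ s'" "c = p' @ r @ s'" "(l, r) \<in> R \<or> (r, l) \<in> R"
    unfolding thue_step_def by blast
  then have "thue_step R (p @ b @ s) (p @ c @ s)"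
    unfolding thue_step_def by (intro exI[of _ "p @ p'"] exI[of _ l] exI[of _ r] exI[of _ "s' @ s"]) auto
  with step(3) show ?case by (rule rtranclp.rtrancl_into_rtrancl)
qed simp

lemma thue_congruence_append:
  assumes "thue_congruence R a b" "thue_congruence R c d"
  shows "thue_congruence R (a @ c) (b @ d)"
  using thue_congruence_context[OF assms(1), of "[]" c] thue_congruence_context[OF assms(2), of b "[]"]
  by simp

lemma thue_congruence_map:
  assumes "thue_congruence R a b"
  shows "thue_congruence (map_prod (map f) (map f) ` R) (map f a) (map f b)"
  using assms
proof (induction rule: rtranclp_induct)
  case (step b c)
  from step(2) obtain p l r s where bc: "b = p @ l @ s" "c = p @ r @ s"
    and lr: "(l, r) \<in> R \<or> (r, l) \<in> R"
    unfolding thue_step_def by blast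
  let ?R = "map_prod (map f) (map f) ` R"
  have "(map f x, map f y) \<in> ?R" if "(x, y) \<in> R" for x y
    using imageI[OF that, of "map_prod (map f) (map f)"] by simp
  then have "(map f l, map f r) \<in> ?R \<or> (map f r, map f l) \<in> ?R" using lr by blast
  then have "thue_step ?R (map f b) (map f c)"
    unfolding thue_step_def bc map_append by blast
  with step(3) show ?case by (rule rtranclp.rtrancl_into_rtrancl)
qed simp

definition power_rules :: "nat \<Rightarrow> 'b set \<Rightarrow> 'b list \<Rightarrow> 'b list \<Rightarrow> ('b list \<times> 'b list) set" where
  "power_rules k Y u w = insert (u, w) ((\<lambda>y. (replicate k y, [])) ` Y)"

lemma power_rules_map:
  "map_prod (map f) (map f) ` power_rules k Y u w = power_rules k (f ` Y) (map f u) (map f w)"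
  by (auto simp: power_rules_def image_image)

lemma thue_congruence_power:
  assumes "y \<in> Y" "k dvd n"
  shows "thue_congruence (power_rules k Y u w) (replicate n y) []"
proof -
  have "thue_congruence (power_rules k Y u w) (replicate (k * m) y) []" for m
  proof (induction m)
    case (Suc m)
    have "thue_congruence (power_rules k Y u w) (replicate k y) []"
      using assms(1) by (intro thue_congruence_rule) (auto simp: power_rules_def)
    from thue_congruence_append[OF this Suc] show ?case by (simp add: replicate_add)
  qed simp
  with assms(2) show ?thesis by (auto elim: dvdE)
qed

text \<open>In the presence of the relations \<open>y\<^sup>k = 1\<close>, this is the inverse of
  \<open>w\<close>, written without inverse letters.\<close>

definition reverse_powers :: "nat \<Rightarrow> 'b list \<Rightarrow> 'b list" where
  "reverse_powers k w = concat (map (replicate (k - 1)) (rev w))"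

lemma reverse_powers_simps [simp]:
  "reverse_powers k [] = []"
  "reverse_powers k (x # w) = reverse_powers k w @ replicate (k - 1) x"
  by (simp_all add: reverse_powers_def)

lemma set_reverse_powers: "set (reverse_powers k w) \<subseteq> set w"
  by (induction w) auto

lemma length_reverse_powers: "length (reverse_powers k w) = (k - 1) * length w"
  by (induction w) simp_all

lemma dvd_length_reverse_powers:
  assumes "k > 0" shows "k dvd length w + length (reverse_powers k w)"
proof -
  have "length w + length (reverse_powers k w) = k * length w"
    using assms by (cases k) (auto simp: length_reverse_powers)
  then show ?thesis by simp
qed

lemma thue_congruence_reverse_powers:
  assumes "k > 0" "set w \<subseteq> Y"
  shows "thue_congruence (power_rules k Y u v) (w @ reverse_powers k w) []"
    and "thue_congruence (power_rules k Y u v) (reverse_powers k w @ w) []"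
proof -
  let ?R = "power_rules k Y u v"
  have k: "x # replicate (k - 1) x = replicate k x" "replicate (k - 1) x @ [x] = replicate k x" for x :: 'a
    using assms(1) by (cases k; simp add: replicate_append_same)+
  show "thue_congruence ?R (w @ reverse_powers k w) []"
    using assms(2)
  proof (induction w)
    case (Cons x w)
    have "thue_congruence ?R ([x] @ (w @ reverse_powers k w) @ replicate (k - 1) x) ([x] @ [] @ replicate (k - 1) x)"
      using Cons by (intro thue_congruence_context) auto
    also have "[x] @ [] @ replicate (k - 1) x = replicate k x" using k by simp
    also have "thue_congruence ?R \<dots> []" using Cons.prems by (intro thue_congruence_power) auto
    finally show ?case by simp
  qed simp
  show "thue_congruence ?R (reverse_powers k w @ w) []"
    using assms(2)
  proof (induction w)
    case (Cons x w)
    have "thue_congruence ?R (reverse_powers k w @ replicate k x @ w) (reverse_powers k w @ [] @ w)"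
      using Cons.prems by (intro thue_congruence_context thue_congruence_power) auto
    also have "replicate k x @ w = replicate (k - 1) x @ x # w"
      unfolding k(2)[symmetric] by simp
    also have "thue_congruence ?R (reverse_powers k w @ [] @ w) []" using Cons by simp
    finally show ?case by simp
  qed simp
qed

context group
begin

lemma word_value_Nil [simp]: "word_value G [] = \<one>"
  by (simp add: word_value_def)

lemma word_value_Cons:
  "word_value G (a # w) = (if snd a then fst a else inv (fst a)) \<otimes> word_value G w"
  by (simp add: word_value_def case_prod_beta)

lemma word_value_closed:
  "X \<subseteq> carrier G \<Longrightarrow> set w \<subseteq> X \<times> UNIV \<Longrightarrow> word_value G w \<in> carrier G"
  by (induction w) (auto simp: word_value_Cons)

lemma word_value_append:
  assumes "X \<subseteq> carrier G" "set u \<subseteq> X \<times> UNIV" "set v \<subseteq> X \<times> UNIV"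
  shows "word_value G (u @ v) = word_value G u \<otimes> word_value G v"
  using assms(2)
proof (induction u)
  case Nil
  then show ?case using word_value_closed[OF assms(1,3)] by simp
next
  case (Cons a u)
  have "fst a \<in> carrier G" using Cons.prems assms(1) by auto
  then show ?case using Cons word_value_closed[OF assms(1), of u] word_value_closed[OF assms(1,3)]
    by (simp add: word_value_Cons m_assoc)
qed

lemma word_value_replicate:
  assumes "x \<in> carrier G" shows "word_value G (replicate n (x, True)) = x [^] n"
  by (induction n) (simp_all only: replicate.simps word_value_Nil word_value_Cons nat_pow_Suc2[OF assms]
      nat_pow_0 fst_conv snd_conv if_True)

end

lemma positive_word_reduced: "set w \<subseteq> X \<times> {True} \<Longrightarrow> reduced w"
  unfolding reduced_def by (induction w rule: induct_list012) auto

section \<open>Groups generated by elements of finite order\<close>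

locale torsion_generated = group G for G :: "('a, 'm) monoid_scheme" (structure) +
  fixes X :: "'a set" and k :: nat
  assumes finite_gens: "finite X" and gens: "X \<subseteq> carrier G" and generate_gens: "generate G X = carrier G"
    and k_pos: "k > 0" and gen_pow: "\<And>x. x \<in> X \<Longrightarrow> x [^] k = \<one>"
begin

abbreviation val :: "'a word \<Rightarrow> 'a" where "val \<equiv> word_value G"
abbreviation letters :: "('a \<times> bool) set" where "letters \<equiv> X \<times> {True}"
abbreviation rules :: "'a word \<Rightarrow> 'a word \<Rightarrow> ('a word \<times> 'a word) set" where
  "rules \<equiv> power_rules k letters"

text \<open>The lengths are divisible by \<open>k\<close> so that any two such words can be padded to a
  common length by powers \<open>y\<^sup>k\<close> of letters, which have the value 1. Arbitrary
  positive words can have lengths that differ modulo \<open>k\<close>.\<close>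

definition pos_words :: "'a word set" where
  "pos_words = {w. set w \<subseteq> letters \<and> k dvd length w}"

lemma pos_words_letters: "w \<in> pos_words \<Longrightarrow> set w \<subseteq> letters"
  by (simp add: pos_words_def)

lemma letters_UNIV: "set w \<subseteq> letters \<Longrightarrow> set w \<subseteq> X \<times> UNIV" by auto

lemma val_closed: "set w \<subseteq> letters \<Longrightarrow> val w \<in> carrier G"
  using word_value_closed[OF gens letters_UNIV] .

lemma val_append: "set u \<subseteq> letters \<Longrightarrow> set v \<subseteq> letters \<Longrightarrow> val (u @ v) = val u \<otimes> val v"
  using word_value_append[OF gens letters_UNIV letters_UNIV] .

lemma pos_words_free: "w \<in> pos_words \<Longrightarrow> w \<in> free_words X"
  using positive_word_reduced[of w X] by (auto simp: pos_words_def free_words_def)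

lemma thue_congruence_val:
  assumes "thue_congruence (rules u w) a b" "set a \<subseteq> X \<times> UNIV"
    and uw: "set u \<subseteq> letters" "set w \<subseteq> letters" "val u = val w"
  shows "val a = val b"
proof -
  have "set b \<subseteq> X \<times> UNIV \<and> val b = val a"
    using assms(1)
  proof (induction rule: rtranclp_induct)
    case base
    show ?case using assms(2) by simp
  next
    case (step b c)
    from step(2) obtain p l r s where bc: "b = p @ l @ s" "c = p @ r @ s"
      and lr: "(l, r) \<in> rules u w \<or> (r, l) \<in> rules u w"
      unfolding thue_step_def by blast
    have "set l' \<subseteq> X \<times> UNIV \<and> set r' \<subseteq> X \<times> UNIV \<and> val l' = val r'" if "(l', r') \<in> rules u w" for l' r'
      using that uw gen_pow word_value_replicate gens unfolding power_rules_def by auto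
    then have "set l \<subseteq> X \<times> UNIV" "set r \<subseteq> X \<times> UNIV" "val l = val r" using lr by metis+
    moreover have "set p \<subseteq> X \<times> UNIV" "set s \<subseteq> X \<times> UNIV" using step(3) bc by auto
    ultimately show ?case using step(3) unfolding bc
      by (simp add: word_value_append[OF gens] del: subset_UNIV)
  qed
  then show ?thesis by simp
qed

lemma val_reverse_powers:
  assumes "set w \<subseteq> letters" shows "val (reverse_powers k w) = inv (val w)"
proof -
  have r: "set (reverse_powers k w) \<subseteq> letters" using set_reverse_powers assms by fast
  have "val (reverse_powers k w @ w) = val []"
    using r assms letters_UNIV
    by (intro thue_congruence_val[OF thue_congruence_reverse_powers(2)[OF k_pos assms, of "[]" "[]"]])
      simp_all
  then show ?thesis using inv_equality[of "val (reverse_powers k w)" "val w"] val_closed r assms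
    by (simp add: val_append)
qed

lemma positive_representative:
  assumes "g \<in> carrier G" obtains w where "set w \<subseteq> letters" "val w = g"
proof -
  have "g \<in> generate G X" using assms generate_gens by simp
  then have "\<exists>w. set w \<subseteq> letters \<and> val w = g"
  proof (induction rule: generate.induct)
    case one
    show ?case by (rule exI[of _ "[]"]) simp
  next
    case (incl h)
    then show ?case using gens by (intro exI[of _ "[(h, True)]"]) (auto simp: word_value_Cons)
  next
    case (inv h)
    then have h: "set [(h, True)] \<subseteq> letters" "val [(h, True)] = h" using gens by (auto simp: word_value_Cons)
    show ?case using val_reverse_powers[OF h(1)] h set_reverse_powers[of k "[(h, True)]"]
      by (intro exI[of _ "reverse_powers k [(h, True)]"]) auto
  next
    case (eng g h)
    then obtain u w where "set u \<subseteq> letters" "val u = g" "set w \<subseteq> letters" "val w = h" by blast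
    then show ?case by (intro exI[of _ "u @ w"]) (simp add: val_append)
  qed
  then show thesis using that by blast
qed

text \<open>The image in \<open>G\<close> of the words that the relation \<open>u = w\<close> makes trivial;
  it plays the part of the normal closure of \<open>u\<^sup>-\<^sup>1 w\<close>.\<close>

definition relator_subgroup :: "'a word \<Rightarrow> 'a word \<Rightarrow> 'a set" where
  "relator_subgroup u w = val ` {z \<in> pos_words. thue_congruence (rules u w) z []}"

lemma pos_words_append: "u \<in> pos_words \<Longrightarrow> v \<in> pos_words \<Longrightarrow> u @ v \<in> pos_words"
  by (auto simp: pos_words_def)

lemma pos_words_reverse_powers: "u \<in> pos_words \<Longrightarrow> reverse_powers k u \<in> pos_words"
  using set_reverse_powers[of k u] by (auto simp: pos_words_def length_reverse_powers)

lemma relator_subgroup_normal: "relator_subgroup u w \<lhd> G"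
proof -
  let ?N = "relator_subgroup u w"
  let ?Z = "{z \<in> pos_words. thue_congruence (rules u w) z []}"
  have sub: "subgroup ?N G"
  proof (rule subgroupI)
    show "?N \<subseteq> carrier G" using pos_words_letters val_closed unfolding relator_subgroup_def by auto
    have "[] \<in> ?Z" by (simp add: pos_words_def)
    then show "?N \<noteq> {}" unfolding relator_subgroup_def by blast
  next
    fix a assume "a \<in> ?N"
    then obtain z where z: "z \<in> ?Z" "a = val z" unfolding relator_subgroup_def by auto
    have zl: "set z \<subseteq> letters" using z pos_words_letters by auto
    have "thue_congruence (rules u w) (z @ reverse_powers k z) ([] @ reverse_powers k z)"
      using z by (intro thue_congruence_append) auto
    from thue_congruence_sym[OF this]
    have "thue_congruence (rules u w) (reverse_powers k z) []"
      using thue_congruence_reverse_powers(1)[OF k_pos zl, of u w] by simp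
    then have "reverse_powers k z \<in> ?Z" using z pos_words_reverse_powers by auto
    then show "inv a \<in> ?N" using val_reverse_powers[OF zl] z(2)
      unfolding relator_subgroup_def by force
  next
    fix a b assume "a \<in> ?N" "b \<in> ?N"
    then obtain y z where yz: "y \<in> ?Z" "a = val y" "z \<in> ?Z" "b = val z"
      unfolding relator_subgroup_def by auto
    have "y @ z \<in> ?Z" using yz pos_words_append thue_congruence_append[of "rules u w" y "[]" z "[]"] by auto
    moreover have "val (y @ z) = a \<otimes> b" using yz pos_words_letters by (simp add: val_append)
    ultimately show "a \<otimes> b \<in> ?N" unfolding relator_subgroup_def by force
  qed
  moreover have "g \<otimes> a \<otimes> inv g \<in> ?N" if g: "g \<in> carrier G" and a: "a \<in> ?N" for g a
  proof -
    obtain z where z: "z \<in> ?Z" "a = val z" using a unfolding relator_subgroup_def by auto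
    obtain p where p: "set p \<subseteq> letters" "val p = g" using positive_representative[OF g] .
    have r: "set (reverse_powers k p) \<subseteq> letters" using set_reverse_powers p(1) by fast
    have zl: "set z \<subseteq> letters" using z pos_words_letters by auto
    have "thue_congruence (rules u w) (p @ z @ reverse_powers k p) (p @ [] @ reverse_powers k p)"
      using z by (intro thue_congruence_context) auto
    also have "thue_congruence (rules u w) (p @ [] @ reverse_powers k p) []"
      using thue_congruence_reverse_powers(1)[OF k_pos p(1)] by simp
    finally have cong: "thue_congruence (rules u w) (p @ z @ reverse_powers k p) []" .
    have "k dvd (length p + length (reverse_powers k p)) + length z"
      using z by (intro dvd_add[OF dvd_length_reverse_powers[OF k_pos]]) (simp add: pos_words_def)
    moreover have "length (p @ z @ reverse_powers k p) =
        (length p + length (reverse_powers k p)) + length z" by simp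
    ultimately have "k dvd length (p @ z @ reverse_powers k p)" by (simp only:)
    then have "p @ z @ reverse_powers k p \<in> ?Z"
      using cong p r zl by (simp add: pos_words_def)
    moreover have "val (p @ z @ reverse_powers k p) = g \<otimes> a \<otimes> inv g"
      using p r zl z(2) val_reverse_powers[OF p(1)] val_closed g by (simp add: val_append m_assoc)
    ultimately show ?thesis unfolding relator_subgroup_def by force
  qed
  ultimately show ?thesis unfolding normal_inv_iff by blast
qed

lemma relator_subgroup_mem:
  assumes "u \<in> pos_words" "w \<in> pos_words"
  shows "inv (val u) \<otimes> val w \<in> relator_subgroup u w"
proof -
  let ?z = "reverse_powers k u @ w"
  have ul: "set u \<subseteq> letters" and wl: "set w \<subseteq> letters" using assms pos_words_letters by auto
  have r: "reverse_powers k u \<in> pos_words" using assms pos_words_reverse_powers by blast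
  have "thue_congruence (rules u w) w u"
    by (rule thue_congruence_sym[OF thue_congruence_rule]) (simp add: power_rules_def)
  then have "thue_congruence (rules u w) ?z (reverse_powers k u @ u)"
    by (intro thue_congruence_append) auto
  also have "thue_congruence (rules u w) (reverse_powers k u @ u) []"
    using thue_congruence_reverse_powers(2)[OF k_pos ul] .
  finally have "thue_congruence (rules u w) ?z []" .
  moreover have "?z \<in> pos_words" using r assms pos_words_append by blast
  moreover have "val ?z = inv (val u) \<otimes> val w"
    using val_append[OF pos_words_letters[OF r] wl] val_reverse_powers[OF ul] by simp
  ultimately show ?thesis unfolding relator_subgroup_def by force
qed

text \<open>Otherwise finitely many cosets of the union of the subgroups in \<open>Q\<close> cover
  \<open>G\<close>. Let \<open>T\<close> be the finite set of representatives. For a generator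
  \<open>x\<close> and \<open>t \<in> T\<close>, the element \<open>x t\<close> is \<open>t'
  r\<close> with \<open>t' \<in> T\<close> and \<open>r\<close> in a member of \<open>Q\<close>.
  Only finitely many \<open>r\<close> occur, so one member \<open>K\<close> of \<open>Q\<close>
  contains all of them, and \<open>T K\<close> is stable under left multiplication by generators;
  thus it is all of \<open>G\<close>.\<close>

lemma fresh_word:
  assumes Q_normal: "\<And>K. Q K \<Longrightarrow> K \<lhd> G" and Q_trivial: "Q {\<one>}"
    and Q_join: "\<And>K L. Q K \<Longrightarrow> Q L \<Longrightarrow> \<exists>M. Q M \<and> K \<subseteq> M \<and> L \<subseteq> M"
    and Q_index: "\<And>K T. Q K \<Longrightarrow> finite T \<Longrightarrow> T \<subseteq> carrier G \<Longrightarrow> T <#> K \<noteq> carrier G"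
    and U: "finite U" "U \<subseteq> carrier G"
  obtains w where "w \<in> pos_words" "\<And>u K. u \<in> U \<Longrightarrow> Q K \<Longrightarrow> inv u \<otimes> val w \<notin> K"
proof (rule ccontr)
  assume "\<not> thesis"
  with that have cover: "\<And>w. w \<in> pos_words \<Longrightarrow> \<exists>u\<in>U. \<exists>K. Q K \<and> inv u \<otimes> val w \<in> K" by blast
  have "X \<noteq> {}"
  proof
    assume "X = {}"
    then have "carrier G = {\<one>}" using generate_gens generate_empty by simp
    then show False using Q_index[OF Q_trivial, of "{\<one>}"] by (auto simp: set_mult_def)
  qed
  then obtain y where y: "y \<in> X" by blast
  then have yc: "y \<in> carrier G" using gens by blast
  \<comment> \<open>Prefixing a word by up to \<open>k - 1\<close> letters \<open>y\<close> makes its length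
    divisible by \<open>k\<close>; the factors \<open>y\<^sup>j\<close> account for this
    prefix.\<close>
  define T where "T = (\<lambda>(j, u). inv (y [^] j) \<otimes> u) ` ({..<k} \<times> U)"
  have T: "finite T" "T \<subseteq> carrier G" using U yc by (auto simp: T_def)
  have TR: "\<exists>t\<in>T. \<exists>r K. Q K \<and> r \<in> K \<and> g = t \<otimes> r" if g: "g \<in> carrier G" for g
  proof -
    obtain z where z: "set z \<subseteq> letters" "val z = g" using positive_representative[OF g] .
    define j where "j = (k - length z mod k) mod k"
    have j: "j < k" "k dvd j + length z"
    proof -
      show "j < k" using k_pos by (simp add: j_def)
      have "(j + length z) mod k = (k - length z mod k + length z mod k) mod k"
        unfolding j_def by (simp add: mod_add_left_eq mod_add_right_eq)
      also have "\<dots> = 0" using k_pos by simp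
      finally show "k dvd j + length z" by presburger
    qed
    let ?w = "replicate j (y, True) @ z"
    have "?w \<in> pos_words" using j z y by (auto simp: pos_words_def)
    then obtain u K where uK: "u \<in> U" "Q K" "inv u \<otimes> val ?w \<in> K" using cover by blast
    have vw: "val ?w = y [^] j \<otimes> g"
      using z y yc by (subst val_append) (auto simp: word_value_replicate)
    have uc: "u \<in> carrier G" using uK U by blast
    have "g = (inv (y [^] j) \<otimes> u) \<otimes> (inv u \<otimes> val ?w)"
    proof -
      have "u \<otimes> (inv u \<otimes> val ?w) = val ?w" "inv (y [^] j) \<otimes> (y [^] j \<otimes> g) = g"
        unfolding vw using g uc yc by (simp_all flip: m_assoc)
      then show ?thesis unfolding vw using g uc yc by (simp add: m_assoc)
    qed
    moreover have "inv (y [^] j) \<otimes> u \<in> T" unfolding T_def using j uK by force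
    ultimately show ?thesis using uK by blast
  qed
  have finite_join: "\<exists>K. Q K \<and> F \<subseteq> K" if "finite F" "\<And>r. r \<in> F \<Longrightarrow> \<exists>K. Q K \<and> r \<in> K" for F
    using that
  proof (induction F rule: finite_induct)
    case empty
    then show ?case using Q_trivial by blast
  next
    case (insert r F)
    then obtain K L where "Q K" "F \<subseteq> K" "Q L" "r \<in> L" by (metis insertCI)
    then show ?case using Q_join[of K L] by blast
  qed
  obtain tt rr where tr: "\<And>g. g \<in> carrier G \<Longrightarrow> tt g \<in> T \<and> (\<exists>K. Q K \<and> rr g \<in> K) \<and> g = tt g \<otimes> rr g"
    using TR by metis
  define F where "F = insert (rr \<one>) (rr ` (\<lambda>(x, t). x \<otimes> t) ` (X \<times> T))"
  have "finite F" unfolding F_def using T finite_gens by blast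
  moreover have "\<exists>K. Q K \<and> r \<in> K" if "r \<in> F" for r
    using that tr T gens unfolding F_def by (auto simp: subset_iff)
  ultimately obtain K where K: "Q K" "F \<subseteq> K" using finite_join by blast
  have Ksub: "subgroup K G" using Q_normal[OF K(1)] normal_imp_subgroup by blast
  have "val w \<in> T <#> K" if "set w \<subseteq> letters" for w
    using that
  proof (induction w)
    case Nil
    have "rr \<one> \<in> K" using K unfolding F_def by blast
    then have "tt \<one> \<otimes> rr \<one> \<in> T <#> K" using tr[of \<one>] unfolding set_mult_def by blast
    then show ?case using tr[of \<one>] by simp
  next
    case (Cons a w)
    then obtain x where a: "a = (x, True)" "x \<in> X" by auto
    from Cons obtain t r where t: "t \<in> T" "r \<in> K" "val w = t \<otimes> r"
      unfolding set_mult_def by auto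
    have c: "x \<in> carrier G" "t \<in> carrier G" "r \<in> carrier G"
      using a gens t T subgroup.mem_carrier[OF Ksub] by auto
    have F: "rr (x \<otimes> t) \<in> F" unfolding F_def using a t by force
    have "rr (x \<otimes> t) \<in> K" using F K by blast
    then have rc: "rr (x \<otimes> t) \<in> carrier G" "rr (x \<otimes> t) \<otimes> r \<in> K"
      using subgroup.mem_carrier[OF Ksub] subgroup.m_closed[OF Ksub] t by auto
    have tc: "tt (x \<otimes> t) \<in> T" "x \<otimes> t = tt (x \<otimes> t) \<otimes> rr (x \<otimes> t)" using tr[of "x \<otimes> t"] c by auto
    have "val (a # w) = x \<otimes> t \<otimes> r" using a t c by (simp add: word_value_Cons m_assoc)
    also have "\<dots> = tt (x \<otimes> t) \<otimes> (rr (x \<otimes> t) \<otimes> r)"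
    proof -
      have "tt (x \<otimes> t) \<in> carrier G" using tc(1) T(2) by blast
      from m_assoc[OF this rc(1) c(3)] show ?thesis by (simp only: tc(2)[symmetric])
    qed
    finally show ?case using tc rc unfolding set_mult_def by blast
  qed
  note vals = this
  have "g \<in> T <#> K" if g: "g \<in> carrier G" for g
  proof -
    obtain w where "set w \<subseteq> letters" "val w = g" using positive_representative[OF g] .
    then show ?thesis using vals by blast
  qed
  then have "carrier G \<subseteq> T <#> K" by blast
  moreover have "T <#> K \<subseteq> carrier G"
    using T subgroup.mem_carrier[OF Ksub] unfolding set_mult_def by auto
  ultimately show False using Q_index[OF K(1) T] by blast
qed

end

section \<open>Semidecidability of sets of words and of congruences\<close>

definition letter_code :: "'a set \<Rightarrow> 'a \<times> bool \<Rightarrow> nat" where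
  "letter_code X a = 2 * to_nat_on X (fst a) + of_bool (snd a)"

definition letter_decode :: "'a set \<Rightarrow> nat \<Rightarrow> 'a \<times> bool" where
  "letter_decode X n = (from_nat_into X (n div 2), odd n)"

lemma word_code_map: "word_code X w = list_encode (map (letter_code X) w)"
  by (simp add: word_code_def letter_code_def[abs_def] case_prod_beta')

context
  fixes X :: "'a set" assumes finite_X: "finite X"
begin

lemma letter_decode_code: "fst a \<in> X \<Longrightarrow> letter_decode X (letter_code X a) = a"
  using finite_X by (cases a) (auto simp: letter_decode_def letter_code_def countable_finite)

lemma letter_code_less: "fst a \<in> X \<Longrightarrow> letter_code X a < 2 * card X"
  using bij_betw_apply[OF to_nat_on_finite[OF finite_X], of "fst a"]
  by (auto simp: letter_code_def of_bool_def)

lemma letter_code_decode: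
  assumes "n < 2 * card X"
  shows "letter_code X (letter_decode X n) = n" "fst (letter_decode X n) \<in> X"
proof -
  have n: "n div 2 \<in> to_nat_on X ` X"
    using assms to_nat_on_finite[OF finite_X] by (auto simp: bij_betw_def)
  then show "fst (letter_decode X n) \<in> X"
    unfolding letter_decode_def by (auto simp: finite_X countable_finite)
  show "letter_code X (letter_decode X n) = n"
    using to_nat_on_from_nat_into[OF n] by (auto simp: letter_decode_def letter_code_def)
qed

lemma map_letter_decode_code: "set w \<subseteq> X \<times> UNIV \<Longrightarrow> map (letter_decode X) (map (letter_code X) w) = w"
  by (induction w) (auto simp: letter_decode_code)

lemma map_letter_code_decode:
  "\<forall>n\<in>set ns. n < 2 * card X \<Longrightarrow> map (letter_code X) (map (letter_decode X) ns) = ns"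
  by (induction ns) (auto simp: letter_code_decode)

lemma word_code_inj: "inj_on (word_code X) (free_words X)"
proof (rule inj_onI)
  fix u v assume uv: "u \<in> free_words X" "v \<in> free_words X" "word_code X u = word_code X v"
  then have "map (letter_code X) u = map (letter_code X) v"
    by (simp add: word_code_map list_encode_eq)
  then show "u = v" using map_letter_decode_code uv(1,2) unfolding free_words_def
    by (metis (no_types, lifting) mem_Collect_eq)
qed

text \<open>The right-hand side is visibly semidecidable: the letters are in range, and consecutive letters
  \<open>2 m\<close> and \<open>2 m + 1\<close>, which are inverse to each other, are excluded.\<close>

lemma free_words_code_iff:
  "ns \<in> map (letter_code X) ` free_words X \<longleftrightarrow>
     (\<forall>i<length ns. cnth (list_encode ns) i < 2 * card X) \<and>
     (\<forall>i<length ns - 1. \<exists>m m'.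
        (cnth (list_encode ns) i = m + m \<or> cnth (list_encode ns) i = Suc (m + m)) \<and>
        (cnth (list_encode ns) (Suc i) = m' + m' \<or> cnth (list_encode ns) (Suc i) = Suc (m' + m')) \<and>
        (m < m' \<or> m' < m \<or> cnth (list_encode ns) i = cnth (list_encode ns) (Suc i)))"
    (is "_ \<longleftrightarrow> ?A \<and> ?B")
proof -
  have half: "(\<exists>m m'. (x = m + m \<or> x = Suc (m + m)) \<and> (y = m' + m' \<or> y = Suc (m' + m')) \<and>
      (m < m' \<or> m' < m \<or> x = y)) \<longleftrightarrow> x div 2 \<noteq> y div 2 \<or> x = y" for x y :: nat
  proof -
    have "x = m + m \<or> x = Suc (m + m) \<longleftrightarrow> m = x div 2" for x m :: nat by presburger
    then show ?thesis by (simp add: nat_neq_iff disj_assoc)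
  qed
  have A: "?A \<longleftrightarrow> (\<forall>n\<in>set ns. n < 2 * card X)" by (auto simp: cnth all_set_conv_all_nth)
  have B: "?B \<longleftrightarrow> successively (\<lambda>x y. x div 2 \<noteq> y div 2 \<or> x = y) ns"
    unfolding half successively_conv_nth by (auto simp: cnth less_diff_conv)
  have letters: "\<not> (fst (letter_decode X x) = fst (letter_decode X y) \<and>
      snd (letter_decode X x) \<noteq> snd (letter_decode X y)) \<longleftrightarrow> x div 2 \<noteq> y div 2 \<or> x = y"
    if xy: "x < 2 * card X" "y < 2 * card X" for x y
  proof -
    have "x div 2 = y div 2" if "fst (letter_decode X x) = fst (letter_decode X y)"
    proof -
      have "letter_code X (letter_decode X x) div 2 = letter_code X (letter_decode X y) div 2"
        using that by (simp add: letter_code_def)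
      then show ?thesis using letter_code_decode(1) xy by simp
    qed
    moreover have "snd (letter_decode X x) = snd (letter_decode X y) \<longleftrightarrow> (even x \<longleftrightarrow> even y)"
      by (auto simp: letter_decode_def)
    moreover have "x = y \<longleftrightarrow> x div 2 = y div 2 \<and> (even x \<longleftrightarrow> even y)" by presburger
    moreover have "fst (letter_decode X x) = fst (letter_decode X y)" if "x div 2 = y div 2"
      using that by (simp add: letter_decode_def)
    ultimately show ?thesis by blast
  qed
  have red: "reduced (map (letter_decode X) ns) \<longleftrightarrow> ?B" if ns: "\<forall>n\<in>set ns. n < 2 * card X"
    unfolding B reduced_def successively_map
    by (rule successively_cong) (use ns letters in auto)
  have sub: "set (map (letter_decode X) ns) \<subseteq> X \<times> UNIV" if ns: "\<forall>n\<in>set ns. n < 2 * card X"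
    unfolding set_map by (rule image_subsetI) (use ns letter_code_decode(2) in \<open>simp add: mem_Times_iff\<close>)
  show ?thesis
  proof
    assume "ns \<in> map (letter_code X) ` free_words X"
    then obtain w where w: "w \<in> free_words X" "ns = map (letter_code X) w" by blast
    then have l: "set w \<subseteq> X \<times> UNIV" by (simp add: free_words_def)
    then have ns: "\<forall>n\<in>set ns. n < 2 * card X" unfolding w(2) using letter_code_less by fastforce
    have "map (letter_decode X) ns = w" unfolding w(2) using l by (rule map_letter_decode_code)
    then show "?A \<and> ?B" using red[OF ns] w(1) A ns by (simp add: free_words_def)
  next
    assume AB: "?A \<and> ?B"
    then have ns: "\<forall>n\<in>set ns. n < 2 * card X" using A by blast
    then have "map (letter_decode X) ns \<in> free_words X"
      using red sub AB by (simp add: free_words_def)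
    then show "ns \<in> map (letter_code X) ` free_words X"
      using map_letter_code_decode[OF ns] by (metis imageI)
  qed
qed

end

lemma computable_mult_const:
  assumes "computable f" shows "computable (\<lambda>x. k * f x)"
  by (induction k) (simp_all add: computable_intros assms)

lemma sigma1_free_words:
  assumes "finite X" "computable_list f"
  shows "sigma1 (\<lambda>x. f x \<in> map (letter_code X) ` free_words X)"
  unfolding free_words_code_iff[OF assms(1)]
  by (intro sigma1_intros computable_intros assms computable_compose[OF assms(2)])

lemma sigma1_thue_congruence:
  assumes fin: "finite Y" and comp: "computable_list u" "computable_list w" "computable_list f" "computable_list g"
  shows "sigma1 (\<lambda>x. thue_congruence (power_rules k Y (u x) (w x)) (f x) (g x))"
proof -
  define R where "R = (\<lambda>q c d. thue_step (power_rules k Y (list_decode (pr1 q)) (list_decode (pr2 q)))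
    (list_decode c) (list_decode d))"
  have lift: "(R (pair (list_encode us) (list_encode ws)))\<^sup>*\<^sup>* (list_encode as) (list_encode bs)
      \<longleftrightarrow> thue_congruence (power_rules k Y us ws) as bs" for us ws as bs
  proof
    assume "(R (pair (list_encode us) (list_encode ws)))\<^sup>*\<^sup>* (list_encode as) (list_encode bs)"
    then have "thue_congruence (power_rules k Y us ws) as (list_decode (list_encode bs))"
    proof (induction rule: rtranclp_induct)
      case (step c d)
      then have "thue_step (power_rules k Y us ws) (list_decode c) (list_decode d)"
        by (simp add: R_def)
      with step(3) show ?case by (rule rtranclp.rtrancl_into_rtrancl)
    qed simp
    then show "thue_congruence (power_rules k Y us ws) as bs" by simp
  next
    assume "thue_congruence (power_rules k Y us ws) as bs"
    then show "(R (pair (list_encode us) (list_encode ws)))\<^sup>*\<^sup>* (list_encode as) (list_encode bs)"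
    proof (induction rule: rtranclp_induct)
      case (step b c)
      then have "R (pair (list_encode us) (list_encode ws)) (list_encode b) (list_encode c)"
        by (simp add: R_def)
      with step(3) show ?case by (rule rtranclp.rtrancl_into_rtrancl)
    qed simp
  qed
  have mem: "(l, r) \<in> power_rules k Y us ws \<longleftrightarrow>
      (l = us \<and> r = ws) \<or> (\<exists>y\<in>Y. l = replicate k y \<and> r = [])" for l r us ws
    by (auto simp: power_rules_def)
  have finite_ex: "sigma1 (\<lambda>x. \<exists>y\<in>Y. P y x)" if "\<And>y. sigma1 (P y)" for P
    using fin
  proof (induction Y rule: finite_induct)
    case empty
    then show ?case using sigma1_eq[of "\<lambda>_. 0" "\<lambda>_. 1"] by (simp add: computable_intros)
  next
    case (insert y Y)
    then show ?case using sigma1_disj[OF that[of y]] by simp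
  qed
  have "sigma1 (\<lambda>z. R (pr1 (pr1 z)) (pr2 (pr1 z)) (pr2 z))"
    unfolding R_def thue_step_def mem
    by (intro sigma1_intros finite_ex computable_intros)
  then have "sigma1 (\<lambda>x. (R (pair (list_encode (u x)) (list_encode (w x))))\<^sup>*\<^sup>*
      (list_encode (f x)) (list_encode (g x)))"
    by (rule sigma1_rtranclp) (intro computable_intros comp)+
  then show ?thesis unfolding lift .
qed

context torsion_generated
begin

lemma pos_words_code_iff:
  "ns \<in> map (letter_code X) ` pos_words \<longleftrightarrow>
     (\<forall>i<length ns. \<exists>j. j < card X \<and> cnth (list_encode ns) i = Suc (2 * j)) \<and> (\<exists>m. length ns = k * m)"
proof -
  have A: "(\<forall>i<length ns. \<exists>j. j < card X \<and> cnth (list_encode ns) i = Suc (2 * j)) \<longleftrightarrow>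
      (\<forall>n\<in>set ns. \<exists>j<card X. n = Suc (2 * j))" by (auto simp: cnth all_set_conv_all_nth)
  have "(\<exists>w. set w \<subseteq> letters \<and> ns = map (letter_code X) w) \<longleftrightarrow> (\<forall>n\<in>set ns. \<exists>j<card X. n = Suc (2 * j))"
  proof
    assume "\<exists>w. set w \<subseteq> letters \<and> ns = map (letter_code X) w"
    then show "\<forall>n\<in>set ns. \<exists>j<card X. n = Suc (2 * j)"
      using letter_code_less[OF finite_gens] by (fastforce simp: letter_code_def)
  next
    assume ns: "\<forall>n\<in>set ns. \<exists>j<card X. n = Suc (2 * j)"
    then have less: "\<forall>n\<in>set ns. n < 2 * card X" by fastforce
    have "letter_decode X n \<in> letters" if "n \<in> set ns" for n
      using ns that letter_code_decode(2)[OF finite_gens, of n] less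
      by (auto simp: letter_decode_def)
    then have "set (map (letter_decode X) ns) \<subseteq> letters" unfolding set_map by (rule image_subsetI)
    then show "\<exists>w. set w \<subseteq> letters \<and> ns = map (letter_code X) w"
      using map_letter_code_decode[OF finite_gens less] by metis
  qed
  moreover have "ns \<in> map (letter_code X) ` pos_words \<longleftrightarrow>
      (\<exists>w. set w \<subseteq> letters \<and> ns = map (letter_code X) w) \<and> k dvd length ns"
    by (auto simp: pos_words_def)
  ultimately show ?thesis unfolding A dvd_def by blast
qed

lemma sigma1_pos_words:
  assumes "computable_list f"
  shows "sigma1 (\<lambda>x. f x \<in> map (letter_code X) ` pos_words)"
  unfolding pos_words_code_iff
  by (intro sigma1_intros computable_intros computable_mult_const assms computable_compose[OF assms])

section \<open>Words separated by a partial decision algorithm\<close>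

text \<open>A certificate that \<open>u\<close> and \<open>w\<close> have different values: adding the
  relation \<open>u = w\<close> would identify two words \<open>a\<close> and \<open>b\<close>
  that the algorithm \<open>p\<close> declares different.\<close>

definition separated :: "recf \<Rightarrow> 'a word \<Rightarrow> 'a word \<Rightarrow> bool" where
  "separated p u w \<longleftrightarrow> (\<exists>a\<in>free_words X. \<exists>b\<in>free_words X.
     recf_eval p [word_code X a, word_code X b] 0 \<and> thue_congruence (rules u w) a b)"

lemma separated_code_iff:
  assumes "set u \<subseteq> letters" "set w \<subseteq> letters"
  shows "separated p u w \<longleftrightarrow> (\<exists>as bs. as \<in> map (letter_code X) ` free_words X \<and>
     bs \<in> map (letter_code X) ` free_words X \<and> recf_eval p [list_encode as, list_encode bs] 0 \<and>
     thue_congruence (power_rules k (letter_code X ` letters) (map (letter_code X) u) (map (letter_code X) w)) as bs)"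
    (is "_ \<longleftrightarrow> ?R")
proof
  assume "separated p u w"
  then obtain a b where ab: "a \<in> free_words X" "b \<in> free_words X"
    "recf_eval p [word_code X a, word_code X b] 0" "thue_congruence (rules u w) a b"
    unfolding separated_def by blast
  then show ?R using thue_congruence_map[OF ab(4), of "letter_code X"]
    unfolding power_rules_map word_code_map by blast
next
  assume ?R
  then obtain a b where ab: "a \<in> free_words X" "b \<in> free_words X"
      "recf_eval p [word_code X a, word_code X b] 0"
    and cong: "thue_congruence (power_rules k (letter_code X ` letters) (map (letter_code X) u) (map (letter_code X) w))
      (map (letter_code X) a) (map (letter_code X) b)"
    unfolding word_code_map by blast
  have "(\<lambda>a. letter_decode X (letter_code X a)) ` letters = (\<lambda>a. a) ` letters"
    by (rule image_cong) (auto intro: letter_decode_code[OF finite_gens])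
  then have "letter_decode X ` letter_code X ` letters = letters"
    unfolding image_image by simp
  then have "thue_congruence (rules u w) a b"
    using thue_congruence_map[OF cong, of "letter_decode X"] ab(1,2)
      map_letter_decode_code[OF finite_gens] letters_UNIV assms
    unfolding power_rules_map free_words_def by (simp del: map_map)
  with ab show "separated p u w" unfolding separated_def by blast
qed

lemma separated_sound:
  assumes "partial_EP_algorithm G X p" "set u \<subseteq> letters" "set w \<subseteq> letters" "separated p u w"
  shows "val u \<noteq> val w"
proof
  assume eq: "val u = val w"
  obtain a b where ab: "a \<in> free_words X" "b \<in> free_words X"
    "recf_eval p [word_code X a, word_code X b] 0" "thue_congruence (rules u w) a b"
    using assms(4) unfolding separated_def by blast
  have "val a = val b"
    using thue_congruence_val[OF ab(4) _ assms(2,3) eq] ab(1) by (simp add: free_words_def)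
  then show False using assms(1) ab unfolding partial_EP_algorithm_def by fastforce
qed

text \<open>On \<open>S\<close> the algorithm always answers, so that two congruent words of
  \<open>S\<close> with different values would be a certificate.\<close>

lemma unseparated_thin:
  assumes "partial_EP_algorithm G X p" "S \<subseteq> free_words X"
    and halts: "\<And>a b. a \<in> S \<Longrightarrow> b \<in> S \<Longrightarrow> \<exists>y. recf_eval p [word_code X a, word_code X b] y"
    and "\<not> separated p u w" "a \<in> S" "b \<in> S" "thue_congruence (rules u w) a b"
  shows "val a = val b"
proof (rule ccontr)
  assume "val a \<noteq> val b"
  then have "recf_eval p [word_code X a, word_code X b] 0"
    using halts[OF assms(5,6)] assms(1,2,5,6) unfolding partial_EP_algorithm_def by fastforce
  then show False using assms unfolding separated_def by blast
qed

text \<open>If all pairs with \<open>relator_subgroup u w\<close> outside \<open>Q\<close> were separated,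
  then \<open>fresh_word\<close> would provide, for every finite list of words, a word separated
  from all of them, and the greedy search would list infinitely many words with distinct values.\<close>

lemma unseparated_pair_exists:
  assumes algfin: "algorithmically_finite G X" and EP: "EP_decidable_on G X S" and S: "S \<subseteq> free_words X"
    and Q_normal: "\<And>K. Q K \<Longrightarrow> K \<lhd> G" and Q_trivial: "Q {\<one>}"
    and Q_join: "\<And>K L. Q K \<Longrightarrow> Q L \<Longrightarrow> \<exists>M. Q M \<and> K \<subseteq> M \<and> L \<subseteq> M"
    and Q_index: "\<And>K T. Q K \<Longrightarrow> finite T \<Longrightarrow> T \<subseteq> carrier G \<Longrightarrow> T <#> K \<noteq> carrier G"
  obtains u w where "u \<in> pos_words" "w \<in> pos_words" "\<not> Q (relator_subgroup u w)"
    "\<forall>a\<in>S. \<forall>b\<in>S. thue_congruence (rules u w) a b \<longrightarrow> val a = val b"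
proof (rule ccontr)
  assume no: "\<not> thesis"
  obtain p where p: "partial_EP_algorithm G X p"
    and halts: "\<And>a b. a \<in> S \<Longrightarrow> b \<in> S \<Longrightarrow> \<exists>y. recf_eval p [word_code X a, word_code X b] y"
    using EP unfolding EP_decidable_on_def by blast
  note goal = that
  have sep: "separated p u w"
    if uw: "u \<in> pos_words" "w \<in> pos_words" "\<not> Q (relator_subgroup u w)" for u w
  proof (rule ccontr)
    assume "\<not> separated p u w"
    note thin = unseparated_thin[OF p S halts this]
    have "\<forall>a\<in>S. \<forall>b\<in>S. thue_congruence (rules u w) a b \<longrightarrow> val a = val b"
      by (intro ballI impI) (rule thin)
    from goal[OF uw this] no show False by simp
  qed
  let ?c = "map (letter_code X)"
  define E where "E = (\<lambda>us ws. \<exists>as bs. as \<in> ?c ` free_words X \<and> bs \<in> ?c ` free_words X \<and>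
    recf_eval p [list_encode as, list_encode bs] 0 \<and>
    thue_congruence (power_rules k (letter_code X ` letters) us ws) as bs)"
  have E: "separated p u w \<longleftrightarrow> E (?c u) (?c w)" if "set u \<subseteq> letters" "set w \<subseteq> letters" for u w
    using separated_code_iff[OF that] unfolding E_def .
  define ext where "ext = (\<lambda>L c. list_decode c \<in> ?c ` pos_words \<and>
    (\<forall>i<length L. E (list_decode (cnth (list_encode L) i)) (list_decode c)))"
  have "sigma1 (\<lambda>z. ext (list_decode (pr1 z)) (pr2 z))"
    unfolding ext_def E_def
    by (intro sigma1_intros sigma1_pos_words sigma1_free_words sigma1_recf_eval
        sigma1_thue_congruence finite_imageI finite_cartesian_product finite_gens
        finite.intros computable_intros)
  moreover have "\<exists>c. ext L c" if "chain ext L" for L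
  proof -
    have L: "list_decode c \<in> ?c ` pos_words" if "c \<in> set L" for c
      using \<open>chain ext L\<close> that by (induction L) (auto simp: ext_def)
    define V where "V = {u \<in> pos_words. word_code X u \<in> set L}"
    have "finite V"
      using inj_on_finite[OF inj_on_subset[OF word_code_inj[OF finite_gens]], of V "set L"] pos_words_free
      unfolding V_def by auto
    moreover have "val ` V \<subseteq> carrier G" unfolding V_def using pos_words_letters val_closed by auto
    ultimately obtain w where w: "w \<in> pos_words"
      "\<And>g K. g \<in> val ` V \<Longrightarrow> Q K \<Longrightarrow> inv g \<otimes> val w \<notin> K"
      using fresh_word[OF Q_normal Q_trivial Q_join Q_index, of "val ` V"] by blast
    have "E (list_decode (cnth (list_encode L) i)) (?c w)" if i: "i < length L" for i
    proof -
      obtain u where u: "u \<in> pos_words" "list_decode (L ! i) = ?c u"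
        using L[OF nth_mem[OF i]] by blast
      then have "word_code X u = L ! i"
        unfolding word_code_map by (metis list_decode_inverse)
      then have "val u \<in> val ` V" using u i unfolding V_def by auto
      then have "\<not> Q (relator_subgroup u w)" using w relator_subgroup_mem[OF u(1) w(1)] by blast
      then have "separated p u w" using sep u w by blast
      then show ?thesis using E u w i pos_words_letters by (simp add: cnth)
    qed
    then have "ext L (word_code X w)" using w(1) by (simp add: ext_def word_code_map)
    then show ?thesis by blast
  qed
  ultimately obtain c where c: "ce_set (range c)" "\<And>n. ext (rev (map c [0..<n])) (c n)"
    using greedy_ce_set[of ext] by metis
  have "\<exists>v. v \<in> pos_words \<and> list_decode (c n) = ?c v" for n using c(2)[of n] unfolding ext_def by blast
  then obtain v where v: "\<And>n. v n \<in> pos_words" "\<And>n. list_decode (c n) = ?c (v n)" by metis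
  have cv: "c n = word_code X (v n)" for n
    unfolding word_code_map using v(2) by (metis list_decode_inverse)
  have less: "val (v i) \<noteq> val (v n)" if "i < n" for i n
  proof -
    \<comment> \<open>The list is reversed: the most recent element has index 0.\<close>
    have "cnth (list_encode (rev (map c [0..<n]))) (n - Suc i) = c i"
      using that by (subst cnth) (auto simp: rev_nth)
    moreover have "n - Suc i < length (rev (map c [0..<n]))" using that by simp
    ultimately have "E (list_decode (c i)) (list_decode (c n))" using c(2)[of n] unfolding ext_def by metis
    then have "separated p (v i) (v n)" using E v pos_words_letters by simp
    then show ?thesis using separated_sound[OF p] v pos_words_letters by blast
  qed
  then have distinct: "val (v i) \<noteq> val (v n)" if "i \<noteq> n" for i n
    using that by (metis linorder_neqE_nat)
  then have "inj v" by (metis injI)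
  then have "infinite (range v)" using finite_imageD by blast
  moreover have "ce_words X (range v)"
    using c(1) pos_words_free v(1) cv unfolding ce_words_def by (auto simp: image_image)
  ultimately obtain i j where "v i \<noteq> v j" "val (v i) = val (v j)"
    using algfin unfolding algorithmically_finite_def by blast
  then show False using distinct by metis
qed

end

section \<open>Almost invariant functions and amenability\<close>

text \<open>This is the identity \<open>card E * (\<Sum>k. (a k)\<^sup>2) - (\<Sum>k. a k)\<^sup>2 =
  (\<Sum>k l. (a k - a l)\<^sup>2) / 2\<close> with all summands dropped except those for
  \<open>(i, j)\<close> and \<open>(j, i)\<close>.\<close>

lemma square_sum_gap:
  fixes a :: "'b \<Rightarrow> real"
  assumes "finite E" "i \<in> E" "j \<in> E"
  shows "(a i - a j)\<^sup>2 + (\<Sum>k\<in>E. a k)\<^sup>2 \<le> card E * (\<Sum>k\<in>E. (a k)\<^sup>2)"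
proof (cases "i = j")
  case True
  have "(\<Sum>k\<in>E. a k * 1)\<^sup>2 \<le> (\<Sum>k\<in>E. (a k)\<^sup>2) * (\<Sum>k\<in>E. 1\<^sup>2)"
    by (rule Cauchy_Schwarz_ineq_sum)
  then show ?thesis using True by (simp add: mult.commute)
next
  case False
  have "(\<Sum>x\<in>{i, j}. \<Sum>y\<in>{i, j}. (a x - a y)\<^sup>2) \<le> (\<Sum>x\<in>{i, j}. \<Sum>y\<in>E. (a x - a y)\<^sup>2)"
    using assms by (intro sum_mono sum_mono2) auto
  also have "\<dots> \<le> (\<Sum>x\<in>E. \<Sum>y\<in>E. (a x - a y)\<^sup>2)"
    using assms by (intro sum_mono2 sum_nonneg) auto
  also have "\<dots> = (\<Sum>x\<in>E. \<Sum>y\<in>E. (a x)\<^sup>2 + (a y)\<^sup>2 - 2 * (a x * a y))"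
    by (simp add: power2_diff algebra_simps)
  also have "\<dots> = 2 * card E * (\<Sum>k\<in>E. (a k)\<^sup>2) - 2 * (\<Sum>k\<in>E. a k)\<^sup>2"
    by (simp add: sum.distrib sum_subtractf power2_eq_square sum_product sum_distrib_left algebra_simps)
  finally have "2 * (a i - a j)\<^sup>2 \<le> 2 * card E * (\<Sum>k\<in>E. (a k)\<^sup>2) - 2 * (\<Sum>k\<in>E. a k)\<^sup>2"
    using False by (simp add: power2_commute)
  then show ?thesis by simp
qed

context group
begin

lemma normal_set_mult:
  assumes "K \<lhd> G" "L \<lhd> G"
  shows "K <#> L \<lhd> G" "K \<subseteq> K <#> L" "L \<subseteq> K <#> L"
proof -
  have K: "subgroup K G" and L: "subgroup L G" using assms normal_imp_subgroup by auto
  have c: "k \<in> carrier G" if "k \<in> K \<or> k \<in> L" for k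
    using that subgroup.mem_carrier[OF K] subgroup.mem_carrier[OF L] by blast
  have "g \<otimes> x \<otimes> inv g \<in> K <#> L" if g: "g \<in> carrier G" and x: "x \<in> K <#> L" for g x
  proof -
    obtain k l where kl: "k \<in> K" "l \<in> L" "x = k \<otimes> l" using x unfolding set_mult_def by blast
    have "inv g \<otimes> (g \<otimes> (l \<otimes> inv g)) = l \<otimes> inv g" using g c kl by (simp flip: m_assoc)
    then have "g \<otimes> x \<otimes> inv g = (g \<otimes> k \<otimes> inv g) \<otimes> (g \<otimes> l \<otimes> inv g)"
      using g c kl by (simp add: m_assoc)
    moreover have "g \<otimes> k \<otimes> inv g \<in> K" "g \<otimes> l \<otimes> inv g \<in> L"
      using normal.inv_op_closed2[OF assms(1) g kl(1)] normal.inv_op_closed2[OF assms(2) g kl(2)] by auto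
    ultimately show ?thesis unfolding set_mult_def by auto
  qed
  then show "K <#> L \<lhd> G" unfolding normal_inv_iff
    using mult_norm_subgroup[OF assms(1) L] by blast
  show "K \<subseteq> K <#> L"
  proof
    fix k assume k: "k \<in> K"
    then have "k = k \<otimes> \<one>" using c by simp
    with k subgroup.one_closed[OF L] show "k \<in> K <#> L" unfolding set_mult_def by blast
  qed
  show "L \<subseteq> K <#> L"
  proof
    fix l assume l: "l \<in> L"
    then have "l = \<one> \<otimes> l" using c by simp
    with l subgroup.one_closed[OF K] show "l \<in> K <#> L" unfolding set_mult_def by blast
  qed
qed

lemma finite_set_mult: "finite T \<Longrightarrow> finite K \<Longrightarrow> finite (T <#> K)"
  unfolding set_mult_def by auto

lemma sum_translate:
  assumes "k \<in> carrier G" "Y \<subseteq> carrier G"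
  shows "(\<Sum>g\<in>Y. F (k \<otimes> g)) = (\<Sum>g\<in>(\<otimes>) k ` Y. F g)"
  using assms by (subst sum.reindex) (auto simp: inj_on_def subset_iff)

text \<open>Conditions are imposed on the carrier only, because products with elements outside of it are
  unspecified.\<close>

definition prob_weight :: "('a \<Rightarrow> real) \<Rightarrow> bool" where
  "prob_weight f \<longleftrightarrow> (\<exists>H. finite H \<and> H \<subseteq> carrier G \<and> (\<forall>g\<in>carrier G. 0 \<le> f g \<and> (g \<notin> H \<longrightarrow> f g = 0)) \<and> sum f H = 1)"

text \<open>A bound for the \<open>\<ell>\<^sup>1\<close> distance between \<open>f\<close> and its
  translate, expressed by finite partial sums.\<close>

definition moved_by :: "'a \<Rightarrow> ('a \<Rightarrow> real) \<Rightarrow> real \<Rightarrow> bool" where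
  "moved_by k f \<epsilon> \<longleftrightarrow> (\<forall>Y. finite Y \<and> Y \<subseteq> carrier G \<longrightarrow> (\<Sum>g\<in>Y. \<bar>f (k \<otimes> g) - f g\<bar>) \<le> \<epsilon>)"

text \<open>Reiter's condition for the action of \<open>K\<close> on \<open>G\<close> by left
  multiplication. For a subgroup it is equivalent to amenability of \<open>K\<close>, but
  functions on \<open>G\<close> are what extensions and counting arguments need.\<close>

definition reiter :: "'a set \<Rightarrow> bool" where
  "reiter K \<longleftrightarrow> (\<forall>E \<epsilon>. finite E \<and> E \<subseteq> K \<and> 0 < \<epsilon> \<longrightarrow>
     (\<exists>f. prob_weight f \<and> (\<forall>k\<in>E. moved_by k f \<epsilon>)))"

lemma moved_byD:
  "moved_by k f \<epsilon> \<Longrightarrow> finite Y \<Longrightarrow> Y \<subseteq> carrier G \<Longrightarrow> (\<Sum>g\<in>Y. \<bar>f (k \<otimes> g) - f g\<bar>) \<le> \<epsilon>"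
  unfolding moved_by_def by blast

lemma reiterE:
  assumes "reiter K" "finite E" "E \<subseteq> K" "0 < \<epsilon>"
  obtains f where "prob_weight f" "\<forall>k\<in>E. moved_by k f \<epsilon>"
proof -
  have "finite E \<and> E \<subseteq> K \<and> 0 < \<epsilon>" using assms by simp
  then have "\<exists>f. prob_weight f \<and> (\<forall>k\<in>E. moved_by k f \<epsilon>)"
    using assms(1) unfolding reiter_def by (elim allE impE) 
  then show thesis using that by blast
qed

lemma translate_closed: "k \<in> carrier G \<Longrightarrow> Y \<subseteq> carrier G \<Longrightarrow> (\<otimes>) k ` Y \<subseteq> carrier G"
  by blast

lemma prob_weight_sum_le:
  assumes "prob_weight f" "finite Y" "Y \<subseteq> carrier G" shows "sum f Y \<le> 1"
proof -
  obtain H where H: "finite H" "H \<subseteq> carrier G" "\<And>g. g \<in> carrier G \<Longrightarrow> 0 \<le> f g"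
    "\<And>g. g \<in> carrier G \<Longrightarrow> g \<notin> H \<Longrightarrow> f g = 0" "sum f H = 1"
    using assms(1) unfolding prob_weight_def by blast
  have "sum f Y = sum f (Y \<inter> H)" using H assms by (intro sum.mono_neutral_right) auto
  also have "\<dots> \<le> sum f H" using H by (intro sum_mono2) auto
  finally show ?thesis using H by simp
qed

lemma prob_weight_translate:
  assumes "prob_weight f" "h \<in> carrier G" shows "prob_weight (\<lambda>g. f (h \<otimes> g))"
proof -
  obtain H where H: "finite H" "H \<subseteq> carrier G" "\<And>g. g \<in> carrier G \<Longrightarrow> 0 \<le> f g"
    "\<And>g. g \<in> carrier G \<Longrightarrow> g \<notin> H \<Longrightarrow> f g = 0" "sum f H = 1"
    using assms(1) unfolding prob_weight_def by blast
  let ?H = "(\<otimes>) (inv h) ` H"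
  have cancel: "h \<otimes> (inv h \<otimes> g) = g" "inv h \<otimes> (h \<otimes> g) = g" if "g \<in> carrier G" for g
    using that assms(2) by (simp_all flip: m_assoc)
  have "(\<otimes>) h ` ?H = H" using H(2) cancel by (force simp: image_image subset_iff)
  then have "(\<Sum>g\<in>?H. f (h \<otimes> g)) = 1"
    using sum_translate[OF assms(2), of ?H f] H(2,5) assms(2) by (auto simp: image_subset_iff subset_iff)
  moreover have "f (h \<otimes> g) = 0" if "g \<in> carrier G" "g \<notin> ?H" for g
  proof (rule H(4))
    show "h \<otimes> g \<notin> H"
    proof
      assume "h \<otimes> g \<in> H"
      then have "inv h \<otimes> (h \<otimes> g) \<in> ?H" by blast
      then show False using that cancel by simp
    qed
  qed (use that assms in auto)
  ultimately show ?thesis unfolding prob_weight_def using H assms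
    by (intro exI[of _ ?H]) auto
qed

lemma prob_weight_convex:
  assumes "finite I" "\<And>i. i \<in> I \<Longrightarrow> prob_weight (f i)" "\<And>i. i \<in> I \<Longrightarrow> 0 \<le> c i" "sum c I = 1"
  shows "prob_weight (\<lambda>g. \<Sum>i\<in>I. c i * f i g)"
proof -
  obtain H where H: "\<And>i. i \<in> I \<Longrightarrow> finite (H i) \<and> H i \<subseteq> carrier G \<and>
      (\<forall>g\<in>carrier G. 0 \<le> f i g \<and> (g \<notin> H i \<longrightarrow> f i g = 0)) \<and> sum (f i) (H i) = 1"
    using assms(2) unfolding prob_weight_def by metis
  let ?H = "\<Union> (H ` I)"
  have one: "sum (f i) ?H = 1" if "i \<in> I" for i
  proof -
    have "sum (f i) ?H = sum (f i) (H i)"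
      using H that assms(1) by (intro sum.mono_neutral_right) (fastforce simp: subset_iff)+
    then show ?thesis using H that by simp
  qed
  have "(\<Sum>g\<in>?H. \<Sum>i\<in>I. c i * f i g) = (\<Sum>i\<in>I. c i * sum (f i) ?H)"
    by (subst sum.swap) (simp add: sum_distrib_left)
  also have "\<dots> = 1" using one assms(4) by simp
  finally have "(\<Sum>g\<in>?H. \<Sum>i\<in>I. c i * f i g) = 1" .
  moreover have "\<forall>g\<in>carrier G. 0 \<le> (\<Sum>i\<in>I. c i * f i g) \<and> (g \<notin> ?H \<longrightarrow> (\<Sum>i\<in>I. c i * f i g) = 0)"
    using H assms(3) by (auto intro!: sum_nonneg mult_nonneg_nonneg sum.neutral)
  moreover have "finite ?H" "?H \<subseteq> carrier G" using H assms(1) by auto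
  ultimately show ?thesis unfolding prob_weight_def by blast
qed

lemma moved_by_mult:
  assumes "moved_by k f \<epsilon>" "moved_by l f \<delta>" "k \<in> carrier G" "l \<in> carrier G"
  shows "moved_by (k \<otimes> l) f (\<epsilon> + \<delta>)"
  unfolding moved_by_def
proof (intro allI impI)
  fix Y assume Y: "finite Y \<and> Y \<subseteq> carrier G"
  have "(\<Sum>g\<in>Y. \<bar>f (k \<otimes> l \<otimes> g) - f g\<bar>) \<le> (\<Sum>g\<in>Y. \<bar>f (k \<otimes> (l \<otimes> g)) - f (l \<otimes> g)\<bar> + \<bar>f (l \<otimes> g) - f g\<bar>)"
    using Y assms(3,4) by (intro sum_mono) (auto simp: m_assoc subset_iff)
  also have "\<dots> = (\<Sum>g\<in>(\<otimes>) l ` Y. \<bar>f (k \<otimes> g) - f g\<bar>) + (\<Sum>g\<in>Y. \<bar>f (l \<otimes> g) - f g\<bar>)"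
    using sum_translate[OF assms(4), of Y "\<lambda>g. \<bar>f (k \<otimes> g) - f g\<bar>"] Y by (simp add: sum.distrib)
  also have "\<dots> \<le> \<epsilon> + \<delta>"
  proof (rule add_mono)
    show "(\<Sum>g\<in>(\<otimes>) l ` Y. \<bar>f (k \<otimes> g) - f g\<bar>) \<le> \<epsilon>"
      using Y by (intro moved_byD[OF assms(1)] finite_imageI translate_closed[OF assms(4)]) simp_all
    show "(\<Sum>g\<in>Y. \<bar>f (l \<otimes> g) - f g\<bar>) \<le> \<delta>" using assms Y unfolding moved_by_def by blast
  qed
  finally show "(\<Sum>g\<in>Y. \<bar>f (k \<otimes> l \<otimes> g) - f g\<bar>) \<le> \<epsilon> + \<delta>" .
qed

lemma reiter_trivial: "reiter {\<one>}"
  unfolding reiter_def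
proof (intro allI impI)
  fix E and \<epsilon> :: real assume E: "finite E \<and> E \<subseteq> {\<one>} \<and> 0 < \<epsilon>"
  have "prob_weight (\<lambda>g. of_bool (g = \<one>))"
    unfolding prob_weight_def by (intro exI[of _ "{\<one>}"]) auto
  moreover have "moved_by k (\<lambda>g. of_bool (g = \<one>)) \<epsilon>" if "k \<in> E" for k
    using that E unfolding moved_by_def by (auto simp: subset_iff intro!: sum_nonpos[THEN order_trans])
  ultimately show "\<exists>f. prob_weight f \<and> (\<forall>k\<in>E. moved_by k f \<epsilon>)" by blast
qed

lemma moved_by_convex:
  assumes I: "finite I" "\<And>i. i \<in> I \<Longrightarrow> 0 \<le> c i" "sum c I = 1"
    and diff: "\<And>g. g \<in> carrier G \<Longrightarrow> \<bar>f (k \<otimes> g) - f g\<bar> \<le> (\<Sum>i\<in>I. c i * \<bar>f' (b i \<otimes> (h i \<otimes> g)) - f' (h i \<otimes> g)\<bar>)"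
    and moved: "\<And>i. i \<in> I \<Longrightarrow> h i \<in> carrier G \<and> moved_by (b i) f' \<epsilon>"
  shows "moved_by k f \<epsilon>"
  unfolding moved_by_def
proof (intro allI impI)
  fix Y assume Y: "finite Y \<and> Y \<subseteq> carrier G"
  have "(\<Sum>g\<in>Y. \<bar>f (k \<otimes> g) - f g\<bar>) \<le> (\<Sum>g\<in>Y. \<Sum>i\<in>I. c i * \<bar>f' (b i \<otimes> (h i \<otimes> g)) - f' (h i \<otimes> g)\<bar>)"
    using Y diff by (intro sum_mono) auto
  also have "\<dots> = (\<Sum>i\<in>I. c i * (\<Sum>g\<in>Y. \<bar>f' (b i \<otimes> (h i \<otimes> g)) - f' (h i \<otimes> g)\<bar>))"
    by (subst sum.swap) (simp add: sum_distrib_left)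
  also have "\<dots> \<le> (\<Sum>i\<in>I. c i * \<epsilon>)"
  proof (intro sum_mono mult_left_mono)
    fix i assume i: "i \<in> I"
    have "(\<Sum>g\<in>Y. \<bar>f' (b i \<otimes> (h i \<otimes> g)) - f' (h i \<otimes> g)\<bar>) = (\<Sum>g\<in>(\<otimes>) (h i) ` Y. \<bar>f' (b i \<otimes> g) - f' g\<bar>)"
      using sum_translate[of "h i" Y "\<lambda>g. \<bar>f' (b i \<otimes> g) - f' g\<bar>"] moved[OF i] Y by blast
    also have "\<dots> \<le> \<epsilon>"
      using moved[OF i] Y by (intro moved_byD[of "b i"] finite_imageI translate_closed[of "h i"]) simp_all
    finally show "(\<Sum>g\<in>Y. \<bar>f' (b i \<otimes> (h i \<otimes> g)) - f' (h i \<otimes> g)\<bar>) \<le> \<epsilon>" .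
  qed (rule I)
  also have "\<dots> = \<epsilon>" using I(3) by (simp flip: sum_distrib_right)
  finally show "(\<Sum>g\<in>Y. \<bar>f (k \<otimes> g) - f g\<bar>) \<le> \<epsilon>" .
qed

text \<open>Take \<open>f1\<close> almost invariant under the finitely many given elements of
  \<open>K\<close>, and then \<open>f2\<close> almost invariant under the conjugates of the given
  elements of \<open>L\<close> by the support of \<open>f1\<close>. The convolution of
  \<open>f1\<close> and \<open>f2\<close> is almost invariant under both, since \<open>l h = h
  (h\<^sup>-\<^sup>1 l h)\<close>.\<close>

lemma reiter_set_mult:
  assumes K: "K \<subseteq> carrier G" "reiter K" and L: "L \<lhd> G" "reiter L"
  shows "reiter (K <#> L)"
  unfolding reiter_def
proof (intro allI impI)
  fix E and \<epsilon> :: real assume E: "finite E \<and> E \<subseteq> K <#> L \<and> 0 < \<epsilon>"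
  then have "\<forall>e\<in>E. \<exists>k l. k \<in> K \<and> l \<in> L \<and> e = k \<otimes> l" unfolding set_mult_def by blast
  then obtain k l where kl: "\<And>e. e \<in> E \<Longrightarrow> k e \<in> K \<and> l e \<in> L \<and> e = k e \<otimes> l e" by metis
  have Lc: "L \<subseteq> carrier G" using L(1) normal_imp_subgroup subgroup.subset by blast
  have kE: "finite (k ` E)" "k ` E \<subseteq> K" and \<epsilon>2: "0 < \<epsilon> / 2" using E kl by auto
  obtain f1 where f1: "prob_weight f1" "\<forall>x\<in>k ` E. moved_by x f1 (\<epsilon> / 2)"
    using reiterE[OF K(2) kE \<epsilon>2] .
  obtain H where H: "finite H" "H \<subseteq> carrier G" "\<And>g. g \<in> carrier G \<Longrightarrow> 0 \<le> f1 g"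
    "\<And>g. g \<in> carrier G \<Longrightarrow> g \<notin> H \<Longrightarrow> f1 g = 0" "sum f1 H = 1"
    using f1(1) unfolding prob_weight_def by blast
  define E2 where "E2 = (\<lambda>(e, h). inv h \<otimes> l e \<otimes> h) ` (E \<times> H)"
  have "inv h \<otimes> x \<otimes> h \<in> L" if "x \<in> L" "h \<in> carrier G" for x h
    using normal.inv_op_closed1[OF L(1)] that by blast
  then have E2: "finite E2" "E2 \<subseteq> L" using E H(1,2) kl unfolding E2_def by auto
  obtain f2 where f2: "prob_weight f2" "\<forall>x\<in>E2. moved_by x f2 (\<epsilon> / 2)"
    using reiterE[OF L(2) E2 \<epsilon>2] .
  define f where "f = (\<lambda>g. \<Sum>h\<in>H. f1 h * f2 (inv h \<otimes> g))"
  have "prob_weight f" unfolding f_def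
    using H f2(1) by (intro prob_weight_convex prob_weight_translate) auto
  moreover have "moved_by e f \<epsilon>" if e: "e \<in> E" for e
  proof -
    have kc: "k e \<in> carrier G" and lc: "l e \<in> carrier G" using kl[OF e] K(1) Lc by auto
    have "moved_by (l e) f (\<epsilon> / 2)"
    proof (rule moved_by_convex[where I = H and c = f1 and b = "\<lambda>h. inv h \<otimes> l e \<otimes> h" and h = "m_inv G" and f' = f2])
      fix g assume g: "g \<in> carrier G"
      have eq: "inv h \<otimes> l e \<otimes> h \<otimes> (inv h \<otimes> g) = inv h \<otimes> (l e \<otimes> g)" if "h \<in> H" for h
      proof -
        have "h \<in> carrier G" using that H by blast
        then have "h \<otimes> (inv h \<otimes> g) = g" using g by (simp flip: m_assoc)
        then show ?thesis using \<open>h \<in> carrier G\<close> g lc by (simp add: m_assoc)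
      qed
      have "\<bar>f (l e \<otimes> g) - f g\<bar> = \<bar>\<Sum>h\<in>H. f1 h * (f2 (inv h \<otimes> (l e \<otimes> g)) - f2 (inv h \<otimes> g))\<bar>"
        unfolding f_def by (simp add: sum_subtractf right_diff_distrib)
      also have "\<dots> \<le> (\<Sum>h\<in>H. \<bar>f1 h * (f2 (inv h \<otimes> (l e \<otimes> g)) - f2 (inv h \<otimes> g))\<bar>)" by (rule sum_abs)
      also have "\<dots> = (\<Sum>h\<in>H. f1 h * \<bar>f2 (inv h \<otimes> l e \<otimes> h \<otimes> (inv h \<otimes> g)) - f2 (inv h \<otimes> g)\<bar>)"
        using H eq by (intro sum.cong) (auto simp: abs_mult)
      finally show "\<bar>f (l e \<otimes> g) - f g\<bar> \<le> \<dots>" .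
    next
      fix h assume h: "h \<in> H"
      then have "inv h \<otimes> l e \<otimes> h \<in> E2" unfolding E2_def using e by force
      with f2(2) h H(2) show "inv h \<in> carrier G \<and> moved_by (inv h \<otimes> l e \<otimes> h) f2 (\<epsilon> / 2)" by auto
    qed (use H in auto)
    moreover have "moved_by (k e) f (\<epsilon> / 2)"
      unfolding moved_by_def
    proof (intro allI impI)
      fix Y assume Y: "finite Y \<and> Y \<subseteq> carrier G"
      let ?kH = "(\<otimes>) (inv (k e)) ` H"
      let ?H = "H \<union> ?kH"
      have Hc: "finite ?H" "?H \<subseteq> carrier G" using H kc by (auto simp: subset_iff)
      have cancel: "k e \<otimes> (inv (k e) \<otimes> g) = g" "inv (k e) \<otimes> (k e \<otimes> g) = g" if "g \<in> carrier G" for g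
        using that kc by (simp_all flip: m_assoc)
      have f_g: "f g = (\<Sum>h\<in>?H. f1 h * f2 (inv h \<otimes> g))" for g
        unfolding f_def using Hc H by (intro sum.mono_neutral_left) auto
      have f_kg: "f (k e \<otimes> g) = (\<Sum>h\<in>?H. f1 (k e \<otimes> h) * f2 (inv h \<otimes> g))" if g: "g \<in> carrier G" for g
      proof -
        have "f (k e \<otimes> g) = (\<Sum>h\<in>H. f1 (k e \<otimes> (inv (k e) \<otimes> h)) * f2 (inv (inv (k e) \<otimes> h) \<otimes> g))"
          unfolding f_def
        proof (rule sum.cong)
          fix h assume "h \<in> H"
          then have "h \<in> carrier G" using H by blast
          then show "f1 h * f2 (inv h \<otimes> (k e \<otimes> g)) = f1 (k e \<otimes> (inv (k e) \<otimes> h)) * f2 (inv (inv (k e) \<otimes> h) \<otimes> g)"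
            using cancel g kc by (simp add: inv_mult_group m_assoc)
        qed simp
        also have "\<dots> = (\<Sum>h\<in>?kH. f1 (k e \<otimes> h) * f2 (inv h \<otimes> g))"
          using sum_translate[of "inv (k e)" H "\<lambda>h. f1 (k e \<otimes> h) * f2 (inv h \<otimes> g)"] kc H(2) by simp
        also have "\<dots> = (\<Sum>h\<in>?H. f1 (k e \<otimes> h) * f2 (inv h \<otimes> g))"
        proof (rule sum.mono_neutral_left)
          show "\<forall>h\<in>?H - ?kH. f1 (k e \<otimes> h) * f2 (inv h \<otimes> g) = 0"
          proof
            fix h assume h: "h \<in> ?H - ?kH"
            then have "h \<in> carrier G" using Hc by blast
            moreover have "k e \<otimes> h \<notin> H" using h cancel(2)[of h] \<open>h \<in> carrier G\<close> by (metis DiffD2 imageI)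
            ultimately show "f1 (k e \<otimes> h) * f2 (inv h \<otimes> g) = 0" using H(4) kc by simp
          qed
        qed (use Hc in auto)
        finally show ?thesis .
      qed
      have "(\<Sum>g\<in>Y. \<bar>f (k e \<otimes> g) - f g\<bar>) \<le> (\<Sum>g\<in>Y. \<Sum>h\<in>?H. \<bar>f1 (k e \<otimes> h) - f1 h\<bar> * f2 (inv h \<otimes> g))"
      proof (rule sum_mono)
        fix g assume "g \<in> Y"
        then have g: "g \<in> carrier G" using Y by blast
        have nn: "0 \<le> f2 (inv h \<otimes> g)" if "h \<in> ?H" for h
          using f2(1) g Hc that unfolding prob_weight_def by (metis inv_closed m_closed subsetD)
        have "\<bar>f (k e \<otimes> g) - f g\<bar> = \<bar>\<Sum>h\<in>?H. (f1 (k e \<otimes> h) - f1 h) * f2 (inv h \<otimes> g)\<bar>"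
          unfolding f_kg[OF g] f_g[of g] by (simp add: sum_subtractf left_diff_distrib)
        also have "\<dots> \<le> (\<Sum>h\<in>?H. \<bar>(f1 (k e \<otimes> h) - f1 h) * f2 (inv h \<otimes> g)\<bar>)" by (rule sum_abs)
        also have "\<dots> = (\<Sum>h\<in>?H. \<bar>f1 (k e \<otimes> h) - f1 h\<bar> * f2 (inv h \<otimes> g))"
          using nn by (intro sum.cong) (auto simp: abs_mult)
        finally show "\<bar>f (k e \<otimes> g) - f g\<bar> \<le> \<dots>" .
      qed
      also have "\<dots> = (\<Sum>h\<in>?H. \<bar>f1 (k e \<otimes> h) - f1 h\<bar> * (\<Sum>g\<in>Y. f2 (inv h \<otimes> g)))"
        by (subst sum.swap) (simp add: sum_distrib_left)
      also have "\<dots> \<le> (\<Sum>h\<in>?H. \<bar>f1 (k e \<otimes> h) - f1 h\<bar> * 1)"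
      proof (intro sum_mono mult_left_mono)
        fix h assume "h \<in> ?H"
        then have "h \<in> carrier G" using Hc by blast
        then show "(\<Sum>g\<in>Y. f2 (inv h \<otimes> g)) \<le> 1"
          using prob_weight_sum_le[OF prob_weight_translate[OF f2(1), of "inv h"]] Y by simp
      qed simp
      also have "\<dots> \<le> \<epsilon> / 2" using f1(2) e Hc unfolding moved_by_def by simp
      finally show "(\<Sum>g\<in>Y. \<bar>f (k e \<otimes> g) - f g\<bar>) \<le> \<epsilon> / 2" .
    qed
    ultimately have "moved_by (k e \<otimes> l e) f (\<epsilon> / 2 + \<epsilon> / 2)"
      using moved_by_mult kc lc by blast
    then show ?thesis using kl[OF e] by simp
  qed
  ultimately show "\<exists>f. prob_weight f \<and> (\<forall>k\<in>E. moved_by k f \<epsilon>)" by blast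
qed

text \<open>Left multiplication by an element of \<open>G\<close> permutes the finitely many cosets \<open>t
  K\<close>, and changes the representatives by elements of \<open>K\<close> only. So the mean of
  the translates \<open>t f'\<close> is almost invariant if \<open>f'\<close> is almost invariant
  under finitely many elements of \<open>K\<close>.\<close>

lemma reiter_finite_index:
  assumes K: "K \<lhd> G" "reiter K" and T: "finite T" "T \<subseteq> carrier G" "T <#> K = carrier G"
  shows "reiter (carrier G)"
  unfolding reiter_def
proof (intro allI impI)
  fix E and \<epsilon> :: real assume E: "finite E \<and> E \<subseteq> carrier G \<and> 0 < \<epsilon>"
  have sub: "subgroup K G" using K normal_imp_subgroup by blast
  note Kc = subgroup.mem_carrier[OF sub]
  define rep where "rep = (\<lambda>g. SOME t. t \<in> T \<and> inv t \<otimes> g \<in> K)"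
  have rep: "rep g \<in> T \<and> inv (rep g) \<otimes> g \<in> K" if g: "g \<in> carrier G" for g
  proof -
    obtain t k where t: "t \<in> T" "k \<in> K" "g = t \<otimes> k" using T(3) g unfolding set_mult_def by blast
    then have "inv t \<otimes> g = k" using T(2) Kc by (simp add: subset_iff flip: m_assoc)
    then have "\<exists>t. t \<in> T \<and> inv t \<otimes> g \<in> K" using t by blast
    then show ?thesis unfolding rep_def by (rule someI_ex)
  qed
  have repc: "rep g \<in> carrier G" if "g \<in> carrier G" for g using rep[OF that] T(2) by blast
  have coset: "inv t \<otimes> h \<in> K" if "t \<in> carrier G" "g \<in> carrier G" "h \<in> carrier G" "inv t \<otimes> g \<in> K" "inv g \<otimes> h \<in> K" for t g h
  proof -
    have "inv t \<otimes> h = (inv t \<otimes> g) \<otimes> (inv g \<otimes> h)"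
    proof -
      have "g \<otimes> (inv g \<otimes> h) = h" using that by (simp flip: m_assoc)
      then show ?thesis using that by (simp add: m_assoc)
    qed
    then show ?thesis using that subgroup.m_closed[OF sub] by simp
  qed
  have coset_sym: "inv h \<otimes> g \<in> K" if "g \<in> carrier G" "h \<in> carrier G" "inv g \<otimes> h \<in> K" for g h
    using subgroup.m_inv_closed[OF sub that(3)] that by (simp add: inv_mult_group)
  have rep_eq: "rep g = rep h" if "g \<in> carrier G" "h \<in> carrier G" "inv g \<otimes> h \<in> K" for g h
  proof -
    have "inv t \<otimes> g \<in> K \<longleftrightarrow> inv t \<otimes> h \<in> K" if "t \<in> T" for t
      using coset coset_sym \<open>g \<in> carrier G\<close> \<open>h \<in> carrier G\<close> \<open>inv g \<otimes> h \<in> K\<close> T(2) that by (meson subsetD)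
    then show ?thesis unfolding rep_def by meson
  qed
  have rep_inv: "inv g \<otimes> h \<in> K" if "g \<in> carrier G" "h \<in> carrier G" "rep g = rep h" for g h
  proof (rule coset[of _ "rep g"])
    show "inv g \<otimes> rep g \<in> K" using coset_sym[of "rep g" g] rep repc that by blast
    show "inv (rep g) \<otimes> h \<in> K" using rep[of h] that by simp
  qed (use that repc in auto)
  define R where "R = rep ` carrier G"
  have R: "finite R" "R \<subseteq> carrier G" "R \<noteq> {}" "\<And>t. t \<in> R \<Longrightarrow> rep t = t"
  proof -
    show "finite R" using rep T(1) by (auto simp: R_def intro: finite_subset)
    show "R \<subseteq> carrier G" using repc by (auto simp: R_def)
    show "R \<noteq> {}" by (auto simp: R_def)
    fix t assume "t \<in> R"
    then obtain g where "g \<in> carrier G" "t = rep g" by (auto simp: R_def)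
    then show "rep t = t" using rep_eq[of t g] rep[of g] repc by metis
  qed
  have perm: "bij_betw (\<lambda>t. rep (inv e \<otimes> t)) R R" if e: "e \<in> carrier G" for e
  proof -
    have "inj_on (\<lambda>t. rep (inv e \<otimes> t)) R"
    proof (rule inj_onI)
      fix s t assume st: "s \<in> R" "t \<in> R" "rep (inv e \<otimes> s) = rep (inv e \<otimes> t)"
      then have c: "s \<in> carrier G" "t \<in> carrier G" using R by auto
      have "inv (inv e \<otimes> s) \<otimes> (inv e \<otimes> t) \<in> K" using rep_inv st c e by simp
      moreover have "inv (inv e \<otimes> s) \<otimes> (inv e \<otimes> t) = inv s \<otimes> t"
      proof -
        have "e \<otimes> (inv e \<otimes> t) = t" using e c by (simp flip: m_assoc)
        then show ?thesis using e c by (simp add: inv_mult_group m_assoc)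
      qed
      ultimately show "s = t" using rep_eq[of s t] c R(4) st by metis
    qed
    moreover have "(\<lambda>t. rep (inv e \<otimes> t)) ` R \<subseteq> R" using e R(2) by (auto simp: R_def)
    ultimately show ?thesis unfolding bij_betw_def using endo_inj_surj[OF R(1)] by blast
  qed
  define b where "b = (\<lambda>e t. inv (inv (rep (inv e \<otimes> t)) \<otimes> (inv e \<otimes> t)))"
  have b: "b e t \<in> K" if "e \<in> carrier G" "t \<in> carrier G" for e t
    unfolding b_def using rep[of "inv e \<otimes> t"] that by (intro subgroup.m_inv_closed[OF sub]) auto
  define E2 where "E2 = (\<lambda>(e, t). b e t) ` (E \<times> R)"
  have E2: "finite E2" "E2 \<subseteq> K" and \<epsilon>: "0 < \<epsilon>"
    using E R(1,2) b unfolding E2_def by (auto simp: subset_iff)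
  obtain f' where f': "prob_weight f'" "\<forall>x\<in>E2. moved_by x f' \<epsilon>"
    using reiterE[OF K(2) E2 \<epsilon>] .
  let ?c = "1 / real (card R)"
  define f where "f = (\<lambda>g. \<Sum>t\<in>R. ?c * f' (inv t \<otimes> g))"
  have c: "0 \<le> ?c" "(\<Sum>t\<in>R. ?c) = 1" using R by auto
  have "prob_weight f" unfolding f_def
    using R f' c by (intro prob_weight_convex prob_weight_translate) auto
  moreover have "moved_by e f \<epsilon>" if e: "e \<in> E" for e
  proof (rule moved_by_convex[where I = R and c = "\<lambda>_. ?c" and b = "b e" and h = "\<lambda>t. inv (rep (inv e \<otimes> t))" and f' = f'])
    fix g assume g: "g \<in> carrier G"
    have ec: "e \<in> carrier G" using e E by blast
    have eq: "b e t \<otimes> (inv (rep (inv e \<otimes> t)) \<otimes> g) = inv t \<otimes> (e \<otimes> g)" if "t \<in> R" for t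
    proof -
      let ?r = "rep (inv e \<otimes> t)"
      have tc: "t \<in> carrier G" "?r \<in> carrier G" using that R repc ec by auto
      have "b e t = inv t \<otimes> e \<otimes> ?r" unfolding b_def using tc ec by (simp add: inv_mult_group m_assoc)
      moreover have "?r \<otimes> (inv ?r \<otimes> g) = g" using tc g by (simp flip: m_assoc)
      ultimately show ?thesis using tc ec g by (simp add: m_assoc)
    qed
    have "f g = (\<Sum>t\<in>R. ?c * f' (inv (rep (inv e \<otimes> t)) \<otimes> g))"
      unfolding f_def using sum.reindex_bij_betw[OF perm[OF ec], of "\<lambda>t. ?c * f' (inv t \<otimes> g)"] by simp
    then have "\<bar>f (e \<otimes> g) - f g\<bar> =
        \<bar>\<Sum>t\<in>R. ?c * (f' (inv t \<otimes> (e \<otimes> g)) - f' (inv (rep (inv e \<otimes> t)) \<otimes> g))\<bar>"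
      unfolding f_def by (simp add: sum_subtractf right_diff_distrib del: times_divide_eq_left)
    also have "\<dots> \<le> (\<Sum>t\<in>R. \<bar>?c * (f' (inv t \<otimes> (e \<otimes> g)) - f' (inv (rep (inv e \<otimes> t)) \<otimes> g))\<bar>)" by (rule sum_abs)
    also have "\<dots> = (\<Sum>t\<in>R. ?c * \<bar>f' (b e t \<otimes> (inv (rep (inv e \<otimes> t)) \<otimes> g)) - f' (inv (rep (inv e \<otimes> t)) \<otimes> g)\<bar>)"
      using eq c by (intro sum.cong) (auto simp: abs_mult)
    finally show "\<bar>f (e \<otimes> g) - f g\<bar> \<le> \<dots>" .
  next
    fix t assume t: "t \<in> R"
    then have "b e t \<in> E2" unfolding E2_def using e by force
    moreover have "e \<in> carrier G" "t \<in> carrier G" using e E t R(2) by auto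
    ultimately show "inv (rep (inv e \<otimes> t)) \<in> carrier G \<and> moved_by (b e t) f' \<epsilon>"
      using f'(2) repc by simp
  qed (use R(1) c in auto)
  ultimately show "\<exists>f. prob_weight f \<and> (\<forall>k\<in>E. moved_by k f \<epsilon>)" by blast
qed

text \<open>The almost invariant functions define finitely additive measures, points of a product of unit
  intervals. That a measure moves by at most \<open>1 / (n + 1)\<close> under \<open>e\<close> is
  a closed condition, and finitely many such conditions are met simultaneously; by Tychonoff's
  theorem, all of them are.\<close>

lemma reiter_imp_amenable:
  assumes "reiter (carrier G)" shows "amenable G"
proof -
  define box where "box = (PiE UNIV (\<lambda>_. {0..1}) :: ('a set \<Rightarrow> real) set)"
  define additive where "additive = {\<mu> :: 'a set \<Rightarrow> real. \<mu> (carrier G) = 1} \<inter>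
    (\<Inter>(A, B)\<in>{(A, B). A \<subseteq> carrier G \<and> B \<subseteq> carrier G \<and> A \<inter> B = {}}. {\<mu>. \<mu> (A \<union> B) = \<mu> A + \<mu> B})"
  define inva where "inva = (\<lambda>(e, n). \<Inter>A\<in>Pow (carrier G). {\<mu> :: 'a set \<Rightarrow> real. \<bar>\<mu> (e <# A) - \<mu> A\<bar> \<le> 1 / real (Suc n)})"
  let ?F = "insert additive (inva ` (carrier G \<times> UNIV))"
  have "compactin (product_topology (\<lambda>_. euclidean) UNIV) box"
    unfolding box_def compactin_PiE by (simp add: compactin_euclidean_iff)
  then have compact: "compact box" by (simp add: euclidean_product_topology compactin_euclidean_iff)
  have cont: "continuous_on UNIV (\<lambda>\<mu>. \<mu> A)" for A :: "'a set"
    by (rule continuous_on_product_coordinates)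
  have closed: "closed T" if "T \<in> ?F" for T
    using that unfolding additive_def inva_def
    by (auto intro!: closed_Int closed_INT closed_Collect_eq closed_Collect_le continuous_intros cont)
  have fip: "box \<inter> \<Inter>F' \<noteq> {}" if F': "finite F'" "F' \<subseteq> ?F" for F'
  proof -
    have "finite (F' - {additive})" "F' - {additive} \<subseteq> inva ` (carrier G \<times> UNIV)" using F' by auto
    then obtain P where P: "P \<subseteq> carrier G \<times> UNIV" "finite P" "F' - {additive} = inva ` P"
      by (meson finite_subset_image)
    define N where "N = Max (insert 0 (snd ` P))"
    have N: "n \<le> N" if "(e, n) \<in> P" for e n
      unfolding N_def using P(2) that by (intro Max_ge) force+
    have "finite (fst ` P)" "fst ` P \<subseteq> carrier G" "0 < 1 / real (Suc N)" using P by auto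
    then obtain f where f: "prob_weight f" "\<forall>k\<in>fst ` P. moved_by k f (1 / real (Suc N))"
      using reiterE[OF assms] by metis
    obtain H where H: "finite H" "H \<subseteq> carrier G" "\<And>g. g \<in> carrier G \<Longrightarrow> 0 \<le> f g"
      "\<And>g. g \<in> carrier G \<Longrightarrow> g \<notin> H \<Longrightarrow> f g = 0" "sum f H = 1"
      using f(1) unfolding prob_weight_def by blast
    define \<mu> where "\<mu> = (\<lambda>A. sum f (A \<inter> H))"
    have "0 \<le> \<mu> A \<and> \<mu> A \<le> 1" for A
      unfolding \<mu>_def H(5)[symmetric] using H(1,2,3)
      by (intro conjI sum_nonneg sum_mono2) auto
    then have \<mu>_box: "\<mu> \<in> box" unfolding box_def by (auto simp: PiE_def)
    have \<mu>_additive: "\<mu> \<in> additive"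
    proof -
      have "\<mu> (A \<union> B) = \<mu> A + \<mu> B" if "A \<inter> B = {}" for A B
        unfolding \<mu>_def Int_Un_distrib2 using H(1) that by (intro sum.union_disjoint) auto
      moreover have "\<mu> (carrier G) = 1" unfolding \<mu>_def using H(2,5) by (simp add: Int_absorb1)
      ultimately show ?thesis unfolding additive_def by auto
    qed
    have \<mu>_inva: "\<mu> \<in> inva (e, n)" if en: "(e, n) \<in> P" for e n
    proof -
      have e: "e \<in> carrier G" using en P(1) by auto
      have cancel: "e \<otimes> (inv e \<otimes> g) = g" if "g \<in> carrier G" for g
        using that e by (simp flip: m_assoc)
      have cancel': "inv e \<otimes> (e \<otimes> g) = g" if "g \<in> carrier G" for g
        using that e by (simp flip: m_assoc)
      have "\<bar>\<mu> (e <# A) - \<mu> A\<bar> \<le> 1 / real (Suc n)" if A: "A \<subseteq> carrier G" for A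
      proof -
        let ?Y = "(H \<union> (\<otimes>) (inv e) ` H) \<inter> A"
        have Y: "finite ?Y" "?Y \<subseteq> carrier G" using H A by auto
        have eA: "e <# A = (\<otimes>) e ` A" unfolding l_coset_def by auto
        have "\<mu> A = sum f ?Y"
          unfolding \<mu>_def
        proof (rule sum.mono_neutral_left)
          show "\<forall>g\<in>?Y - A \<inter> H. f g = 0" using H(4) A by blast
        qed (use Y in auto)
        moreover have "\<mu> (e <# A) = (\<Sum>g\<in>?Y. f (e \<otimes> g))"
        proof -
          have "g \<in> (\<otimes>) e ` ?Y" if g: "g \<in> (e <# A) \<inter> H" for g
          proof -
            obtain a where a: "a \<in> A" "g = e \<otimes> a" "g \<in> H" using g unfolding eA by auto
            then have "a = inv e \<otimes> g" using cancel'[of a] A by auto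
            then have "a \<in> ?Y" using a by blast
            then show ?thesis using a by blast
          qed
          then have "\<mu> (e <# A) = sum f ((\<otimes>) e ` ?Y)"
            unfolding \<mu>_def
          proof (intro sum.mono_neutral_left)
            have "(\<otimes>) e ` ?Y \<subseteq> e <# A" unfolding eA by blast
            then show "\<forall>g\<in>(\<otimes>) e ` ?Y - (e <# A) \<inter> H. f g = 0"
              using H(4) translate_closed[OF e Y(2)] by blast
          qed (use Y in auto)
          then show ?thesis using sum_translate[OF e Y(2), of f] by simp
        qed
        ultimately have "\<bar>\<mu> (e <# A) - \<mu> A\<bar> = \<bar>\<Sum>g\<in>?Y. f (e \<otimes> g) - f g\<bar>" by (simp add: sum_subtractf)
        also have "\<dots> \<le> (\<Sum>g\<in>?Y. \<bar>f (e \<otimes> g) - f g\<bar>)" by (rule sum_abs)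
        also have "\<dots> \<le> 1 / real (Suc N)"
        proof (rule moved_byD[OF _ Y])
          have "e \<in> fst ` P" using en image_iff by fastforce
          then show "moved_by e f (1 / real (Suc N))" using f(2) by blast
        qed
        also have "\<dots> \<le> 1 / real (Suc n)" using N[OF en] by (simp add: frac_le)
        finally show ?thesis .
      qed
      then show ?thesis unfolding inva_def by auto
    qed
    have "\<mu> \<in> T" if "T \<in> F'" for T
    proof (cases "T = additive")
      case False
      with that have "T \<in> inva ` P" unfolding P(3)[symmetric] by simp
      then obtain e n where "(e, n) \<in> P" "T = inva (e, n)" by auto
      then show ?thesis using \<mu>_inva by simp
    qed (use \<mu>_additive in simp)
    then show ?thesis using \<mu>_box by blast
  qed
  have "box \<inter> \<Inter>?F \<noteq> {}" using compact closed fip by (rule compact_imp_fip)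
  then obtain \<mu> where \<mu>: "\<mu> \<in> box" "\<mu> \<in> additive" "\<And>e n. e \<in> carrier G \<Longrightarrow> \<mu> \<in> inva (e, n)" by auto
  have "\<mu> (g <# A) = \<mu> A" if "g \<in> carrier G" "A \<subseteq> carrier G" for g A
  proof (rule ccontr)
    assume "\<mu> (g <# A) \<noteq> \<mu> A"
    then have "0 < \<bar>\<mu> (g <# A) - \<mu> A\<bar>" by simp
    then obtain n where "1 / real (Suc n) < \<bar>\<mu> (g <# A) - \<mu> A\<bar>" using nat_approx_posE by blast
    moreover have "\<bar>\<mu> (g <# A) - \<mu> A\<bar> \<le> 1 / real (Suc n)"
      using \<mu>(3)[OF that(1), of n] that(2) unfolding inva_def by auto
    ultimately show False by simp
  qed
  moreover have "\<mu> A \<ge> 0" for A using \<mu>(1) unfolding box_def by auto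
  moreover have "\<mu> (carrier G) = 1" "\<forall>A B. A \<subseteq> carrier G \<and> B \<subseteq> carrier G \<and> A \<inter> B = {} \<longrightarrow> \<mu> (A \<union> B) = \<mu> A + \<mu> B"
    using \<mu>(2) unfolding additive_def by auto
  ultimately show ?thesis unfolding amenable_def by (intro exI[of _ \<mu>]) auto
qed

text \<open>The bound \<open>D\<close> for the \<open>\<ell>\<^sup>2\<close> norm, expressed by finite
  partial sums.\<close>

definition l2_bound :: "('a \<Rightarrow> real) \<Rightarrow> real \<Rightarrow> bool" where
  "l2_bound f D \<longleftrightarrow> 0 \<le> D \<and> (\<forall>Y. finite Y \<and> Y \<subseteq> carrier G \<longrightarrow> (\<Sum>g\<in>Y. (f g)\<^sup>2) \<le> D\<^sup>2)"

lemma l2_boundD: "l2_bound f D \<Longrightarrow> finite Y \<Longrightarrow> Y \<subseteq> carrier G \<Longrightarrow> (\<Sum>g\<in>Y. (f g)\<^sup>2) \<le> D\<^sup>2"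
  by (simp add: l2_bound_def)

lemma l2_bound_point:
  assumes "l2_bound f D" "g \<in> carrier G" shows "f g \<le> D"
  using l2_boundD[OF assms(1), of "{g}"] assms by (auto simp: l2_bound_def intro: power2_le_imp_le)

lemma l2_bound_translate:
  assumes "l2_bound f D" "h \<in> carrier G" shows "l2_bound (\<lambda>g. f (h \<otimes> g)) D"
  unfolding l2_bound_def
proof (intro conjI allI impI)
  show "0 \<le> D" using assms(1) by (simp add: l2_bound_def)
  fix Y assume "finite Y \<and> Y \<subseteq> carrier G"
  then show "(\<Sum>g\<in>Y. (f (h \<otimes> g))\<^sup>2) \<le> D\<^sup>2"
    using sum_translate[OF assms(2), of Y "\<lambda>g. (f g)\<^sup>2"] l2_boundD[OF assms(1), of "(\<otimes>) h ` Y"]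
      translate_closed[OF assms(2), of Y] by simp
qed

text \<open>If \<open>f\<close> is a finitely supported function whose translates by \<open>E\<close> have a
  sum of norm close to \<open>card E\<close> times the norm of \<open>f\<close>, then these
  translates are close to each other (\<open>square_sum_gap\<close>), in particular to
  \<open>f\<close> itself if \<open>\<one> \<in> E\<close>. By the Cauchy-Schwarz inequality,
  \<open>f\<^sup>2\<close> is then almost invariant in the \<open>\<ell>\<^sup>1\<close> sense. So
  the absence of almost invariant functions gives a uniform gap.\<close>

lemma not_reiter_contraction:
  assumes K: "subgroup K G" and not: "\<not> reiter K"
  obtains E and \<rho> :: real where "finite E" "E \<subseteq> K" "E \<noteq> {}" "0 \<le> \<rho>" "\<rho> < 1"
    "\<And>f D. l2_bound f D \<Longrightarrow> l2_bound (\<lambda>h. \<Sum>k\<in>E. f (k \<otimes> h)) (\<rho> * card E * D)"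
proof -
  obtain E0 \<epsilon>0 where "finite E0 \<and> E0 \<subseteq> K \<and> 0 < \<epsilon>0"
    and no_f: "\<not> (\<exists>f. prob_weight f \<and> (\<forall>k\<in>E0. moved_by k f \<epsilon>0))"
    using not unfolding reiter_def not_all not_imp by (elim exE conjE) (rule that, simp_all)
  then have E0: "finite E0" "E0 \<subseteq> K" "0 < \<epsilon>0" by simp_all
  have none: "\<exists>k\<in>E0. \<not> moved_by k f \<epsilon>0" if "prob_weight f" for f
    using no_f that by blast
  define \<delta> where "\<delta> = min \<epsilon>0 1 / 2"
  have \<delta>: "0 < \<delta>" "\<delta> \<le> 1 / 2" "2 * \<delta> \<le> \<epsilon>0" using E0 by (auto simp: \<delta>_def)
  define E where "E = insert \<one> E0"
  have E: "finite E" "E \<subseteq> K" "\<one> \<in> E" "E0 \<subseteq> E" "E \<subseteq> carrier G"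
    using E0 subgroup.one_closed[OF K] subgroup.subset[OF K] by (auto simp: E_def)
  let ?N = "real (card E)"
  have N: "1 \<le> ?N" proof -
    have "0 < card E" using E(1,3) card_gt_0_iff by blast
    then show ?thesis by simp
  qed
  \<comment> \<open>chosen such that a sum of norm above \<open>\<rho> * ?N\<close> times that of
    \<open>f\<close> leaves \<open>\<delta>\<^sup>2\<close> times the square norm of
    \<open>f\<close> for the differences\<close>
  define \<rho> where "\<rho> = sqrt (1 - \<delta>\<^sup>2 / ?N\<^sup>2)"
  have "\<delta>\<^sup>2 \<le> 1 * ?N\<^sup>2" using \<delta> N by (intro order_trans[OF power_le_one[of \<delta> 2]]) auto
  then have le: "0 \<le> 1 - \<delta>\<^sup>2 / ?N\<^sup>2" using N by (simp add: divide_le_eq)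
  have "0 < \<delta>\<^sup>2 / ?N\<^sup>2" using \<delta> N by (intro divide_pos_pos) auto
  then have \<rho>: "0 \<le> \<rho>" "\<rho> < 1" unfolding \<rho>_def using le by (auto simp: real_sqrt_lt_1_iff)
  have \<rho>2: "?N\<^sup>2 - \<rho>\<^sup>2 * ?N\<^sup>2 = \<delta>\<^sup>2"
    unfolding \<rho>_def using le N by (simp add: left_diff_distrib)
  have main: "(\<Sum>h\<in>Y. (\<Sum>k\<in>E. f (k \<otimes> h))\<^sup>2) \<le> (\<rho> * ?N * D)\<^sup>2"
    if f: "l2_bound f D" and Y: "finite Y" "Y \<subseteq> carrier G" for f D Y
  proof (rule ccontr)
    assume gt: "\<not> ?thesis"
    define Z where "Z = (\<Union>k\<in>E. (\<otimes>) k ` Y)"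
    have Z: "finite Z" "Z \<subseteq> carrier G"
      unfolding Z_def using E Y by auto
    define g where "g = (\<lambda>h. if h \<in> Z then f h else 0)"
    define F where "F = (\<Sum>h\<in>Z. (g h)\<^sup>2)"
    have FD: "F \<le> D\<^sup>2" unfolding F_def g_def using l2_boundD[OF f Z] by simp
    have gF: "(\<Sum>h\<in>W. (g h)\<^sup>2) \<le> F" if "finite W" for W
    proof -
      have "(\<Sum>h\<in>W. (g h)\<^sup>2) = (\<Sum>h\<in>W \<inter> Z. (g h)\<^sup>2)"
        using that by (intro sum.mono_neutral_right) (auto simp: g_def)
      also have "\<dots> \<le> F" unfolding F_def using Z by (intro sum_mono2) auto
      finally show ?thesis .
    qed
    have fg: "f (k \<otimes> h) = g (k \<otimes> h)" if "k \<in> E" "h \<in> Y" for k h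
      using that by (auto simp: g_def Z_def)
    have "(\<rho> * ?N)\<^sup>2 * F \<le> (\<rho> * ?N * D)\<^sup>2"
      unfolding power_mult_distrib using FD by (intro mult_left_mono) auto
    then have big: "(\<rho> * ?N)\<^sup>2 * F < (\<Sum>h\<in>Y. (\<Sum>k\<in>E. g (k \<otimes> h))\<^sup>2)"
      using gt fg by simp
    have gtrans: "(\<Sum>h\<in>W. (g (k \<otimes> h))\<^sup>2) \<le> F" if "k \<in> E" "finite W" "W \<subseteq> carrier G" for k W
      using sum_translate[of k W "\<lambda>h. (g h)\<^sup>2"] gF[of "(\<otimes>) k ` W"] that E(5) by auto
    have "F \<noteq> 0"
    proof
      assume "F = 0"
      then have "g h = 0" for h using Z(1) by (auto simp: F_def g_def sum_nonneg_eq_0_iff)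
      then show False using big \<open>F = 0\<close> by simp
    qed
    moreover have "0 \<le> F" unfolding F_def by (intro sum_nonneg) auto
    ultimately have F: "0 < F" by simp
    define p where "p = (\<lambda>h. (g h)\<^sup>2 / F)"
    have "prob_weight p"
      unfolding prob_weight_def using Z F
      by (intro exI[of _ Z]) (auto simp: p_def g_def F_def simp flip: sum_divide_distrib)
    then obtain k where k: "k \<in> E0" "\<not> moved_by k p \<epsilon>0" using none by blast
    then obtain Y' where Y': "finite Y'" "Y' \<subseteq> carrier G" "\<epsilon>0 < (\<Sum>h\<in>Y'. \<bar>p (k \<otimes> h) - p h\<bar>)"
      unfolding moved_by_def by fastforce
    have kE: "k \<in> E" "k \<in> carrier G" using k E by auto
    define W where "W = Y \<union> Y'"
    have W: "finite W" "W \<subseteq> carrier G" using Y Y' by (auto simp: W_def)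
    let ?d = "\<lambda>h. g (k \<otimes> h) - g h" and ?s = "\<lambda>h. g (k \<otimes> h) + g h"
    have "(\<Sum>h\<in>W. (?d h)\<^sup>2) + (\<Sum>h\<in>W. (\<Sum>k\<in>E. g (k \<otimes> h))\<^sup>2)
        \<le> (\<Sum>h\<in>W. ?N * (\<Sum>k\<in>E. (g (k \<otimes> h))\<^sup>2))"
      unfolding sum.distrib[symmetric]
    proof (rule sum_mono)
      fix h assume "h \<in> W"
      then have "\<one> \<otimes> h = h" using W by auto
      then show "(?d h)\<^sup>2 + (\<Sum>k\<in>E. g (k \<otimes> h))\<^sup>2 \<le> ?N * (\<Sum>k\<in>E. (g (k \<otimes> h))\<^sup>2)"
        using square_sum_gap[OF E(1) kE(1) E(3), of "\<lambda>k. g (k \<otimes> h)"] by simp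
    qed
    also have "\<dots> = ?N * (\<Sum>k\<in>E. \<Sum>h\<in>W. (g (k \<otimes> h))\<^sup>2)"
      by (subst sum.swap) (simp add: sum_distrib_left)
    also have "\<dots> \<le> ?N * (\<Sum>k\<in>E. F)"
      using gtrans W by (intro mult_left_mono sum_mono) auto
    also have "\<dots> = ?N\<^sup>2 * F" by (simp add: power2_eq_square)
    finally have up: "(\<Sum>h\<in>W. (?d h)\<^sup>2) + (\<Sum>h\<in>W. (\<Sum>k\<in>E. g (k \<otimes> h))\<^sup>2) \<le> ?N\<^sup>2 * F" .
    have "(\<Sum>h\<in>Y. (\<Sum>k\<in>E. g (k \<otimes> h))\<^sup>2) \<le> (\<Sum>h\<in>W. (\<Sum>k\<in>E. g (k \<otimes> h))\<^sup>2)"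
      using W by (intro sum_mono2) (auto simp: W_def)
    then have "(\<Sum>h\<in>W. (?d h)\<^sup>2) \<le> ?N\<^sup>2 * F - (\<rho> * ?N)\<^sup>2 * F" using up big by linarith
    also have "\<dots> = \<delta>\<^sup>2 * F" unfolding \<rho>2[symmetric] by (simp add: power_mult_distrib left_diff_distrib)
    finally have d: "(\<Sum>h\<in>W. (?d h)\<^sup>2) \<le> \<delta>\<^sup>2 * F" .
    have "(\<Sum>h\<in>W. (?s h)\<^sup>2) \<le> (\<Sum>h\<in>W. 2 * (g (k \<otimes> h))\<^sup>2 + 2 * (g h)\<^sup>2)"
    proof (rule sum_mono)
      fix h
      have "0 \<le> (?d h)\<^sup>2" by simp
      then show "(?s h)\<^sup>2 \<le> 2 * (g (k \<otimes> h))\<^sup>2 + 2 * (g h)\<^sup>2"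
        unfolding power2_diff power2_sum by linarith
    qed
    also have "\<dots> \<le> 2 * F + 2 * F"
      unfolding sum.distrib sum_distrib_left[symmetric] using gtrans[OF kE(1) W] gF[OF W(1)] by simp
    finally have s: "(\<Sum>h\<in>W. (?s h)\<^sup>2) \<le> 4 * F" by simp
    have "(\<Sum>h\<in>W. \<bar>?d h\<bar> * \<bar>?s h\<bar>)\<^sup>2 \<le> (\<Sum>h\<in>W. \<bar>?d h\<bar>\<^sup>2) * (\<Sum>h\<in>W. \<bar>?s h\<bar>\<^sup>2)"
      by (rule Cauchy_Schwarz_ineq_sum)
    also have "\<dots> \<le> (\<delta>\<^sup>2 * F) * (4 * F)"
      unfolding power2_abs using d s F \<delta> by (intro mult_mono) (auto intro: sum_nonneg)
    also have "\<dots> = (2 * \<delta> * F)\<^sup>2" by (simp add: power2_eq_square)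
    finally have ds: "(\<Sum>h\<in>W. \<bar>?d h\<bar> * \<bar>?s h\<bar>) \<le> 2 * \<delta> * F"
      by (rule power2_le_imp_le) (use F \<delta> in auto)
    have "(\<Sum>h\<in>Y'. \<bar>p (k \<otimes> h) - p h\<bar>) \<le> (\<Sum>h\<in>W. \<bar>p (k \<otimes> h) - p h\<bar>)"
      using W by (intro sum_mono2) (auto simp: W_def)
    also have "\<dots> = (\<Sum>h\<in>W. \<bar>?d h\<bar> * \<bar>?s h\<bar>) / F"
      unfolding sum_divide_distrib
    proof (rule sum.cong)
      fix h
      have "p (k \<otimes> h) - p h = (?d h * ?s h) / F"
        unfolding p_def by (simp add: power2_eq_square algebra_simps diff_divide_distrib add_divide_distrib)
      then show "\<bar>p (k \<otimes> h) - p h\<bar> = \<bar>?d h\<bar> * \<bar>?s h\<bar> / F" using F by (simp add: abs_mult)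
    qed simp
    also have "\<dots> \<le> 2 * \<delta>" using ds F by (simp add: divide_le_eq)
    also have "\<dots> \<le> \<epsilon>0" by (rule \<delta>)
    finally show False using Y'(3) by simp
  qed
  have "l2_bound (\<lambda>h. \<Sum>k\<in>E. f (k \<otimes> h)) (\<rho> * card E * D)" if "l2_bound f D" for f D
    using main[OF that] \<rho> that unfolding l2_bound_def by simp
  then show thesis using that[of E \<rho>] E \<rho> by blast
qed

end

section \<open>Counting reduced words with exchangeable blocks\<close>

definition continuations :: "'a set \<Rightarrow> 'a \<times> bool \<Rightarrow> nat \<Rightarrow> 'a word set" where
  "continuations X a n = {c. set c \<subseteq> X \<times> UNIV \<and> reduced (a # c) \<and> length c = n}"

abbreviation can_follow :: "'a \<times> bool \<Rightarrow> 'a \<times> bool \<Rightarrow> bool" where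
  "can_follow a e \<equiv> \<not> (fst a = fst e \<and> snd a \<noteq> snd e)"

lemma reduced_Cons: "reduced (a # w) \<longleftrightarrow> w = [] \<or> can_follow a (hd w) \<and> reduced w"
  unfolding reduced_def by (rule successively_Cons)

lemma reduced_append_iff: "reduced (a # u @ v) \<longleftrightarrow> reduced (a # u) \<and> reduced (last (a # u) # v)"
  using successively_append_iff[of can_follow "a # u" v] successively_Cons[of can_follow "last (a # u)" v]
  unfolding reduced_def by (auto simp: successively_Cons)

lemma finite_continuations: "finite X \<Longrightarrow> finite (continuations X a n)"
  by (rule finite_subset[OF _ finite_lists_length_eq[of "X \<times> UNIV" n]]) (auto simp: continuations_def)

lemma sum_continuations_append:
  fixes f :: "'a word \<Rightarrow> 'b::comm_monoid_add"
  assumes "finite X"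
  shows "(\<Sum>c\<in>continuations X a (j + n). f c) =
    (\<Sum>b\<in>continuations X a j. \<Sum>c\<in>continuations X (last (a # b)) n. f (b @ c))"
proof -
  let ?S = "Sigma (continuations X a j) (\<lambda>b. continuations X (last (a # b)) n)"
  have "bij_betw (\<lambda>(b, c). b @ c) ?S (continuations X a (j + n))"
  proof (rule bij_betw_imageI)
    show "inj_on (\<lambda>(b, c). b @ c) ?S" by (auto simp: inj_on_def continuations_def)
    have "c \<in> (\<lambda>(b, c). b @ c) ` ?S" if "c \<in> continuations X a (j + n)" for c
    proof -
      have c: "c = take j c @ drop j c" "length c = j + n" "reduced (a # take j c @ drop j c)"
        "set c \<subseteq> X \<times> UNIV"
        using that by (auto simp: continuations_def)
      have "set (take j c) \<subseteq> X \<times> UNIV" "set (drop j c) \<subseteq> X \<times> UNIV"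
        using c(4) set_take_subset[of j c] set_drop_subset[of j c] by (meson order_trans)+
      moreover have "reduced (a # take j c)" "reduced (last (a # take j c) # drop j c)"
        using c(3) unfolding reduced_append_iff by blast+
      ultimately have "(take j c, drop j c) \<in> ?S"
        using c(2) by (simp add: continuations_def del: last.simps)
      then show ?thesis using c(1) by (metis (mono_tags, lifting) case_prod_conv image_eqI)
    qed
    moreover have "b @ c \<in> continuations X a (j + n)" if "(b, c) \<in> ?S" for b c
      using that reduced_append_iff[of a b c] by (auto simp: continuations_def)
    ultimately show "(\<lambda>(b, c). b @ c) ` ?S = continuations X a (j + n)" by fast
  qed
  from sum.reindex_bij_betw[OF this, of f]
  have "(\<Sum>c\<in>continuations X a (j + n). f c) = (\<Sum>(b, c)\<in>?S. f (b @ c))"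
    by (simp add: case_prod_beta')
  then show ?thesis by (simp add: sum.Sigma finite_continuations[OF assms])
qed

lemma continuations_0: "continuations X a 0 = {[]}"
  by (auto simp: continuations_def reduced_def)

lemma card_continuations:
  assumes "finite X" "a \<in> X \<times> UNIV"
  shows "card (continuations X a n) = (2 * card X - 1) ^ n"
  using assms(2)
proof (induction n arbitrary: a)
  case 0
  show ?case by (simp add: continuations_0)
next
  case (Suc n)
  have one: "continuations X b 1 = (\<lambda>e. [e]) ` (X \<times> UNIV - {(fst b, \<not> snd b)})" for b
    by (fastforce simp: continuations_def reduced_def length_Suc_conv)
  have card_one: "card (continuations X a 1) = 2 * card X - 1"
    unfolding one using Suc.prems assms(1)
    by (subst card_image) (auto simp: inj_on_def card_cartesian_product mem_Times_iff)
  have "card (continuations X a (1 + n)) =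
      (\<Sum>b\<in>continuations X a 1. card (continuations X (last (a # b)) n))"
    using sum_continuations_append[OF assms(1), of "\<lambda>_. 1::nat" a 1 n] by simp
  also have "\<dots> = (\<Sum>b\<in>continuations X a 1. (2 * card X - 1) ^ n)"
  proof (rule sum.cong)
    fix b assume "b \<in> continuations X a 1"
    then have "last (a # b) \<in> X \<times> UNIV" unfolding one by auto
    then show "card (continuations X (last (a # b)) n) = (2 * card X - 1) ^ n" by (rule Suc.IH)
  qed simp
  finally show ?case using card_one by simp
qed

lemma sum_sphere_Suc:
  fixes f :: "'a word \<Rightarrow> 'b::comm_monoid_add"
  assumes "finite X"
  shows "(\<Sum>w\<in>sphere_words X (Suc n). f w) = (\<Sum>a\<in>X \<times> UNIV. \<Sum>c\<in>continuations X a n. f (a # c))"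
proof -
  let ?S = "Sigma (X \<times> UNIV) (\<lambda>a. continuations X a n)"
  have "bij_betw (\<lambda>(a, c). a # c) ?S (sphere_words X (Suc n))"
  proof (rule bij_betw_imageI)
    show "inj_on (\<lambda>(a, c). a # c) ?S" by (auto simp: inj_on_def)
    have "w \<in> (\<lambda>(a, c). a # c) ` ?S" if w: "w \<in> sphere_words X (Suc n)" for w
    proof -
      obtain a c where "w = a # c" "a \<in> X \<times> UNIV" "c \<in> continuations X a n"
        using w by (cases w) (auto simp: sphere_words_def free_words_def continuations_def)
      then show ?thesis by (metis (mono_tags, lifting) SigmaI case_prod_conv image_eqI)
    qed
    moreover have "(\<lambda>(a, c). a # c) ` ?S \<subseteq> sphere_words X (Suc n)"
      by (auto simp: sphere_words_def free_words_def continuations_def)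
    ultimately show "(\<lambda>(a, c). a # c) ` ?S = sphere_words X (Suc n)" by blast
  qed
  from sum.reindex_bij_betw[OF this, of f]
  have "(\<Sum>w\<in>sphere_words X (Suc n). f w) = (\<Sum>(a, c)\<in>?S. f (a # c))"
    by (simp add: case_prod_beta')
  then show ?thesis using assms by (simp add: sum.Sigma finite_continuations)
qed

lemma card_sphere_Suc:
  assumes "finite X"
  shows "card (sphere_words X (Suc n)) = 2 * card X * (2 * card X - 1) ^ n"
  using sum_sphere_Suc[OF assms, of "\<lambda>_. 1::nat" n] assms
  by (simp add: card_continuations card_cartesian_product)

lemma finite_sphere: "finite X \<Longrightarrow> finite (sphere_words X n)"
  by (rule finite_subset[OF _ finite_lists_length_eq[of "X \<times> UNIV" n]])
    (auto simp: sphere_words_def free_words_def)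

text \<open>Replacing one element of \<open>B\<close> by another one inside a reduced word yields a reduced
  word of the same length, because all elements of \<open>B\<close> have the same length and the
  same first and last letter.\<close>

locale swap_family =
  fixes X :: "'a set" and B :: "'a word set" and l :: nat and y :: "'a \<times> bool"
  assumes finite_X: "finite X" and two_letters: "2 \<le> card X"
    and finite_B: "finite B" and B_nonempty: "B \<noteq> {}"
    and B_word: "\<And>x. x \<in> B \<Longrightarrow> set x \<subseteq> X \<times> UNIV \<and> reduced x \<and> length x = l \<and> x \<noteq> [] \<and> hd x = y \<and> last x = y"
begin

abbreviation q :: real where "q \<equiv> real (2 * card X - 1)"

text \<open>A letter that can be inserted between \<open>a\<close> and a word of \<open>B\<close>. The
  inserted letter guarantees that a word of \<open>B\<close> can occur soon after every letter
  \<open>a\<close>, even if \<open>a\<close> is the inverse of \<open>y\<close>.\<close>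

definition openers :: "'a \<times> bool \<Rightarrow> ('a \<times> bool) set" where
  "openers a = {e \<in> X \<times> UNIV. can_follow a e \<and> can_follow e y}"

definition swap_blocks :: "'a \<times> bool \<Rightarrow> 'a word set" where
  "swap_blocks a = (\<lambda>(e, x). e # x) ` (openers a \<times> B)"

lemma y_letter: "y \<in> X \<times> UNIV"
  using B_nonempty B_word by (metis ex_in_conv hd_in_set subsetD)

lemma finite_openers: "finite (openers a)"
  using finite_X by (simp add: openers_def)

lemma openers_nonempty: "openers a \<noteq> {}"
proof -
  obtain z where z: "z \<in> X" "z \<noteq> fst y"
    using two_letters finite_X by (metis One_nat_def card_le_Suc0_iff_eq not_less_eq_eq numeral_2_eq_2)
  show ?thesis
  proof (cases "can_follow a y")
    case True
    then have "y \<in> openers a" using y_letter by (simp add: openers_def)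
    then show ?thesis by blast
  next
    case False
    then have "(z, True) \<in> openers a" using z by (simp add: openers_def)
    then show ?thesis by blast
  qed
qed

lemma swap_blocks_subset: "swap_blocks a \<subseteq> continuations X a (Suc l)"
proof
  fix b assume "b \<in> swap_blocks a"
  then obtain e x where b: "b = e # x" "e \<in> openers a" "x \<in> B" by (auto simp: swap_blocks_def)
  then show "b \<in> continuations X a (Suc l)"
    using B_word[OF b(3)] by (simp add: openers_def continuations_def reduced_Cons)
qed

lemma card_swap_blocks: "card (swap_blocks a) = card (openers a) * card B"
  unfolding swap_blocks_def
  by (subst card_image) (auto simp: inj_on_def card_cartesian_product)

lemma card_B_le: "card B \<le> (2 * card X - 1) ^ Suc l"
proof -
  have "card B \<le> card (openers y) * card B"
    using openers_nonempty[of y] finite_openers[of y] by (cases "card (openers y)") auto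
  also have "\<dots> \<le> card (continuations X y (Suc l))"
    unfolding card_swap_blocks[symmetric, of y]
    by (rule card_mono[OF finite_continuations[OF finite_X] swap_blocks_subset])
  finally show ?thesis using card_continuations[OF finite_X y_letter] by simp
qed

lemma sum_continuations_swap:
  fixes f :: "'a word \<Rightarrow> real"
  shows "(\<Sum>c\<in>continuations X a (Suc l + n). f c) =
    (\<Sum>b\<in>continuations X a (Suc l) - swap_blocks a. \<Sum>c\<in>continuations X (last (a # b)) n. f (b @ c)) +
    (\<Sum>e\<in>openers a. \<Sum>c\<in>continuations X y n. \<Sum>x\<in>B. f (e # x @ c))"
proof -
  let ?g = "\<lambda>b. \<Sum>c\<in>continuations X (last (a # b)) n. f (b @ c)"
  have "(\<Sum>b\<in>swap_blocks a. ?g b) = (\<Sum>(e, x)\<in>openers a \<times> B. ?g (e # x))"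
    unfolding swap_blocks_def
    by (subst sum.reindex) (auto simp: inj_on_def case_prod_beta' intro!: sum.cong)
  also have "\<dots> = (\<Sum>e\<in>openers a. \<Sum>x\<in>B. ?g (e # x))"
    by (simp add: sum.cartesian_product)
  also have "\<dots> = (\<Sum>e\<in>openers a. \<Sum>x\<in>B. \<Sum>c\<in>continuations X y n. f (e # x @ c))"
    using B_word by (intro sum.cong) auto
  also have "\<dots> = (\<Sum>e\<in>openers a. \<Sum>c\<in>continuations X y n. \<Sum>x\<in>B. f (e # x @ c))"
    by (intro sum.cong sum.swap refl)
  finally have "(\<Sum>b\<in>swap_blocks a. ?g b) = \<dots>" .
  moreover have "(\<Sum>c\<in>continuations X a (Suc l + n). f c) = (\<Sum>b\<in>continuations X a (Suc l). ?g b)"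
    by (rule sum_continuations_append[OF finite_X])
  moreover have "\<dots> = (\<Sum>b\<in>continuations X a (Suc l) - swap_blocks a. ?g b) + (\<Sum>b\<in>swap_blocks a. ?g b)"
    by (rule sum.subset_diff[OF swap_blocks_subset finite_continuations[OF finite_X]])
  ultimately show ?thesis by simp
qed

text \<open>The induction peels off blocks of length \<open>l + 1\<close>. A block that is not of the form
  \<open>e # x\<close> with \<open>x \<in> B\<close> keeps the constant \<open>D\<close>, whereas
  the \<open>card B\<close> blocks with a common \<open>e\<close> together contribute the constant
  \<open>\<rho> * card B * D\<close> instead of \<open>card B * D\<close>. As there is at least
  one \<open>e\<close>, each block reduces the number \<open>q ^ (l + 1)\<close> of continuations
  by at least \<open>(1 - \<rho>) * card B\<close>. The predicate \<open>P D f\<close> stands for the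
  admissible functions with constant \<open>D\<close>.\<close>

lemma sum_continuations_bound:
  fixes P :: "real \<Rightarrow> ('a word \<Rightarrow> real) \<Rightarrow> bool"
    and \<rho> :: real
  assumes \<rho>: "0 \<le> \<rho>" "\<rho> \<le> 1"
    and P_bound: "\<And>D f c. P D f \<Longrightarrow> set c \<subseteq> X \<times> UNIV \<Longrightarrow> 0 \<le> D \<and> f c \<le> D"
    and P_append: "\<And>D f b. P D f \<Longrightarrow> set b \<subseteq> X \<times> UNIV \<Longrightarrow> P D (\<lambda>c. f (b @ c))"
    and P_swap: "\<And>D f e. P D f \<Longrightarrow> e \<in> X \<times> UNIV \<Longrightarrow> P (\<rho> * card B * D) (\<lambda>c. \<Sum>x\<in>B. f (e # x @ c))"
    and "P D f" "a \<in> X \<times> UNIV"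
  shows "(\<Sum>c\<in>continuations X a (Suc l * m + r). f c) \<le> D * (q ^ Suc l - (1 - \<rho>) * card B) ^ m * q ^ r"
  using assms(6,7)
proof (induction m arbitrary: a D f)
  case 0
  have "(\<Sum>c\<in>continuations X a r. f c) \<le> (\<Sum>c\<in>continuations X a r. D)"
    using P_bound[OF 0(1)] by (intro sum_mono) (auto simp: continuations_def)
  also have "\<dots> = D * q ^ r" using card_continuations[OF finite_X 0(2)] by simp
  finally show ?case by simp
next
  case (Suc m)
  define L where "L = q ^ Suc l - (1 - \<rho>) * card B"
  let ?n = "Suc l * m + r" and ?N = "real (card B)" and ?E = "real (card (openers a))"
  let ?lit = "continuations X a (Suc l) - swap_blocks a"
  have D: "0 \<le> D" using P_bound[OF Suc.prems(1), of "[]"] by simp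
  have "?N \<le> q ^ Suc l"
    using card_B_le by (metis of_nat_le_iff of_nat_power)
  moreover have "(1 - \<rho>) * ?N \<le> ?N" using \<rho> by (simp add: mult_left_le_one_le)
  ultimately have L: "0 \<le> L" unfolding L_def by linarith
  have "(\<Sum>b\<in>?lit. \<Sum>c\<in>continuations X (last (a # b)) ?n. f (b @ c)) \<le> (\<Sum>b\<in>?lit. D * L ^ m * q ^ r)"
  proof (rule sum_mono)
    fix b assume "b \<in> ?lit"
    then have b: "set b \<subseteq> X \<times> UNIV" "length b = Suc l" by (auto simp: continuations_def)
    then have "b \<noteq> []" by auto
    then have "last (a # b) \<in> X \<times> UNIV" using last_in_set[of b] b(1) by auto
    from Suc.IH[OF P_append[OF Suc.prems(1) b(1)] this]
    show "(\<Sum>c\<in>continuations X (last (a # b)) ?n. f (b @ c)) \<le> D * L ^ m * q ^ r"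
      unfolding L_def .
  qed
  also have "\<dots> = real (card ?lit) * (D * L ^ m * q ^ r)" by simp
  also have "real (card ?lit) = q ^ Suc l - ?E * ?N"
  proof -
    have fin: "finite (swap_blocks a)" using finite_subset[OF swap_blocks_subset finite_continuations[OF finite_X]] .
    have "card (swap_blocks a) \<le> card (continuations X a (Suc l))"
      by (rule card_mono[OF finite_continuations[OF finite_X] swap_blocks_subset])
    then show ?thesis
      using card_Diff_subset[OF fin swap_blocks_subset] card_continuations[OF finite_X Suc.prems(2), of "Suc l"]
        card_swap_blocks[of a]
      by (simp add: of_nat_diff)
  qed
  finally have lit: "(\<Sum>b\<in>?lit. \<Sum>c\<in>continuations X (last (a # b)) ?n. f (b @ c))
      \<le> (q ^ Suc l - ?E * ?N) * (D * L ^ m * q ^ r)" .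
  have "(\<Sum>e\<in>openers a. \<Sum>c\<in>continuations X y ?n. \<Sum>x\<in>B. f (e # x @ c))
      \<le> (\<Sum>e\<in>openers a. (\<rho> * ?N * D) * L ^ m * q ^ r)"
  proof (rule sum_mono)
    fix e assume "e \<in> openers a"
    then have "e \<in> X \<times> UNIV" by (simp add: openers_def)
    from Suc.IH[OF P_swap[OF Suc.prems(1) this] y_letter]
    show "(\<Sum>c\<in>continuations X y ?n. \<Sum>x\<in>B. f (e # x @ c)) \<le> (\<rho> * ?N * D) * L ^ m * q ^ r"
      unfolding L_def .
  qed
  also have "\<dots> = ?E * \<rho> * ?N * (D * L ^ m * q ^ r)" by simp
  finally have swap: "(\<Sum>e\<in>openers a. \<Sum>c\<in>continuations X y ?n. \<Sum>x\<in>B. f (e # x @ c))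
      \<le> ?E * \<rho> * ?N * (D * L ^ m * q ^ r)" .
  have "1 \<le> ?E" using openers_nonempty[of a] finite_openers[of a]
    by (simp add: Suc_leI card_gt_0_iff)
  then have "1 * ((1 - \<rho>) * ?N) \<le> ?E * ((1 - \<rho>) * ?N)"
    using \<rho> by (intro mult_right_mono) auto
  then have le: "q ^ Suc l - ?E * ?N + ?E * \<rho> * ?N \<le> L"
    unfolding L_def by (simp add: algebra_simps)
  have "(\<Sum>c\<in>continuations X a (Suc l + ?n). f c)
      \<le> (q ^ Suc l - ?E * ?N) * (D * L ^ m * q ^ r) + ?E * \<rho> * ?N * (D * L ^ m * q ^ r)"
    unfolding sum_continuations_swap using lit swap by linarith
  also have "\<dots> = (q ^ Suc l - ?E * ?N + ?E * \<rho> * ?N) * (D * L ^ m * q ^ r)"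
    by (simp add: algebra_simps)
  also have "\<dots> \<le> L * (D * L ^ m * q ^ r)"
    using le D L by (intro mult_right_mono) auto
  finally show ?case unfolding L_def[symmetric] by (simp add: algebra_simps)
qed

text \<open>The constant \<open>\<kappa>\<close> is the part of the density that does not decay with the
  number of blocks.\<close>

lemma density_bound:
  fixes P :: "real \<Rightarrow> ('a word \<Rightarrow> real) \<Rightarrow> bool"
    and \<rho> :: real
  assumes \<rho>: "0 \<le> \<rho>" "\<rho> < 1"
    and P_bound: "\<And>D f c. P D f \<Longrightarrow> set c \<subseteq> X \<times> UNIV \<Longrightarrow> 0 \<le> D \<and> f c \<le> D"
    and P_append: "\<And>D f b. P D f \<Longrightarrow> set b \<subseteq> X \<times> UNIV \<Longrightarrow> P D (\<lambda>c. f (b @ c))"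
    and P_swap: "\<And>D f e. P D f \<Longrightarrow> e \<in> X \<times> UNIV \<Longrightarrow> P (\<rho> * card B * D) (\<lambda>c. \<Sum>x\<in>B. f (e # x @ c))"
    and f: "P D f" "\<And>w. w \<in> free_words X \<Longrightarrow> of_bool (w \<in> S) \<le> \<kappa> + f w"
  obtains \<theta> where "0 \<le> \<theta>" "\<theta> < 1" "\<And>n. density X S (Suc n) \<le> \<kappa> + D * \<theta> ^ (n div Suc l)"
proof
  define \<theta> where "\<theta> = (q ^ Suc l - (1 - \<rho>) * card B) / q ^ Suc l"
  have q: "q > 0" using two_letters by simp
  have "real (card B) \<le> q ^ Suc l"
    using card_B_le by (metis of_nat_le_iff of_nat_power)
  moreover have "(1 - \<rho>) * real (card B) \<le> real (card B)" using \<rho> by (simp add: mult_left_le_one_le)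
  ultimately show "0 \<le> \<theta>" unfolding \<theta>_def using q by (intro divide_nonneg_pos zero_less_power) auto
  have "(1 - \<rho>) * card B > 0" using \<rho> finite_B B_nonempty by (simp add: card_gt_0_iff)
  then show "\<theta> < 1" unfolding \<theta>_def using q by (simp add: divide_less_eq)
  fix n
  define m r where "m = n div Suc l" and "r = n mod Suc l"
  have n: "n = Suc l * m + r" unfolding m_def r_def by (simp only: mult_div_mod_eq)
  let ?Z = "sphere_words X (Suc n)"
  have Z: "real (card ?Z) = real (2 * card X) * q ^ n"
    by (simp only: card_sphere_Suc[OF finite_X] of_nat_mult of_nat_power)
  have Zpos: "real (card ?Z) > 0" unfolding Z using q two_letters by simp
  have "real (card (S \<inter> ?Z)) = (\<Sum>w\<in>?Z. of_bool (w \<in> S))"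
    using finite_sphere[OF finite_X] by (simp add: of_bool_def sum.If_cases Int_commute)
  also have "\<dots> \<le> (\<Sum>w\<in>?Z. \<kappa> + f w)" using f(2) by (intro sum_mono) (auto simp: sphere_words_def)
  also have "\<dots> = \<kappa> * card ?Z + (\<Sum>a\<in>X \<times> UNIV. \<Sum>c\<in>continuations X a n. f ([a] @ c))"
    by (simp add: sum.distrib sum_sphere_Suc[OF finite_X])
  also have "(\<Sum>a\<in>X \<times> UNIV. \<Sum>c\<in>continuations X a n. f ([a] @ c))
      \<le> (\<Sum>a\<in>X \<times> (UNIV :: bool set). D * (q ^ Suc l - (1 - \<rho>) * card B) ^ m * q ^ r)"
    unfolding n using \<rho> f(1)
    by (intro sum_mono sum_continuations_bound[where P = P] P_bound P_append P_swap) auto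
  also have "\<dots> = D * \<theta> ^ m * card ?Z"
  proof -
    have "q ^ n = (q ^ Suc l) ^ m * q ^ r" unfolding n by (simp only: power_add power_mult)
    moreover have "\<theta> ^ m * (q ^ Suc l) ^ m = (q ^ Suc l - (1 - \<rho>) * card B) ^ m"
      unfolding power_mult_distrib[symmetric] \<theta>_def using q by simp
    ultimately have "D * (\<theta> ^ m * q ^ n) = D * (q ^ Suc l - (1 - \<rho>) * card B) ^ m * q ^ r"
      by (metis (no_types, lifting) mult.assoc)
    then show ?thesis unfolding Z by (auto simp: card_cartesian_product algebra_simps)
  qed
  finally have "real (card (S \<inter> ?Z)) \<le> (\<kappa> + D * \<theta> ^ m) * card ?Z" by (simp add: algebra_simps)
  then show "density X S (Suc n) \<le> \<kappa> + D * \<theta> ^ (n div Suc l)"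
    unfolding density_def m_def using Zpos by (simp add: pos_divide_le_eq)
qed

end

lemma density_nonneg: "0 \<le> density X S n"
  by (simp add: density_def)

lemma strongly_negligible_wordsI:
  assumes \<theta>: "0 \<le> \<theta>" "\<theta> < 1" and D: "0 \<le> D"
    and bound: "\<And>n. density X S (Suc n) \<le> D * \<theta> ^ (n div Suc l)"
  shows "strongly_negligible_words X S"
proof -
  define \<tau> where "\<tau> = max \<theta> (1/2)"
  have \<tau>: "0 < \<tau>" "\<tau> < 1" "\<theta> \<le> \<tau>" using \<theta> by (auto simp: \<tau>_def)
  define t where "t = (1 / \<tau>) powr (1 / Suc l)"
  have t: "t > 1" unfolding t_def using \<tau> by (simp add: gr_one_powr)
  have tn: "t powr (- real n) = \<tau> powr (real n / Suc l)" for n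
    unfolding t_def using \<tau> by (simp add: powr_powr powr_divide powr_minus_divide)
  have "density X S n \<le> D / \<tau> * t powr (- real n)" if "n \<ge> 1" for n
  proof -
    define k where "k = n - 1"
    have k: "n = Suc k" using that by (simp add: k_def)
    let ?m = "k div Suc l"
    have "real n \<le> real (Suc l * Suc ?m)"
      unfolding k of_nat_le_iff using dividend_less_times_div[of "Suc l" k] by simp
    then have "real n / Suc l \<le> real (Suc ?m)"
      unfolding of_nat_mult by (simp only: divide_le_eq mult.commute of_nat_0_less_iff zero_less_Suc if_True)
    then have "\<tau> powr real (Suc ?m) \<le> \<tau> powr (real n / Suc l)"
      using \<tau> by (intro powr_mono') auto
    then have "\<tau> ^ Suc ?m \<le> t powr (- real n)" unfolding tn using \<tau> by (simp add: powr_realpow del: of_nat_Suc power_Suc)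
    then have le: "\<tau> ^ ?m \<le> t powr (- real n) / \<tau>" using \<tau> by (simp add: pos_le_divide_eq mult.commute)
    have "density X S n \<le> D * \<theta> ^ ?m" using bound k by simp
    also have "\<dots> \<le> D * \<tau> ^ ?m" using \<tau> \<theta> D by (intro mult_left_mono power_mono) auto
    also have "\<dots> \<le> D * (t powr (- real n) / \<tau>)" using D le by (rule mult_left_mono[rotated])
    finally show ?thesis by simp
  qed
  then have "density X S \<in> O(\<lambda>n. t powr (- real n))"
    by (intro bigoI[where c = "D / \<tau>"] eventually_mono[OF eventually_ge_at_top[of 1]])
      (simp add: density_nonneg)
  with t show ?thesis unfolding strongly_negligible_words_def by blast
qed

lemma negligible_wordsI:
  assumes "\<And>\<epsilon>. \<epsilon> > 0 \<Longrightarrow> \<exists>\<theta> D l. 0 \<le> \<theta> \<and> \<theta> < 1 \<and>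
    (\<forall>n. density X S (Suc n) \<le> \<epsilon> + D * \<theta> ^ (n div Suc l))"
  shows "negligible_words X S"
  unfolding negligible_words_def
proof (rule LIMSEQ_offset[of _ 1], rule LIMSEQ_I)
  fix \<epsilon> :: real assume "\<epsilon> > 0"
  then obtain \<theta> D l where b: "0 \<le> \<theta>" "\<theta> < 1" "\<And>n. density X S (Suc n) \<le> \<epsilon> / 2 + D * \<theta> ^ (n div Suc l)"
    using assms[of "\<epsilon> / 2"] by auto
  have "filterlim (\<lambda>n. n div Suc l) at_top sequentially"
    unfolding filterlim_at_top
  proof
    fix Z
    have "Z \<le> n div Suc l" if "Z * Suc l \<le> n" for n
      using div_le_mono[OF that, of "Suc l"] by (simp del: mult_Suc_right)
    then show "\<forall>\<^sub>F n in sequentially. Z \<le> n div Suc l"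
      by (rule eventually_mono[OF eventually_ge_at_top])
  qed
  moreover have "(\<lambda>m. D * \<theta> ^ m) \<longlonglongrightarrow> 0"
    using b by (intro tendsto_mult_right_zero LIMSEQ_power_zero) auto
  ultimately have "(\<lambda>n. D * \<theta> ^ (n div Suc l)) \<longlonglongrightarrow> 0"
    using filterlim_compose by blast
  then have "\<forall>\<^sub>F n in sequentially. D * \<theta> ^ (n div Suc l) < \<epsilon> / 2"
    using \<open>\<epsilon> > 0\<close> by (intro order_tendstoD) auto
  then obtain n0 where n0: "\<And>n. n \<ge> n0 \<Longrightarrow> D * \<theta> ^ (n div Suc l) < \<epsilon> / 2"
    unfolding eventually_sequentially by blast
  have "norm (density X S (n + 1) - 0) < \<epsilon>" if "n \<ge> n0" for n
    using b(3)[of n] n0[OF that] density_nonneg[of X S "Suc n"] by simp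
  then show "\<exists>n0. \<forall>n\<ge>n0. norm (density X S (n + 1) - 0) < \<epsilon>" by blast
qed

section \<open>The exponent of the generators\<close>

context group
begin

text \<open>The powers of \<open>x\<close>, as words, form an infinite computably enumerable set, so two of
  them have the same value.\<close>

lemma generator_finite_order:
  assumes "finite X" "X \<subseteq> carrier G" "algorithmically_finite G X" "x \<in> X"
  obtains n :: nat where "n > 0" "x [^] n = \<one>"
proof -
  let ?w = "\<lambda>n. replicate n (x, True)"
  have x: "x \<in> carrier G" using assms by blast
  have "inj ?w" by (rule injI) (metis length_replicate)
  then have "infinite (range ?w)" using finite_imageD by blast
  moreover have "ce_words X (range ?w)" unfolding ce_words_def
  proof
    show "range ?w \<subseteq> free_words X"
    proof
      fix v assume "v \<in> range ?w"
      then have "set v \<subseteq> X \<times> {True}" using assms(4) by auto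
      then show "v \<in> free_words X"
        using positive_word_reduced[of v X] by (auto simp: free_words_def)
    qed
    have "word_code X ` range ?w = range (\<lambda>n. list_encode (replicate n (letter_code X (x, True))))"
      by (simp add: word_code_map image_image)
    then show "ce_set (word_code X ` range ?w)"
      by (simp only:) (intro ce_set_range computable_intros)
  qed
  ultimately obtain i j where "?w i \<noteq> ?w j" "word_value G (?w i) = word_value G (?w j)"
    using assms(3) unfolding algorithmically_finite_def by blast
  then have ij: "i \<noteq> j" "x [^] i = x [^] j" by (auto simp: word_value_replicate x)
  have "x [^] (b - a) = \<one>" if "a < b" "x [^] a = x [^] b" for a b :: nat
  proof -
    have "x [^] a \<otimes> x [^] (b - a) = x [^] b"
      using that(1) x by (simp add: nat_pow_mult)
    then show ?thesis using x unfolding that(2)[symmetric] by simp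
  qed
  then show thesis using that[of "i - j"] that[of "j - i"] ij by (metis linorder_neqE_nat zero_less_diff)
qed

lemma generators_exponent:
  assumes "finite X" "X \<subseteq> carrier G" "algorithmically_finite G X"
  obtains k :: nat where "k > 0" "\<And>x. x \<in> X \<Longrightarrow> x [^] k = \<one>"
proof -
  have "\<forall>x\<in>X. \<exists>n::nat. n > 0 \<and> x [^] n = \<one>"
    using generator_finite_order[OF assms] by metis
  then obtain n :: "'a \<Rightarrow> nat" where n: "\<And>x. x \<in> X \<Longrightarrow> n x > 0 \<and> x [^] n x = \<one>" by metis
  have "x [^] (\<Prod>x\<in>X. n x) = \<one>" if "x \<in> X" for x
  proof -
    have "(\<Prod>x\<in>X. n x) = n x * (\<Prod>x\<in>X - {x}. n x)" using assms(1) that by (rule prod.remove)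
    moreover have "x [^] (n x * m) = \<one>" for m
      using n[OF that] that assms(2) by (subst nat_pow_pow[symmetric]) auto
    ultimately show ?thesis by simp
  qed
  moreover have "(\<Prod>x\<in>X. n x) > 0" using n by (intro prod_pos) auto
  ultimately show thesis using that by blast
qed

end

section \<open>The density of a thin set\<close>

context torsion_generated
begin

text \<open>A group with one generator, of finite order, is finite. With two generators there is room for
  the inserted letters of \<open>openers\<close>.\<close>

lemma two_generators:
  assumes "infinite (carrier G)" shows "2 \<le> card X"
proof (rule ccontr)
  assume "\<not> 2 \<le> card X"
  then have "\<exists>x. X \<subseteq> {x}" using finite_gens card_le_Suc0_iff_eq by (metis One_nat_def empty_subsetI
      insertCI less_2_cases not_le subsetI singletonD insert_iff card_eq_0_iff le_eq_less_or_eq less_Suc_eq_le numeral_2_eq_2)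
  then obtain x where x: "X \<subseteq> {x}" by blast
  have "carrier G \<subseteq> insert \<one> ((\<lambda>n. x [^] n) ` {..<k})"
  proof
    fix g assume "g \<in> carrier G"
    then obtain w where w: "set w \<subseteq> letters" "val w = g" by (rule positive_representative)
    show "g \<in> insert \<one> ((\<lambda>n. x [^] n) ` {..<k})"
    proof (cases "X = {}")
      case True
      then show ?thesis using w by simp
    next
      case False
      then have xX: "x \<in> X" using x by blast
      then have xc: "x \<in> carrier G" using gens by blast
      have "w = replicate (length w) (x, True)"
        using w(1) x by (intro replicate_eqI) auto
      then have "g = x [^] length w" using w(2) word_value_replicate[OF xc] by metis
      also have "\<dots> = x [^] (k * (length w div k)) \<otimes> x [^] (length w mod k)"
        using xc by (simp add: nat_pow_mult)
      also have "x [^] (k * (length w div k)) = \<one>"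
        using gen_pow[OF xX] xc by (subst nat_pow_pow[symmetric]) auto
      finally show ?thesis using xc k_pos by auto
    qed
  qed
  then show False using assms finite_subset by blast
qed

text \<open>Every element of \<open>E\<close> has a positive representative that is congruent to the empty
  word and has length divisible by \<open>k\<close>. Powers of one letter, with exponents
  divisible by \<open>k\<close>, have no effect on the congruence class; they are used to equalize
  lengths and end letters.\<close>

lemma swap_words:
  assumes "2 \<le> card X" "finite E" "E \<noteq> {}" "E \<subseteq> relator_subgroup u w"
  obtains B l y where "swap_family X B l y" "bij_betw val B E"
    "\<And>x. x \<in> B \<Longrightarrow> thue_congruence (rules u w) x []"
proof -
  obtain y0 where y0: "y0 \<in> X" using assms(1) by fastforce
  then have y0c: "y0 \<in> carrier G" using gens by blast
  let ?y = "(y0, True)"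
  have "\<forall>g\<in>E. \<exists>z. z \<in> pos_words \<and> thue_congruence (rules u w) z [] \<and> val z = g"
    using assms(4) unfolding relator_subgroup_def by blast
  then obtain z where z: "\<And>g. g \<in> E \<Longrightarrow> z g \<in> pos_words"
    "\<And>g. g \<in> E \<Longrightarrow> thue_congruence (rules u w) (z g) []" "\<And>g. g \<in> E \<Longrightarrow> val (z g) = g" by metis
  define L where "L = (\<Sum>g\<in>E. length (z g))"
  have len: "length (z g) \<le> L" if "g \<in> E" for g
    unfolding L_def using assms(2) that by (intro member_le_sum) auto
  have dvd: "k dvd length (z g)" if "g \<in> E" for g using z(1)[OF that] by (simp add: pos_words_def)
  then have "k dvd L" unfolding L_def by (rule dvd_sum)
  define pad where "pad = (\<lambda>g. k + (L - length (z g)))"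
  have pad: "k dvd pad g" if "g \<in> E" for g
    unfolding pad_def using dvd[OF that] \<open>k dvd L\<close> by (simp add: dvd_diff_nat)
  define x where "x = (\<lambda>g. replicate k ?y @ z g @ replicate (pad g) ?y)"
  have letters_x: "set (x g) \<subseteq> letters" if "g \<in> E" for g
    unfolding x_def using z(1)[OF that] y0 by (auto simp: pos_words_def)
  have pow: "val (replicate n ?y) = \<one>" if "k dvd n" for n
  proof -
    from \<open>k dvd n\<close> obtain m where "n = k * m" by (rule dvdE)
    then have "y0 [^] n = \<one>" using gen_pow[OF y0] y0c by (metis nat_pow_one nat_pow_pow)
    then show ?thesis by (simp add: word_value_replicate y0c)
  qed
  have val_x: "val (x g) = g" if "g \<in> E" for g
  proof -
    have zl: "set (z g) \<subseteq> letters" using pos_words_letters[OF z(1)[OF that]] .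
    moreover have "g \<in> carrier G" using val_closed[OF zl] z(3)[OF that] by simp
    moreover have "set (replicate n ?y) \<subseteq> letters" for n using y0 by auto
    ultimately show ?thesis unfolding x_def using z(3)[OF that] pow[of k] pow[OF pad[OF that]]
      by (simp add: val_append del: set_replicate)
  qed
  have cong: "thue_congruence (rules u w) (x g) []" if "g \<in> E" for g
  proof -
    have "thue_congruence (rules u w) (replicate k ?y) []" "thue_congruence (rules u w) (replicate (pad g) ?y) []"
      using y0 pad[OF that] by (auto intro: thue_congruence_power)
    then have "thue_congruence (rules u w) (replicate k ?y @ z g @ replicate (pad g) ?y) ([] @ [] @ [])"
      using z(2)[OF that] by (intro thue_congruence_append)
    then show ?thesis by (simp add: x_def)
  qed
  have "swap_family X (x ` E) (2 * k + L) ?y"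
  proof
    fix b assume "b \<in> x ` E"
    then obtain g where g: "g \<in> E" "b = x g" by blast
    have "hd b = ?y" "last b = ?y" "b \<noteq> []"
      using k_pos unfolding g(2) x_def pad_def by (auto simp: hd_append last_append)
    moreover have "length b = 2 * k + L" unfolding g(2) x_def pad_def using len[OF g(1)] by simp
    ultimately show "set b \<subseteq> X \<times> UNIV \<and> reduced b \<and> length b = 2 * k + L \<and> b \<noteq> [] \<and> hd b = ?y \<and> last b = ?y"
      using letters_x[OF g(1)] letters_UNIV positive_word_reduced[of b X] g(2) by blast
  qed (use assms finite_gens in auto)
  moreover have "bij_betw val (x ` E) E"
    unfolding bij_betw_def using val_x by (auto simp: inj_on_def image_image)
  ultimately show thesis using that cong by blast
qed

text \<open>Words that differ only in one block \<open>x \<in> B\<close> are congruent and have distinct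
  values, so at most one of them lies in \<open>S\<close>. Hence the indicator function of
  \<open>S\<close>, diminished by \<open>1 / n\<close> with \<open>n = card B\<close>, has a
  nonpositive sum over the exchanges of a single block: \<open>density_bound\<close> applies with
  \<open>\<rho> = 0\<close>.\<close>

lemma infinite_relator_subgroup_negligible:
  assumes X: "2 \<le> card X" and inf: "infinite (relator_subgroup u w)"
    and thin: "\<forall>a\<in>S. \<forall>b\<in>S. thue_congruence (rules u w) a b \<longrightarrow> val a = val b"
  shows "negligible_words X S"
proof (rule negligible_wordsI)
  fix \<epsilon> :: real assume \<epsilon>: "\<epsilon> > 0"
  obtain n where n: "1 / \<epsilon> < real n" using reals_Archimedean2 by blast
  have npos: "n > 0" using n \<epsilon> by (metis divide_pos_pos gr0I less_asym of_nat_0 zero_less_one)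
  obtain E where E: "E \<subseteq> relator_subgroup u w" "finite E" "card E = n"
    using infinite_arbitrarily_large[OF inf] by blast
  obtain B l y where fam: "swap_family X B l y" and bij: "bij_betw val B E"
    and cong: "\<And>x. x \<in> B \<Longrightarrow> thue_congruence (rules u w) x []"
    using swap_words[OF X E(2) _ E(1)] npos E(3) by (metis card.empty less_numeral_extra(3))
  interpret swap_family X B l y by (rule fam)
  have cardB: "card B = n" using bij_betw_same_card[OF bij] E(3) by simp
  have unique: "x = x'" if uv: "set a \<subseteq> X \<times> UNIV" "set b \<subseteq> X \<times> UNIV" and x: "x \<in> B" "x' \<in> B"
    and S: "a @ x @ b \<in> S" "a @ x' @ b \<in> S" for a b x x'
  proof -
    have "thue_congruence (rules u w) (a @ x @ b) (a @ [] @ b)" "thue_congruence (rules u w) (a @ x' @ b) (a @ [] @ b)"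
      using cong x by (simp_all only: thue_congruence_context)
    then have "thue_congruence (rules u w) (a @ x @ b) (a @ x' @ b)"
      using thue_congruence_sym rtranclp_trans by metis
    then have "val (a @ x @ b) = val (a @ x' @ b)" using thin S by blast
    moreover have "set x \<subseteq> X \<times> UNIV" "set x' \<subseteq> X \<times> UNIV" using B_word x by auto
    moreover note uv
    moreover note word_value_closed[OF gens]
    ultimately have "val x = val x'" by (simp add: word_value_append[OF gens])
    then show ?thesis using bij x by (auto simp: bij_betw_def inj_on_def)
  qed
  \<comment> \<open>After the first exchange the constant is 0, and only the upper bound 0 is kept.\<close>
  define P where "P = (\<lambda>D f. (D = 0 \<and> (\<forall>c. set c \<subseteq> X \<times> UNIV \<longrightarrow> f c \<le> 0)) \<or>
    (D = (1::real) \<and> (\<forall>c. set c \<subseteq> X \<times> UNIV \<longrightarrow> f c \<le> 1) \<and>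
      (\<forall>a b. set a \<subseteq> X \<times> UNIV \<longrightarrow> set b \<subseteq> X \<times> UNIV \<longrightarrow> (\<Sum>x\<in>B. f (a @ x @ b)) \<le> (0::real))))"
  have "\<exists>\<theta>. 0 \<le> \<theta> \<and> \<theta> < 1 \<and> (\<forall>m. density X S (Suc m) \<le> 1 / n + 1 * \<theta> ^ (m div Suc l))"
  proof (rule density_bound[where P = P and \<rho> = 0 and D = 1 and f = "\<lambda>c. of_bool (c \<in> S) - 1 / n" and \<kappa> = "1 / n" and S = S])
    show "P 1 (\<lambda>c. of_bool (c \<in> S) - 1 / n)"
    proof -
      have "(\<Sum>x\<in>B. of_bool (a @ x @ b \<in> S) - 1 / real n) \<le> 0"
        if "set a \<subseteq> X \<times> UNIV" "set b \<subseteq> X \<times> UNIV" for a b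
      proof -
        let ?C = "{x \<in> B. a @ x @ b \<in> S}"
        have "card ?C \<le> 1"
          using unique[OF that] finite_B by (intro card_le_Suc0_iff_eq[THEN iffD2, simplified, folded One_nat_def]) auto
        moreover have "(\<Sum>x\<in>B. of_bool (a @ x @ b \<in> S)) = real (card ?C)"
          using finite_B by (simp add: of_bool_def sum.If_cases Int_def)
        ultimately show ?thesis using npos cardB by (simp add: sum_subtractf)
      qed
      moreover have "of_bool (c \<in> S) - 1 / real n \<le> 1" for c
        using order_trans[of "of_bool (c \<in> S) - 1 / real n" "of_bool (c \<in> S)" 1] by simp
      ultimately show ?thesis unfolding P_def by simp
    qed
    show "P (0 * real (card B) * D) (\<lambda>c. \<Sum>x\<in>B. f (e # x @ c))" if "P D f" "e \<in> X \<times> UNIV" for D f e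
    proof -
      have "(\<Sum>x\<in>B. f (e # x @ c)) \<le> 0" if c: "set c \<subseteq> X \<times> UNIV" for c
      proof (cases "D = 0")
        case True
        have "set (e # x @ c) \<subseteq> X \<times> UNIV" if "x \<in> B" for x
          using that \<open>e \<in> _\<close> B_word c by simp
        then show ?thesis using \<open>P D f\<close> True unfolding P_def
          by (intro sum_nonpos) (metis zero_neq_one)
      next
        case False
        then have "(\<Sum>x\<in>B. f ([e] @ x @ c)) \<le> 0"
          using \<open>P D f\<close> \<open>e \<in> _\<close> c unfolding P_def by (metis empty_set empty_subsetI insert_subset list.simps(15))
        then show ?thesis by simp
      qed
      then show ?thesis unfolding P_def by simp
    qed
    show "P D (\<lambda>c. f (b @ c))" if "P D f" "set b \<subseteq> X \<times> UNIV" for D f b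
      using that unfolding P_def by (auto simp flip: append_assoc)
    show "0 \<le> D \<and> f c \<le> D" if "P D f" "set c \<subseteq> X \<times> UNIV" for D f c
      using that unfolding P_def by auto
  qed auto
  then obtain \<theta> where \<theta>: "0 \<le> \<theta>" "\<theta> < 1"
    "\<And>m. density X S (Suc m) \<le> 1 / n + 1 * \<theta> ^ (m div Suc l)" by blast
  have "1 / real n \<le> \<epsilon>" using n \<epsilon> npos by (simp add: field_simps)
  then have "\<forall>m. density X S (Suc m) \<le> \<epsilon> + 1 * \<theta> ^ (m div Suc l)" using \<theta>(3) by (meson add_right_mono order_trans)
  with \<theta>(1,2) show "\<exists>\<theta> D l. 0 \<le> \<theta> \<and> \<theta> < 1 \<and> (\<forall>n. density X S (Suc n) \<le> \<epsilon> + D * \<theta> ^ (n div Suc l))"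
    by blast
qed

text \<open>The indicator function of \<open>S\<close> is at most \<open>W c (val c)\<close>, where \<open>W
  c\<close> is the indicator function of the only value that words of \<open>S\<close> congruent
  to \<open>c\<close> can have. The weight \<open>W c\<close> has norm at most 1 and does not
  change under exchanges of blocks. So summation over the exchanges of one block turns \<open>W
  c\<close> into a sum of its translates by \<open>E\<close>, whose norm is governed by
  \<open>not_reiter_contraction\<close>.\<close>

lemma not_reiter_relator_subgroup_strongly_negligible:
  assumes X: "2 \<le> card X" and not: "\<not> reiter (relator_subgroup u w)"
    and thin: "\<forall>a\<in>S. \<forall>b\<in>S. thue_congruence (rules u w) a b \<longrightarrow> val a = val b"
  shows "strongly_negligible_words X S"
proof -
  have sub: "subgroup (relator_subgroup u w) G"
    using relator_subgroup_normal normal_imp_subgroup by blast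
  obtain E and \<rho> :: real where E: "finite E" "E \<subseteq> relator_subgroup u w" "E \<noteq> {}" and \<rho>: "0 \<le> \<rho>" "\<rho> < 1"
    and contraction: "\<And>f D. l2_bound f D \<Longrightarrow> l2_bound (\<lambda>h. \<Sum>g\<in>E. f (g \<otimes> h)) (\<rho> * card E * D)"
    using not_reiter_contraction[OF sub not] by blast
  obtain B l y where fam: "swap_family X B l y" and bij: "bij_betw val B E"
    and cong: "\<And>x. x \<in> B \<Longrightarrow> thue_congruence (rules u w) x []"
    using swap_words[OF X E(1,3,2)] by blast
  interpret swap_family X B l y by (rule fam)
  have cardB: "card B = card E" using bij_betw_same_card[OF bij] .
  have swap: "thue_congruence (rules u w) (a @ x @ b) (a @ x' @ b)" if "x \<in> B" "x' \<in> B" for a b x x'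
    using thue_congruence_context[of "rules u w" x x'] cong[OF that(1)]
      thue_congruence_sym[OF cong[OF that(2)]] by (meson rtranclp_trans)
  define P where "P = (\<lambda>D f. 0 \<le> D \<and> (\<exists>W. (\<forall>c. set c \<subseteq> X \<times> UNIV \<longrightarrow> l2_bound (W c) D \<and> f c = W c (val c)) \<and>
    (\<forall>a b. \<forall>x\<in>B. \<forall>x'\<in>B. W (a @ x @ b) = W (a @ x' @ b))))"
  define W0 where "W0 = (\<lambda>c g. of_bool (\<exists>s\<in>S. thue_congruence (rules u w) s c \<and> val s = g) :: real)"
  have "\<exists>\<theta>. 0 \<le> \<theta> \<and> \<theta> < 1 \<and> (\<forall>m. density X S (Suc m) \<le> 0 + 1 * \<theta> ^ (m div Suc l))"
  proof (rule density_bound[where P = P and \<rho> = \<rho> and D = 1 and f = "\<lambda>c. W0 c (val c)" and \<kappa> = 0 and S = S, OF \<rho>])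
    show "P 1 (\<lambda>c. W0 c (val c))"
    proof -
      have "l2_bound (W0 c) 1" for c
      proof (cases "\<exists>s\<in>S. thue_congruence (rules u w) s c")
        case True
        then obtain s where s: "s \<in> S" "thue_congruence (rules u w) s c" by blast
        have "val t = val s" if "t \<in> S" "thue_congruence (rules u w) t c" for t
          using thin that(1) s(1) rtranclp_trans[OF that(2) thue_congruence_sym[OF s(2)]] by blast
        then have "(\<exists>t\<in>S. thue_congruence (rules u w) t c \<and> val t = g) \<longleftrightarrow> g = val s" for g
          using s by metis
        then have W0: "W0 c = (\<lambda>g. of_bool (g = val s))" unfolding W0_def by simp
        have "(\<Sum>g\<in>Y. (of_bool (g = val s))\<^sup>2) \<le> (1 :: real)" if "finite Y" for Y
        proof -
          have "(\<Sum>g\<in>Y. (of_bool (g = val s))\<^sup>2) = (\<Sum>g\<in>Y. if g = val s then 1 else 0 :: real)"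
            by (intro sum.cong) auto
          then show ?thesis using that by simp
        qed
        then show ?thesis unfolding W0 l2_bound_def by simp
      next
        case False
        then have "W0 c = (\<lambda>g. 0)" unfolding W0_def by (auto simp: fun_eq_iff)
        then show ?thesis unfolding l2_bound_def by simp
      qed
      then have "\<forall>c. set c \<subseteq> X \<times> UNIV \<longrightarrow> l2_bound (W0 c) 1 \<and> W0 c (val c) = W0 c (val c)" by simp
      moreover have "\<forall>a b. \<forall>x\<in>B. \<forall>x'\<in>B. W0 (a @ x @ b) = W0 (a @ x' @ b)"
      proof (intro allI ballI)
        fix a b x x' assume x: "x \<in> B" "x' \<in> B"
        have "thue_congruence (rules u w) s (a @ x @ b) \<longleftrightarrow> thue_congruence (rules u w) s (a @ x' @ b)" for s
          using swap[OF x, of a b] swap[OF x(2,1), of a b] by (meson rtranclp_trans)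
        then show "W0 (a @ x @ b) = W0 (a @ x' @ b)" unfolding W0_def by simp
      qed
      ultimately show ?thesis unfolding P_def by (intro conjI exI[of _ W0]) (simp, assumption+)
    qed
    show "of_bool (v \<in> S) \<le> 0 + W0 v (val v)" for v unfolding W0_def by auto
  next
    fix D f e assume "P D f" and e: "e \<in> X \<times> (UNIV :: bool set)"
    then obtain W where D: "0 \<le> D" and W: "\<And>c. set c \<subseteq> X \<times> UNIV \<Longrightarrow> l2_bound (W c) D \<and> f c = W c (val c)"
      and Wswap: "\<And>a b x x'. x \<in> B \<Longrightarrow> x' \<in> B \<Longrightarrow> W (a @ x @ b) = W (a @ x' @ b)"
      unfolding P_def by blast
    obtain x0 where x0: "x0 \<in> B" using B_nonempty by blast
    have el: "set [e] \<subseteq> X \<times> UNIV" using e by simp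
    have ec: "val [e] \<in> carrier G" by (rule word_value_closed[OF gens el])
    define W' where "W' = (\<lambda>c h. \<Sum>g\<in>E. W ([e] @ x0 @ c) (val [e] \<otimes> (g \<otimes> h)))"
    have l2: "l2_bound (W' c) (\<rho> * card B * D)" if c: "set c \<subseteq> X \<times> UNIV" for c
    proof -
      have "set ([e] @ x0 @ c) \<subseteq> X \<times> UNIV" using el c B_word[OF x0] by simp
      then have "l2_bound (\<lambda>h. W ([e] @ x0 @ c) (val [e] \<otimes> h)) D"
        using W l2_bound_translate ec by blast
      then show ?thesis unfolding W'_def cardB by (rule contraction)
    qed
    have val: "(\<Sum>x\<in>B. f (e # x @ c)) = W' c (val c)" if c: "set c \<subseteq> X \<times> UNIV" for c
    proof -
      have "f (e # x @ c) = W ([e] @ x0 @ c) (val [e] \<otimes> (val x \<otimes> val c))" if x: "x \<in> B" for x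
      proof -
        have xl: "set x \<subseteq> X \<times> UNIV" using B_word x by blast
        have "set ([e] @ x @ c) \<subseteq> X \<times> UNIV" using el xl c by simp
        then have "f ([e] @ x @ c) = W ([e] @ x @ c) (val ([e] @ x @ c))" using W by blast
        also have "W ([e] @ x @ c) = W ([e] @ x0 @ c)" using Wswap x x0 by blast
        also have "val ([e] @ x @ c) = val [e] \<otimes> (val x \<otimes> val c)"
          using el xl c by (subst word_value_append[OF gens], simp, simp, subst word_value_append[OF gens]) auto
        finally show ?thesis by simp
      qed
      then have "(\<Sum>x\<in>B. f (e # x @ c)) = (\<Sum>x\<in>B. W ([e] @ x0 @ c) (val [e] \<otimes> (val x \<otimes> val c)))" by simp
      also have "\<dots> = W' c (val c)" unfolding W'_def by (rule sum.reindex_bij_betw[OF bij])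
      finally show ?thesis .
    qed
    have W'swap: "W' (a @ x @ b) = W' (a @ x' @ b)" if "x \<in> B" "x' \<in> B" for a b x x'
      unfolding W'_def using Wswap[OF that, of "[e] @ x0 @ a" b] by simp
    have "\<forall>a b. \<forall>x\<in>B. \<forall>x'\<in>B. W' (a @ x @ b) = W' (a @ x' @ b)" by (intro allI ballI W'swap)
    moreover have "0 \<le> \<rho> * card B * D" using \<rho> D by simp
    moreover have "\<forall>c. set c \<subseteq> X \<times> UNIV \<longrightarrow>
        l2_bound (W' c) (\<rho> * card B * D) \<and> (\<Sum>x\<in>B. f (e # x @ c)) = W' c (val c)"
      using l2 val by blast
    ultimately show "P (\<rho> * real (card B) * D) (\<lambda>c. \<Sum>x\<in>B. f (e # x @ c))"
      unfolding P_def by blast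
  next
    fix D f b assume "P D f" and b: "set b \<subseteq> X \<times> (UNIV :: bool set)"
    then obtain W where D: "0 \<le> D" and W: "\<And>c. set c \<subseteq> X \<times> UNIV \<Longrightarrow> l2_bound (W c) D \<and> f c = W c (val c)"
      and Wswap: "\<And>a b x x'. x \<in> B \<Longrightarrow> x' \<in> B \<Longrightarrow> W (a @ x @ b) = W (a @ x' @ b)"
      unfolding P_def by blast
    define W' where "W' = (\<lambda>c h. W (b @ c) (val b \<otimes> h))"
    have l2: "l2_bound (W' c) D \<and> f (b @ c) = W' c (val c)" if c: "set c \<subseteq> X \<times> UNIV" for c
    proof -
      have "set (b @ c) \<subseteq> X \<times> UNIV" using b c by simp
      then show ?thesis unfolding W'_def
        using W l2_bound_translate word_value_closed[OF gens b] word_value_append[OF gens b c] by metis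
    qed
    have W'swap: "W' (a @ x @ b') = W' (a @ x' @ b')" if "x \<in> B" "x' \<in> B" for a b' x x'
      unfolding W'_def using Wswap[OF that, of "b @ a" b'] by simp
    have "\<forall>a b'. \<forall>x\<in>B. \<forall>x'\<in>B. W' (a @ x @ b') = W' (a @ x' @ b')" by (intro allI ballI W'swap)
    moreover have "\<forall>c. set c \<subseteq> X \<times> UNIV \<longrightarrow> l2_bound (W' c) D \<and> f (b @ c) = W' c (val c)"
      using l2 by blast
    ultimately show "P D (\<lambda>c. f (b @ c))" using D unfolding P_def by blast
  next
    fix D f c assume "P D f" "set c \<subseteq> X \<times> (UNIV :: bool set)"
    then show "0 \<le> D \<and> f c \<le> D"
      unfolding P_def using l2_bound_point word_value_closed[OF gens] by metis
  qed auto
  then obtain \<theta> where "0 \<le> \<theta>" "\<theta> < 1" "\<And>m. density X S (Suc m) \<le> 1 * \<theta> ^ (m div Suc l)" by auto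
  then show ?thesis by (intro strongly_negligible_wordsI[where \<theta> = \<theta> and D = 1 and l = l]) auto
qed

end

theorem theorem1p3:
  fixes G :: "('a, 'm) monoid_scheme" and X :: "'a set" and S :: "'a word set"
  assumes "group G"
    and "infinite (carrier G)"
    and "finite X" and "X \<subseteq> carrier G" and "generate G X = carrier G"
    and "algorithmically_finite G X"
    and "S \<subseteq> free_words X"
    and "EP_decidable_on G X S"
  shows "negligible_words X S \<and> (\<not> amenable G \<longrightarrow> strongly_negligible_words X S)"
proof -
  interpret group G by (rule assms(1))
  obtain k :: nat where k: "k > 0" "\<And>x. x \<in> X \<Longrightarrow> x [^]\<^bsub>G\<^esub> k = \<one>\<^bsub>G\<^esub>"
    using generators_exponent[OF assms(3,4,6)] by blast
  interpret torsion_generated G X k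
    using assms k by unfold_locales auto
  note X = two_generators[OF assms(2)]
  let ?fin = "\<lambda>K. K \<lhd> G \<and> finite K" and ?reiter = "\<lambda>K. K \<lhd> G \<and> reiter K"
  have join: "\<exists>M. ?fin M \<and> K \<subseteq> M \<and> L \<subseteq> M" if "?fin K" "?fin L" for K L
    using that normal_set_mult[of K L] finite_set_mult[of K L]
    by (intro exI[of _ "K <#>\<^bsub>G\<^esub> L"]) simp
  have index: "T <#>\<^bsub>G\<^esub> K \<noteq> carrier G" if "?fin K" "finite T" "T \<subseteq> carrier G" for K T
    using that finite_set_mult[of T K] assms(2) by auto
  have triv: "?fin {\<one>\<^bsub>G\<^esub>}" using one_is_normal by simp
  obtain u w where uw: "u \<in> pos_words" "w \<in> pos_words" "\<not> ?fin (relator_subgroup u w)"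
    "\<forall>a\<in>S. \<forall>b\<in>S. thue_congruence (rules u w) a b \<longrightarrow> val a = val b"
    by (rule unseparated_pair_exists[OF assms(6,8,7) conjunct1 triv join index])
  have neg: "negligible_words X S"
    using uw(3) relator_subgroup_normal by (intro infinite_relator_subgroup_negligible[OF X _ uw(4)]) simp
  have "strongly_negligible_words X S" if nonamenable: "\<not> amenable G"
  proof -
    have join: "\<exists>M. ?reiter M \<and> K \<subseteq> M \<and> L \<subseteq> M" if "?reiter K" "?reiter L" for K L
    proof -
      have "K \<subseteq> carrier G" using that normal_imp_subgroup subgroup.subset by blast
      then have "reiter (K <#>\<^bsub>G\<^esub> L)" using that reiter_set_mult by simp
      then show ?thesis
        using that normal_set_mult[of K L] by (intro exI[of _ "K <#>\<^bsub>G\<^esub> L"]) simp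
    qed
    have index: "T <#>\<^bsub>G\<^esub> K \<noteq> carrier G" if "?reiter K" "finite T" "T \<subseteq> carrier G" for K T
      using that reiter_finite_index[of K T] reiter_imp_amenable nonamenable by auto
    have triv: "?reiter {\<one>\<^bsub>G\<^esub>}" using one_is_normal reiter_trivial by simp
    obtain u w where uw: "u \<in> pos_words" "w \<in> pos_words" "\<not> ?reiter (relator_subgroup u w)"
      "\<forall>a\<in>S. \<forall>b\<in>S. thue_congruence (rules u w) a b \<longrightarrow> val a = val b"
      by (rule unseparated_pair_exists[OF assms(6,8,7) conjunct1 triv join index])
    show ?thesis
      using uw(3) relator_subgroup_normal
      by (intro not_reiter_relator_subgroup_strongly_negligible[OF X _ uw(4)]) simp
  qed
  with neg show ?thesis by blast
qed

end
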